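(* There is an absolute constant $C>0$ such that the following holds. Let $p$ be an odd prime, $F=\mathbb{F}_p$, $t\in F$ with $t\neq0$, and let $A\subseteq\mathcal S^3_t$. Then $$\mathsf E(A)\ \le\ C\left(\frac{|A|^3}{p}+|A|^{5/2}+|A|k_0^2+|A|^2k_0\right),$$ where $k_0$ is the maximum number of points of $A$ on an isotropic line.
   Context: For $t\neq 0$, $\mathcal S^3_t=\{x\in F^4:\ x_1^2+x_2^2+x_3^2+x_4^2=t\}$. The additive energy of a finite set $A\subset F^4$ is $\mathsf E(A)=|\{(x,y,z,u)\in A^4:\ x+y=z+u\}|$. A nonzero vector $s\in F^4$ is isotropic if $s\cdot s=0$ for the standard dot product; an isotropic line is an affine line in $F^4$ whose direction vector is isotropic. *)

theory Defs
  imports Complex_Main "HOL-Number_Theory.Residues"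
begin

text \<open>
  The prime field with \<open>p\<close> elements is \<open>residue_ring p\<close>, a ring structure on the integers
  \<open>0, \<dots>, p - 1\<close>. It is used instead of a type-level field because the constant of the
  theorem has to be chosen before \<open>p\<close>. Everything below is stated over an arbitrary ring \<open>R\<close>
  and is meant to be used on vectors with entries in \<open>carrier R\<close>.
\<close>

type_synonym 'a vec4 = "'a \<times> 'a \<times> 'a \<times> 'a"

definition space4 :: "('a, 'b) ring_scheme \<Rightarrow> 'a vec4 set" where
  "space4 R = carrier R \<times> carrier R \<times> carrier R \<times> carrier R"

definition zero4 :: "('a, 'b) ring_scheme \<Rightarrow> 'a vec4" where
  "zero4 R = (\<zero>\<^bsub>R\<^esub>, \<zero>\<^bsub>R\<^esub>, \<zero>\<^bsub>R\<^esub>, \<zero>\<^bsub>R\<^esub>)"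

fun add4 :: "('a, 'b) ring_scheme \<Rightarrow> 'a vec4 \<Rightarrow> 'a vec4 \<Rightarrow> 'a vec4" where
  "add4 R (x1, x2, x3, x4) (y1, y2, y3, y4) =
     (x1 \<oplus>\<^bsub>R\<^esub> y1, x2 \<oplus>\<^bsub>R\<^esub> y2, x3 \<oplus>\<^bsub>R\<^esub> y3, x4 \<oplus>\<^bsub>R\<^esub> y4)"

fun scale4 :: "('a, 'b) ring_scheme \<Rightarrow> 'a \<Rightarrow> 'a vec4 \<Rightarrow> 'a vec4" where
  "scale4 R c (x1, x2, x3, x4) =
     (c \<otimes>\<^bsub>R\<^esub> x1, c \<otimes>\<^bsub>R\<^esub> x2, c \<otimes>\<^bsub>R\<^esub> x3, c \<otimes>\<^bsub>R\<^esub> x4)"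

fun dot4 :: "('a, 'b) ring_scheme \<Rightarrow> 'a vec4 \<Rightarrow> 'a vec4 \<Rightarrow> 'a" where
  "dot4 R (x1, x2, x3, x4) (y1, y2, y3, y4) =
     (x1 \<otimes>\<^bsub>R\<^esub> y1) \<oplus>\<^bsub>R\<^esub> (x2 \<otimes>\<^bsub>R\<^esub> y2) \<oplus>\<^bsub>R\<^esub> (x3 \<otimes>\<^bsub>R\<^esub> y3) \<oplus>\<^bsub>R\<^esub> (x4 \<otimes>\<^bsub>R\<^esub> y4)"

definition sphere3 :: "('a, 'b) ring_scheme \<Rightarrow> 'a \<Rightarrow> 'a vec4 set" where
  "sphere3 R t = {(x1, x2, x3, x4). (x1, x2, x3, x4) \<in> space4 R \<and>
     x1 [^]\<^bsub>R\<^esub> (2::nat) \<oplus>\<^bsub>R\<^esub> x2 [^]\<^bsub>R\<^esub> (2::nat) \<oplus>\<^bsub>R\<^esub> x3 [^]\<^bsub>R\<^esub> (2::nat) \<oplus>\<^bsub>R\<^esub> x4 [^]\<^bsub>R\<^esub> (2::nat) = t}"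

definition additive_energy :: "('a, 'b) ring_scheme \<Rightarrow> 'a vec4 set \<Rightarrow> nat" where
  "additive_energy R A =
     card {(x, y, z, u). x \<in> A \<and> y \<in> A \<and> z \<in> A \<and> u \<in> A \<and> add4 R x y = add4 R z u}"

definition isotropic :: "('a, 'b) ring_scheme \<Rightarrow> 'a vec4 \<Rightarrow> bool" where
  "isotropic R s \<longleftrightarrow> s \<in> space4 R \<and> s \<noteq> zero4 R \<and> dot4 R s s = \<zero>\<^bsub>R\<^esub>"

definition affine_line :: "('a, 'b) ring_scheme \<Rightarrow> 'a vec4 \<Rightarrow> 'a vec4 \<Rightarrow> 'a vec4 set" where
  "affine_line R a s = {add4 R a (scale4 R c s) | c. c \<in> carrier R}"

definition isotropic_lines :: "('a, 'b) ring_scheme \<Rightarrow> 'a vec4 set set" where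
  "isotropic_lines R = {affine_line R a s | a s. a \<in> space4 R \<and> isotropic R s}"

text \<open>
  Over a finite field the set under \<open>Max\<close> is finite, and it is nonempty because the form
  \<open>x1^2 + x2^2 + x3^2 + x4^2\<close> has a nontrivial zero over every finite field.
\<close>

definition max_isotropic :: "('a, 'b) ring_scheme \<Rightarrow> 'a vec4 set \<Rightarrow> nat" where
  "max_isotropic R A = Max {card (A \<inter> L) | L. L \<in> isotropic_lines R}"

end

theory Submission
  imports Defs "HOL-Computational_Algebra.Computational_Algebra" "HOL-Library.Product_Plus" "HOL-Analysis.Convex"
begin

text \<open>
A solution of \<open>x + y = z + u\<close> on the sphere is a rectangle: the sides \<open>x - z\<close> and \<open>y - z\<close> are orthogonal,
  because all four points have the same norm. Rectangles with an isotropic side are few, since the isotropic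
  chords through a point of the sphere that lie in a given plane form at most two lines (\<open>card_isotropic_in_plane_le\<close>). For the
  other rectangles fix the vertex \<open>z\<close>. Projecting the sphere from \<open>z\<close> turns the pairs \<open>(x, y)\<close> into incidences between
  \<open>n = |A|\<close> points and \<open>n\<close> planes of three-space (\<open>pinned_incidence\<close>). If no line contains more than \<open>Q\<close> of the points,
  with \<open>Q \<ge> sqrt n\<close>, and \<open>p\<close> is large compared with \<open>Q\<close>, there are \<open>O(n Q)\<close> incidences
  (\<open>card_point_plane_incidences_le\<close>, a form of Rudnev's theorem). Summation over \<open>z\<close> gives \<open>O(n^2 Q)\<close> rectangles. Lines
  of the projection are plane sections of the sphere. A section with more than \<open>Q > 3 k0\<close> points contains no isotropic
  chord, hence it is involved in only \<open>O(n^2)\<close> rectangles (\<open>card_rectangles_vertex_in_section_le\<close>) and can be deleted;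
  this happens at most \<open>n / Q\<close> times. With \<open>Q\<close> about \<open>sqrt n + 3 k0\<close> this is the bound. If \<open>p\<close> is not large compared
  with \<open>Q\<close>, the second moment of the incidence numbers gives \<open>n^3 / p + O(p n^2)\<close>, and \<open>p n^2 = O(n^2 Q)\<close>.

  The incidence theorem is proved with the polynomial method. A light ray is a line with a direction \<open>(1, a, a^2)\<close>, on
  the cone \<open>y^2 = x w\<close>. Points and planes are represented by light rays in such a way that incidence means that the
  rays meet. The representation depends on a parameter \<open>\<tau>\<close>, and for a suitable \<open>\<tau>\<close> few rays of one kind pass through a
  common point. If there were too many incidences, a pruned subfamily would consist of rays each of which meets the
  others in many more than \<open>d\<close> distinct points, where \<open>d = O(Q)\<close>, with \<open>d < p\<close>, is the least degree of a nonzero polynomial \<open>f\<close>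
  that vanishes on the family.

  At a nonsingular point of \<open>f = 0\<close> where two rays meet, their directions are the two light-like tangent directions,
  and the second derivative of \<open>f\<close> vanishes in both. A polynomial identity that holds at more points of a ray than its
  degree holds along the whole ray. So both light-like tangent directions are asymptotic along every ray: the surface
  is umbilic there for the form \<open>y^2 - x w\<close>. In classical geometry an umbilic surface is a plane or a sphere. Here only
  the infinitesimal form of this on one ray is used (\<open>umbilic_at_cross\<close>): if \<open>a\<close> is the slope of the ray and \<open>a'\<close>
  the slope of the other light-like tangent direction, then \<open>1 / (a' - a)\<close> has second derivative zero along the ray.
  As the degrees are below \<open>p\<close>, it is an affine function, and this says that the points (or planes) whose
  rays meet the given ray are collinear, which contradicts the bound on collinear points. Minimality of the degree
  provides a ray on which the gradient of \<open>f\<close> does not vanish identically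
  (\<open>ex_minimal_poly3_vanishing_on_rays\<close>), and every ray crossing it at a nonsingular point is again nonsingular, so that
  no factorisation of \<open>f\<close> and no theory of ruled surfaces enters.

  The field with \<open>p\<close> elements is handled as the integers modulo \<open>p\<close> throughout: \<open>a = 0\<close> in the field is \<open>p dvd a\<close>, and a
  polynomial is zero if \<open>[:p:]\<close> divides it.
\<close>

section \<open>Univariate polynomials modulo a prime\<close>

lemma const_prime_dvd_mult_iff:
  fixes p :: int
  assumes "prime p"
  shows "[:p:] dvd g * h \<longleftrightarrow> [:p:] dvd g \<or> [:p:] dvd h"
  using assms by (intro prime_elem_dvd_mult_iff prime_elem_const_poly_iff[THEN iffD2] prime_imp_prime_elem)

lemma const_dvd_poly: "[:p:] dvd g \<Longrightarrow> p dvd poly g x" for p :: int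
  by (auto simp: dvd_def)

lemma const_dvd_pderiv: "[:p:] dvd g \<Longrightarrow> [:p:] dvd pderiv g" for p :: int
  by (simp add: const_poly_dvd_iff coeff_pderiv)

lemma not_dvd_diff_residues:
  fixes x y p :: int
  assumes "x \<in> {0..<p}" "y \<in> {0..<p}" "x \<noteq> y"
  shows "\<not> p dvd x - y"
  using assms by (metis mod_eq_dvd_iff mod_pos_pos_trivial atLeastLessThan_iff)

lemma card_roots_mod_prime_le:
  fixes p :: int
  assumes p: "prime p"
  shows "\<not> [:p:] dvd g \<Longrightarrow> degree g \<le> D \<Longrightarrow> \<Theta> \<subseteq> {0..<p} \<Longrightarrow>
     (\<And>\<theta>. \<theta> \<in> \<Theta> \<Longrightarrow> p dvd poly g \<theta>) \<Longrightarrow> card \<Theta> \<le> D"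
proof (induction D arbitrary: g \<Theta>)
  case 0
  then obtain c where c: "g = [:c:]" by (metis degree_eq_zeroE le_zero_eq)
  with 0 have "\<Theta> = {}" by auto
  then show ?case by simp
next
  case (Suc D)
  show ?case
  proof (cases "\<Theta> = {}")
    case False
    then obtain \<theta> where \<theta>: "\<theta> \<in> \<Theta>" by blast
    define h where "h = synthetic_div g \<theta>"
    have g: "g = [:poly g \<theta>:] + [:-\<theta>, 1:] * h"
      using synthetic_div_correct'[of \<theta> g] by (simp add: h_def add.commute)
    have fin: "finite \<Theta>" using Suc.prems(3) finite_subset by blast
    have "card (\<Theta> - {\<theta>}) \<le> D"
    proof (rule Suc.IH)
      show "\<not> [:p:] dvd h"
      proof
        assume "[:p:] dvd h"
        moreover have "[:p:] dvd [:poly g \<theta>:]" using Suc.prems(4)[OF \<theta>] by simp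
        ultimately have "[:p:] dvd g" by (subst g) (intro dvd_add dvd_mult)
        with Suc.prems(1) show False by blast
      qed
      show "degree h \<le> D" using Suc.prems(2) by (simp add: h_def degree_synthetic_div)
      show "\<Theta> - {\<theta>} \<subseteq> {0..<p}" using Suc.prems(3) by blast
      fix \<theta>' assume \<theta>': "\<theta>' \<in> \<Theta> - {\<theta>}"
      have "poly g \<theta>' = poly g \<theta> + (\<theta>' - \<theta>) * poly h \<theta>'"
        by (subst g) (simp add: algebra_simps)
      moreover have "p dvd poly g \<theta>'" "p dvd poly g \<theta>" using Suc.prems(4) \<theta> \<theta>' by auto
      ultimately have "p dvd (\<theta>' - \<theta>) * poly h \<theta>'"
        by (metis dvd_add_right_iff)
      moreover have "\<not> p dvd \<theta>' - \<theta>"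
        using \<theta> \<theta>' Suc.prems(3) by (intro not_dvd_diff_residues) auto
      ultimately show "p dvd poly h \<theta>'" using p by (simp add: prime_dvd_mult_iff)
    qed
    with \<theta> fin show ?thesis by (simp add: card_Diff_singleton)
  qed simp
qed

corollary const_dvd_if_many_roots:
  fixes p :: int
  assumes "prime p" "degree g \<le> D" "\<Theta> \<subseteq> {0..<p}" "\<And>\<theta>. \<theta> \<in> \<Theta> \<Longrightarrow> p dvd poly g \<theta>" "D < card \<Theta>"
  shows "[:p:] dvd g"
  using card_roots_mod_prime_le[of p g D \<Theta>] assms by fastforce

text \<open>A representative modulo \<open>p\<close> whose degree is the degree over the field.\<close>

lemma ex_reduced_poly:
  fixes p :: int and g :: "int poly"
  assumes "p > 0"
  obtains g' where "[:p:] dvd g - g'" "degree g' \<le> degree g" "g' = 0 \<or> \<not> p dvd lead_coeff g'"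
    "\<And>i. p dvd coeff g i \<Longrightarrow> coeff g' i = 0"
proof
  let ?g = "map_poly (\<lambda>c. c mod p) g"
  have c: "coeff ?g i = coeff g i mod p" for i by (simp add: coeff_map_poly)
  show "[:p:] dvd g - ?g" by (simp add: const_poly_dvd_iff c mod_eq_dvd_iff[symmetric])
  show "degree ?g \<le> degree g" by (rule map_poly_degree_leq)
  show "?g = 0 \<or> \<not> p dvd lead_coeff ?g"
  proof (rule disjCI)
    assume "\<not> \<not> p dvd lead_coeff ?g"
    then have "lead_coeff ?g = 0"
      by (simp add: c mod_0_imp_dvd dvd_eq_mod_eq_0)
    then show "?g = 0" by simp
  qed
  show "coeff ?g i = 0" if "p dvd coeff g i" for i using that by (simp add: c)
qed

text \<open>The coefficient of \<open>X ^ (degree A + degree B - 1)\<close> in the Wronskian is the difference of the two degrees times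
  the product of the leading coefficients.\<close>

lemma degree_eq_if_wronskian_vanishes:
  fixes p :: int
  assumes p: "prime p" and A: "\<not> p dvd lead_coeff A" "int (degree A) < p"
    and B: "\<not> p dvd lead_coeff B" "int (degree B) < p"
    and W: "[:p:] dvd pderiv A * B - A * pderiv B"
  shows "degree A = degree B"
proof -
  let ?m = "degree A" and ?n = "degree B"
  have coeff1: "coeff (pderiv F * G) (degree F + degree G - 1) = int (degree F) * lead_coeff F * lead_coeff G"
    if "degree F + degree G > 0" for F G :: "int poly"
  proof (cases "degree F = 0")
    case True
    then have "pderiv F = 0" by (simp add: pderiv_eq_0_iff)
    with True show ?thesis by simp
  next
    case False
    then have "degree F + degree G - 1 = degree (pderiv F) + degree G"
      by (simp add: degree_pderiv)
    then have "coeff (pderiv F * G) (degree F + degree G - 1) = lead_coeff (pderiv F) * lead_coeff G"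
      by (simp only: coeff_mult_degree_sum)
    also have "lead_coeff (pderiv F) = int (degree F) * lead_coeff F"
      using False by (simp add: degree_pderiv coeff_pderiv)
    finally show ?thesis .
  qed
  show ?thesis
  proof (cases "?m + ?n = 0")
    case False
    have "coeff (pderiv A * B - A * pderiv B) (?m + ?n - 1)
        = (int ?m - int ?n) * (lead_coeff A * lead_coeff B)"
      using coeff1[of A B] coeff1[of B A] False by (simp add: algebra_simps)
    with W have "p dvd (int ?m - int ?n) * (lead_coeff A * lead_coeff B)"
      by (metis const_poly_dvd_iff)
    with p A B have "p dvd int ?m - int ?n" by (simp add: prime_dvd_mult_iff)
    then show ?thesis
      using A(2) B(2) not_dvd_diff_residues[of "int ?m" p "int ?n"] by fastforce
  qed simp
qed

lemma prime_obtain_inverse: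
  fixes p a :: int
  assumes "prime p" "\<not> p dvd a"
  obtains b where "p dvd a * b - 1"
proof -
  have "coprime a p" using assms by (metis coprime_commute prime_imp_coprime)
  then obtain b where "[a * b = 1] (mod p)" by (metis cong_solve_coprime_int)
  then show thesis using that by (simp add: cong_iff_dvd_diff)
qed

text \<open>The derivative of \<open>A / B\<close> is zero. In characteristic \<open>p\<close> this would allow functions of \<open>X ^ p\<close>, but below degree
  \<open>p\<close> the quotient has to be constant: subtract the multiple of \<open>B\<close> that cancels the leading term of \<open>A\<close>; the difference
  has the same vanishing Wronskian but a different degree, unless it is zero.\<close>

lemma proportional_if_wronskian_vanishes:
  fixes p :: int
  assumes p: "prime p" and A: "int (degree A) < p" and B: "\<not> [:p:] dvd B" "int (degree B) < p"
    and W: "[:p:] dvd pderiv A * B - A * pderiv B"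
  obtains c where "[:p:] dvd A - smult c B"
proof -
  have p0: "p > 0" using p prime_gt_0_int by blast
  obtain A' where A': "[:p:] dvd A - A'" "degree A' \<le> degree A" "A' = 0 \<or> \<not> p dvd lead_coeff A'"
    using ex_reduced_poly[OF p0, of A] by blast
  obtain B' where B': "[:p:] dvd B - B'" "degree B' \<le> degree B" "B' = 0 \<or> \<not> p dvd lead_coeff B'"
    using ex_reduced_poly[OF p0, of B] by blast
  have B'0: "B' \<noteq> 0" using B(1) B'(1) by auto
  have wron: "[:p:] dvd pderiv F * B' - F * pderiv B'" if "[:p:] dvd A - smult e B - F" for F e
  proof -
    have dF: "[:p:] dvd pderiv A - smult e (pderiv B) - pderiv F"
      using const_dvd_pderiv[OF that] by (simp add: pderiv_diff pderiv_smult)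
    have dB: "[:p:] dvd pderiv B - pderiv B'"
      using const_dvd_pderiv[OF B'(1)] by (simp add: pderiv_diff)
    have eq: "pderiv F * B' - F * pderiv B' = (pderiv A * B - A * pderiv B)
        - B' * (pderiv A - smult e (pderiv B) - pderiv F) + pderiv B' * (A - smult e B - F)
        - (pderiv A - smult e (pderiv B)) * (B - B') + (A - smult e B) * (pderiv B - pderiv B')"
      by (simp add: algebra_simps smult_diff_right)
    show ?thesis unfolding eq
      by (insert W dF dB that B'(1), (assumption | rule dvd_add dvd_diff dvd_mult)+)
  qed
  show thesis
  proof (cases "A' = 0")
    case True
    then show thesis using A'(1) that[of 0] by simp
  next
    case False
    have deg: "degree A' = degree B'"
      using wron[of 0 A'] A A' B B' B'0 False p by (intro degree_eq_if_wronskian_vanishes[OF p]) auto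
    obtain i where i: "p dvd lead_coeff B' * i - 1"
      using prime_obtain_inverse[OF p] B'(3) B'0 by blast
    define c where "c = lead_coeff A' * i"
    obtain D where D: "[:p:] dvd (A - smult c B) - D" "degree D \<le> degree (A - smult c B)" "D = 0 \<or> \<not> p dvd lead_coeff D"
      and D0: "\<And>i. p dvd coeff (A - smult c B) i \<Longrightarrow> coeff D i = 0"
      using ex_reduced_poly[OF p0, of "A - smult c B"] by blast
    show thesis
    proof (cases "D = 0")
      case True
      then show thesis using D(1) that by simp
    next
      case False
      have "int (degree (A - smult c B)) < p"
        using A B(2) degree_diff_le_max[of A "smult c B"] degree_smult_le[of c B] by linarith
      then have degD: "degree D = degree B'"
        using wron[of c D] D B B' B'0 False p by (intro degree_eq_if_wronskian_vanishes[OF p]) auto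
      have "p dvd coeff (A - smult c B) (degree B')"
      proof -
        have "p dvd coeff (A - A') (degree B')" "p dvd coeff (B - B') (degree B')"
          using A'(1) B'(1) by (simp_all only: const_poly_dvd_iff)
        moreover have "coeff (A - smult c B) (degree B')
            = coeff (A - A') (degree B') - c * coeff (B - B') (degree B')
              - lead_coeff A' * (lead_coeff B' * i - 1)"
          by (simp add: c_def deg algebra_simps)
        ultimately show ?thesis using i by (metis dvd_diff dvd_mult)
      qed
      then have "lead_coeff D = 0" using D0 degD by metis
      with False show thesis by simp
    qed
  qed
qed

section \<open>Polynomials in three variables along light rays\<close>

text \<open>A list of monomials \<open>c x^i y^j w^k\<close>, possibly with repetitions. Formal derivatives and the evaluation in an arbitrary
  commutative ring are immediate in this form. Coefficients are never compared: a polynomial counts as nonzero if it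
  has a value that is nonzero modulo \<open>p\<close>.\<close>

type_synonym poly3 = "(int \<times> nat \<times> nat \<times> nat) list"

text \<open>The ring is arbitrary because a polynomial is restricted to a line by evaluating it at three polynomials in one
  variable.\<close>

definition ev :: "poly3 \<Rightarrow> 'a::comm_ring_1 \<Rightarrow> 'a \<Rightarrow> 'a \<Rightarrow> 'a" where
  "ev f x y w = (\<Sum>(c, i, j, k) \<leftarrow> f. of_int c * x ^ i * y ^ j * w ^ k)"

text \<open>Monomials with coefficient zero are exempt: \<open>Dx\<close> turns \<open>y\<close> into \<open>0 \<sqdot> y\<close>, whose exponents do not decrease.\<close>

definition degree3_le :: "poly3 \<Rightarrow> nat \<Rightarrow> bool" where
  "degree3_le f d \<longleftrightarrow> (\<forall>(c, i, j, k) \<in> set f. c = 0 \<or> i + j + k \<le> d)"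

definition Dx :: "poly3 \<Rightarrow> poly3" where
  "Dx = map (\<lambda>(c, i, j, k). (c * int i, i - 1, j, k))"

definition Dy :: "poly3 \<Rightarrow> poly3" where
  "Dy = map (\<lambda>(c, i, j, k). (c * int j, i, j - 1, k))"

definition Dw :: "poly3 \<Rightarrow> poly3" where
  "Dw = map (\<lambda>(c, i, j, k). (c * int k, i, j, k - 1))"

lemma Dy_Dx: "Dy (Dx f) = Dx (Dy f)" and Dw_Dx: "Dw (Dx f) = Dx (Dw f)" and Dw_Dy: "Dw (Dy f) = Dy (Dw f)"
  by (auto simp: Dx_def Dy_def Dw_def)

lemma ev_Nil [simp]: "ev [] x y w = 0"
  and ev_Cons [simp]: "ev ((c, i, j, k) # f) x y w = of_int c * x ^ i * y ^ j * w ^ k + ev f x y w"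
  by (simp_all add: ev_def)

lemma degree3_le_Cons: "degree3_le ((c, i, j, k) # f) d \<longleftrightarrow> (c = 0 \<or> i + j + k \<le> d) \<and> degree3_le f d"
  by (simp add: degree3_le_def)

lemma degree3_le_derivs:
  assumes "degree3_le f d"
  shows "degree3_le (Dx f) (d - 1)" "degree3_le (Dy f) (d - 1)" "degree3_le (Dw f) (d - 1)"
  using assms by (force simp: degree3_le_def Dx_def Dy_def Dw_def)+

lemma degree3_le_mono: "degree3_le f d \<Longrightarrow> d \<le> d' \<Longrightarrow> degree3_le f d'"
  by (force simp: degree3_le_def)

lemma poly_ev: "poly (ev f X Y W) \<theta> = ev f (poly X \<theta>) (poly Y \<theta>) (poly W \<theta>)"
  for X Y W :: "int poly"
  by (induction f) (auto simp: of_int_poly)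

lemma ev_cong:
  fixes x y w x' y' w' :: int
  assumes "[x = x'] (mod p)" "[y = y'] (mod p)" "[w = w'] (mod p)"
  shows "[ev f x y w = ev f x' y' w'] (mod p)"
proof (induction f)
  case (Cons t f)
  obtain c i j k where "t = (c, i, j, k)" by (metis prod_cases4)
  then show ?case using Cons assms by (auto intro!: cong_add cong_mult cong_pow)
qed simp

lemma pderiv_ev:
  fixes X Y W :: "int poly"
  shows "pderiv (ev f X Y W) = ev (Dx f) X Y W * pderiv X + ev (Dy f) X Y W * pderiv Y + ev (Dw f) X Y W * pderiv W"
proof (induction f)
  case (Cons t f)
  obtain c i j k where t: "t = (c, i, j, k)" by (metis prod_cases4)
  have pow: "pderiv (Z ^ m) = of_int (int m) * Z ^ (m - 1) * pderiv Z" for Z :: "int poly" and m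
  proof (cases m)
    case (Suc k)
    then show ?thesis by (simp only: pderiv_power_Suc) (simp add: of_nat_poly smult_add_left algebra_simps)
  qed simp
  have "pderiv (of_int c * X ^ i * Y ^ j * W ^ k)
      = of_int (c * int i) * X ^ (i - 1) * Y ^ j * W ^ k * pderiv X
      + of_int (c * int j) * X ^ i * Y ^ (j - 1) * W ^ k * pderiv Y
      + of_int (c * int k) * X ^ i * Y ^ j * W ^ (k - 1) * pderiv W"
    by (simp add: pderiv_mult pow of_int_poly pderiv_pCons pderiv_smult smult_add_right algebra_simps)
  then show ?case using Cons by (simp add: t pderiv_add Dx_def Dy_def Dw_def algebra_simps)
qed (simp add: Dx_def Dy_def Dw_def)

lemma degree_ev_le:
  fixes X Y W :: "int poly"
  assumes "degree3_le f d" "degree X \<le> 1" "degree Y \<le> 1" "degree W \<le> 1"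
  shows "degree (ev f X Y W) \<le> d"
  using assms(1)
proof (induction f)
  case (Cons t f)
  obtain c i j k where t: "t = (c, i, j, k)" by (metis prod_cases4)
  have pow: "degree (Z ^ m) \<le> m" if "degree Z \<le> 1" for Z :: "int poly" and m
    by (rule order.trans[OF degree_power_le]) (use mult_le_mono1[OF that, of m] in simp)
  have "degree (of_int c * X ^ i * Y ^ j * W ^ k) \<le> d"
  proof (cases "c = 0")
    case False
    have "degree (of_int c * X ^ i * Y ^ j * W ^ k) \<le> degree (of_int c * X ^ i * Y ^ j) + degree (W ^ k)"
      by (rule degree_mult_le)
    also have "degree (of_int c * X ^ i * Y ^ j) \<le> degree (of_int c * X ^ i) + degree (Y ^ j)"
      by (rule degree_mult_le)
    also have "degree (of_int c * X ^ i) \<le> degree (of_int c :: int poly) + degree (X ^ i)"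
      by (rule degree_mult_le)
    also have "degree (of_int c :: int poly) = 0" by simp
    finally show ?thesis
      using pow[OF assms(2), of i] pow[OF assms(3), of j] pow[OF assms(4), of k] Cons.prems False
      by (simp add: t degree3_le_Cons)
  qed simp
  then show ?case using Cons by (simp add: t degree3_le_Cons degree_add_le)
qed simp

text \<open>The ray \<open>(a, b, e)\<close> is the line of the points \<open>(\<theta>, b + a \<theta>, e + a^2 \<theta>)\<close>. Its direction \<open>(1, a, a^2)\<close> lies on the cone
  \<open>y^2 = x w\<close>.\<close>

type_synonym ray = "int \<times> int \<times> int"

definition along :: "poly3 \<Rightarrow> ray \<Rightarrow> int poly" where
  "along f q = (case q of (a, b, e) \<Rightarrow> ev f [:0, 1:] [:b, a:] [:e, a\<^sup>2:])"

text \<open>The rays meet transversally in the point with first coordinate \<open>\<theta>\<close>, which is the parameter of this point on both of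
  them.\<close>

definition cross :: "int \<Rightarrow> ray \<Rightarrow> ray \<Rightarrow> int \<Rightarrow> bool" where
  "cross p q q' \<theta> \<longleftrightarrow> (case q of (a, b, e) \<Rightarrow> case q' of (a', b', e') \<Rightarrow>
     \<not> p dvd a' - a \<and> [b + a * \<theta> = b' + a' * \<theta>] (mod p) \<and> [e + a\<^sup>2 * \<theta> = e' + a'\<^sup>2 * \<theta>] (mod p))"

lemma cross_sym: "cross p q q' \<theta> \<Longrightarrow> cross p q' q \<theta>"
  by (auto simp: cross_def cong_sym dvd_diff_commute)

lemma along_cong_if_cross:
  assumes "cross p q q' \<theta>"
  shows "[poly (along f q) \<theta> = poly (along f q') \<theta>] (mod p)"
  using assms by (auto simp: cross_def along_def poly_ev mult.commute intro!: ev_cong split: prod.splits)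

lemma degree_along_le: "degree3_le f d \<Longrightarrow> degree (along f q) \<le> d"
  by (auto simp: along_def split: prod.splits intro!: degree_ev_le)

lemma pderiv_along:
  "pderiv (along f (a, b, e)) = along (Dx f) (a, b, e) + smult a (along (Dy f) (a, b, e)) + smult (a\<^sup>2) (along (Dw f) (a, b, e))"
  by (simp add: along_def pderiv_ev pderiv_pCons)

definition grad_w :: "poly3 \<Rightarrow> ray \<Rightarrow> int poly" where
  "grad_w f q = along (Dw f) q"

text \<open>If \<open>f\<close> vanishes on the ray \<open>q\<close> of slope \<open>a\<close>, its derivative at a point of \<open>q\<close> in a light-like direction
  \<open>(1, s, s^2)\<close> is \<open>(s - a) (grad_n + (s - a) grad_w)\<close>. So the second light-like tangent direction of the surface \<open>f = 0\<close> has
  the slope \<open>s\<close> with \<open>s - a = - grad_n / grad_w\<close>.\<close>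

definition grad_n :: "poly3 \<Rightarrow> ray \<Rightarrow> int poly" where
  "grad_n f q = along (Dy f) q + smult (2 * fst q) (along (Dw f) q)"

text \<open>The second derivative of \<open>f\<close> in the second light-like tangent direction, whose slope is \<open>N / P\<close>, multiplied by \<open>P ^ 4\<close>.\<close>

definition asymptotic :: "poly3 \<Rightarrow> ray \<Rightarrow> int poly" where
  "asymptotic f q = (let P = along (Dw f) q; N = - along (Dy f) q - smult (fst q) P in
     P ^ 4 * along (Dx (Dx f)) q + P ^ 3 * N * smult 2 (along (Dx (Dy f)) q)
     + P ^ 2 * N ^ 2 * (along (Dy (Dy f)) q + smult 2 (along (Dx (Dw f)) q))
     + P * N ^ 3 * smult 2 (along (Dy (Dw f)) q) + N ^ 4 * along (Dw (Dw f)) q)"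

text \<open>For \<open>h = - P / H\<close>, the reciprocal of the difference of the two slopes, this is \<open>H ^ 3\<close> times the second derivative of \<open>h\<close>.\<close>

definition umbilic :: "poly3 \<Rightarrow> ray \<Rightarrow> int poly" where
  "umbilic f q = (let P = grad_w f q; H = grad_n f q in
     H * (P * pderiv (pderiv H) - H * pderiv (pderiv P)) - smult 2 (pderiv H * (P * pderiv H - H * pderiv P)))"

lemma pderiv_along_vanish:
  fixes \<theta> :: int
  assumes "[:p:] dvd along f (a, b, e)"
  defines "D \<equiv> \<lambda>g. poly (along (Dx g) (a, b, e)) \<theta> + a * poly (along (Dy g) (a, b, e)) \<theta> + a\<^sup>2 * poly (along (Dw g) (a, b, e)) \<theta>"
  shows "p dvd D f" 
    "p dvd D (Dx f) + a * D (Dy f) + a\<^sup>2 * D (Dw f)"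
    "p dvd (D (Dx (Dx f)) + a * D (Dx (Dy f)) + a\<^sup>2 * D (Dx (Dw f)))
       + a * (D (Dx (Dy f)) + a * D (Dy (Dy f)) + a\<^sup>2 * D (Dy (Dw f)))
       + a\<^sup>2 * (D (Dx (Dw f)) + a * D (Dy (Dw f)) + a\<^sup>2 * D (Dw (Dw f)))"
proof -
  have 1: "[:p:] dvd pderiv (along f (a, b, e))" by (intro const_dvd_pderiv assms(1))
  then have 2: "[:p:] dvd pderiv (pderiv (along f (a, b, e)))" by (rule const_dvd_pderiv)
  then have 3: "[:p:] dvd pderiv (pderiv (pderiv (along f (a, b, e))))" by (rule const_dvd_pderiv)
  show "p dvd D f" using const_dvd_poly[OF 1, of \<theta>] by (simp add: pderiv_along D_def)
  show "p dvd D (Dx f) + a * D (Dy f) + a\<^sup>2 * D (Dw f)"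
    using const_dvd_poly[OF 2, of \<theta>]
    by (simp add: pderiv_along pderiv_add pderiv_smult D_def algebra_simps)
  show "p dvd (D (Dx (Dx f)) + a * D (Dx (Dy f)) + a\<^sup>2 * D (Dx (Dw f)))
       + a * (D (Dx (Dy f)) + a * D (Dy (Dy f)) + a\<^sup>2 * D (Dy (Dw f)))
       + a\<^sup>2 * (D (Dx (Dw f)) + a * D (Dy (Dw f)) + a\<^sup>2 * D (Dw (Dw f)))"
    using const_dvd_poly[OF 3, of \<theta>]
    by (simp add: pderiv_along pderiv_add pderiv_smult D_def algebra_simps Dy_Dx Dw_Dx Dw_Dy)
qed

text \<open>The form \<open>P ^ 4 T(N / P)\<close> for a quartic polynomial \<open>T\<close> with variable coefficients \<open>t0, \<dots>, t4\<close> is differentiated at a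
  point where \<open>N / P\<close> equals the root \<open>a\<close> of \<open>T\<close>. Apart from terms with the factor \<open>T(a)\<close>, the derivative is \<open>P ^ 3\<close> times
  \<open>(dN - a dP) T'(a) + P S(a)\<close>, where \<open>S\<close> has the differentiated coefficients.\<close>

lemma quartic_derivative_at_root:
  fixes p a P N dP dN :: int
  assumes "prime p" "\<not> p dvd P" and N: "[N = a * P] (mod p)"
    and T: "p dvd t0 + a * t1 + a\<^sup>2 * t2 + a ^ 3 * t3 + a ^ 4 * t4"
    and E: "p dvd (4 * P ^ 3 * dP * t0 + P ^ 4 * s0) + ((3 * P\<^sup>2 * dP * N + P ^ 3 * dN) * t1 + P ^ 3 * N * s1)
      + ((2 * P * dP * N\<^sup>2 + 2 * P\<^sup>2 * N * dN) * t2 + P\<^sup>2 * N\<^sup>2 * s2)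
      + ((dP * N ^ 3 + 3 * P * N\<^sup>2 * dN) * t3 + P * N ^ 3 * s3) + (4 * N ^ 3 * dN * t4 + N ^ 4 * s4)"
      (is "p dvd ?E N")
  shows "p dvd (dN - a * dP) * (t1 + 2 * a * t2 + 3 * a\<^sup>2 * t3 + 4 * a ^ 3 * t4)
     + P * (s0 + a * s1 + a\<^sup>2 * s2 + a ^ 3 * s3 + a ^ 4 * s4)" (is "p dvd ?R")
proof -
  have "[?E N = ?E (a * P)] (mod p)"
    by (intro cong_add cong_mult cong_pow cong_refl N)
  with E have "p dvd ?E (a * P)" using cong_dvd_iff by blast
  also have "?E (a * P) = P ^ 3 * (?R + 4 * dP * (t0 + a * t1 + a\<^sup>2 * t2 + a ^ 3 * t3 + a ^ 4 * t4))"
    by (simp add: algebra_simps power2_eq_square power3_eq_cube power4_eq_xxxx)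
  finally have "p dvd ?R + 4 * dP * (t0 + a * t1 + a\<^sup>2 * t2 + a ^ 3 * t3 + a ^ 4 * t4)"
    using assms(1,2) by (simp add: prime_dvd_mult_iff prime_dvd_power_iff)
  then show ?thesis using T by (metis dvd_add_left_iff dvd_mult)
qed

text \<open>Two rays on which \<open>f\<close> vanishes, and their common point. The functions \<open>val\<close>, \<open>du\<close> and \<open>dv\<close> give the value of a
  polynomial at this point and its derivatives in the directions of the first and of the second ray.\<close>

locale crossing_rays =
  fixes p a b e a' b' e' \<theta> :: int and f :: poly3
  assumes p: "prime p" and cross: "cross p (a, b, e) (a', b', e') \<theta>"
    and f: "[:p:] dvd along f (a, b, e)" and f': "[:p:] dvd along f (a', b', e')"
begin

definition val :: "poly3 \<Rightarrow> int" where "val g = poly (along g (a, b, e)) \<theta>"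
definition du :: "poly3 \<Rightarrow> int" where "du g = val (Dx g) + a * val (Dy g) + a\<^sup>2 * val (Dw g)"
definition dv :: "poly3 \<Rightarrow> int" where "dv g = val (Dx g) + a' * val (Dy g) + a'\<^sup>2 * val (Dw g)"
definition val' :: "poly3 \<Rightarrow> int" where "val' g = poly (along g (a', b', e')) \<theta>"

lemma val'_cong: "[val' g = val g] (mod p)"
  using along_cong_if_cross[OF cross, of g] by (simp add: val_def val'_def cong_sym)

lemma delta: "\<not> p dvd a' - a"
  using cross by (simp add: cross_def)

lemma first_order_q: "p dvd du f"
  and second_order_q: "p dvd du (Dx f) + a * du (Dy f) + a\<^sup>2 * du (Dw f)"
  and third_order_q: "p dvd (du (Dx (Dx f)) + a * du (Dx (Dy f)) + a\<^sup>2 * du (Dx (Dw f)))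
       + a * (du (Dx (Dy f)) + a * du (Dy (Dy f)) + a\<^sup>2 * du (Dy (Dw f)))
       + a\<^sup>2 * (du (Dx (Dw f)) + a * du (Dy (Dw f)) + a\<^sup>2 * du (Dw (Dw f)))"
  using pderiv_along_vanish[OF f, of \<theta>] unfolding du_def val_def by blast+

lemma first_order_q': "p dvd dv f"
proof -
  have "[val' (Dx f) + a' * val' (Dy f) + a'\<^sup>2 * val' (Dw f) = dv f] (mod p)"
    unfolding dv_def by (intro cong_add cong_mult cong_refl val'_cong)
  then show ?thesis using pderiv_along_vanish(1)[OF f', of \<theta>] unfolding val'_def
    using cong_dvd_iff by blast
qed

lemma second_order_q': "p dvd dv (Dx f) + a' * dv (Dy f) + a'\<^sup>2 * dv (Dw f)"
proof -
  define dv' where "dv' g = val' (Dx g) + a' * val' (Dy g) + a'\<^sup>2 * val' (Dw g)" for g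
  have "[dv' (Dx f) + a' * dv' (Dy f) + a'\<^sup>2 * dv' (Dw f) = dv (Dx f) + a' * dv (Dy f) + a'\<^sup>2 * dv (Dw f)] (mod p)"
    unfolding dv_def dv'_def by (intro cong_add cong_mult cong_refl val'_cong)
  then show ?thesis using pderiv_along_vanish(2)[OF f', of \<theta>] unfolding dv'_def val'_def
    using cong_dvd_iff by blast
qed

text \<open>Two different roots of the quadratic polynomial \<open>f_x + s f_y + s^2 f_w\<close> have the sum \<open>- f_y / f_w\<close>.\<close>

lemma second_root: "p dvd val (Dy f) + (a + a') * val (Dw f)"
proof -
  have "dv f - du f = (a' - a) * (val (Dy f) + (a + a') * val (Dw f))"
    by (simp add: du_def dv_def algebra_simps power2_eq_square)
  then have "p dvd (a' - a) * (val (Dy f) + (a + a') * val (Dw f))"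
    using first_order_q first_order_q' by (metis dvd_diff)
  then show ?thesis using p delta by (simp add: prime_dvd_mult_iff)
qed

lemma normal_relation: "p dvd poly (grad_n f (a, b, e)) \<theta> + (a' - a) * poly (grad_w f (a, b, e)) \<theta>"
  using second_root by (simp add: grad_n_def grad_w_def val_def algebra_simps)

lemma N_cong: "[- val' (Dy f) - a' * val' (Dw f) = a * val' (Dw f)] (mod p)"
proof -
  have "[val (Dy f) + (a + a') * val (Dw f) = val' (Dy f) + (a + a') * val' (Dw f)] (mod p)"
    by (intro cong_add cong_mult cong_refl cong_sym[OF val'_cong])
  then have "p dvd val' (Dy f) + (a + a') * val' (Dw f)"
    using second_root cong_dvd_iff by blast
  moreover have "(- val' (Dy f) - a' * val' (Dw f)) - a * val' (Dw f) = - (val' (Dy f) + (a + a') * val' (Dw f))"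
    by (simp add: algebra_simps)
  ultimately show ?thesis unfolding cong_iff_dvd_diff by (simp only: dvd_minus_iff)
qed

lemma asymptotic_T: "p dvd val' (Dx (Dx f)) + a * (2 * val' (Dx (Dy f))) + a\<^sup>2 * (val' (Dy (Dy f)) + 2 * val' (Dx (Dw f)))
   + a ^ 3 * (2 * val' (Dy (Dw f))) + a ^ 4 * val' (Dw (Dw f))" (is "p dvd ?T val'")
proof -
  have "[?T val' = ?T val] (mod p)" by (intro cong_add cong_mult cong_refl val'_cong)
  moreover have "?T val = du (Dx f) + a * du (Dy f) + a\<^sup>2 * du (Dw f)"
    by (simp add: du_def Dy_Dx Dw_Dx Dw_Dy algebra_simps power2_eq_square power3_eq_cube power4_eq_xxxx)
  ultimately show ?thesis using second_order_q cong_dvd_iff by metis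
qed

text \<open>Seen from the second ray, the other light-like tangent direction is that of the first ray, on which \<open>f\<close> vanishes.\<close>

lemma asymptotic_at_cross: "p dvd poly (asymptotic f (a', b', e')) \<theta>"
proof -
  let ?P = "val' (Dw f)"
  let ?E = "\<lambda>N. ?P ^ 4 * val' (Dx (Dx f)) + ?P ^ 3 * N * (2 * val' (Dx (Dy f)))
     + ?P ^ 2 * N ^ 2 * (val' (Dy (Dy f)) + 2 * val' (Dx (Dw f)))
     + ?P * N ^ 3 * (2 * val' (Dy (Dw f))) + N ^ 4 * val' (Dw (Dw f))"
  have "poly (asymptotic f (a', b', e')) \<theta> = ?E (- val' (Dy f) - a' * val' (Dw f))"
    by (simp add: asymptotic_def val'_def Let_def)
  moreover have "[?E (- val' (Dy f) - a' * val' (Dw f)) = ?E (a * ?P)] (mod p)"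
    by (intro cong_add cong_mult cong_pow cong_refl N_cong)
  moreover have "?E (a * ?P) = ?P ^ 4 * (val' (Dx (Dx f)) + a * (2 * val' (Dx (Dy f))) + a\<^sup>2 * (val' (Dy (Dy f)) + 2 * val' (Dx (Dw f)))
     + a ^ 3 * (2 * val' (Dy (Dw f))) + a ^ 4 * val' (Dw (Dw f)))"
    by (simp add: algebra_simps power2_eq_square power3_eq_cube power4_eq_xxxx)
  ultimately show ?thesis using asymptotic_T by (metis cong_dvd_iff dvd_mult)
qed

text \<open>Differentiate the identity \<open>asymptotic f q' = 0\<close> along \<open>q'\<close> at the common point with \<open>q\<close>. With \<open>\<delta> = a' - a\<close> and
  the derivative \<open>\<partial> = \<partial>_y + (a + a') \<partial>_w\<close>, the two directional derivatives satisfy \<open>dv = du + \<delta> \<partial>\<close>. The pure derivatives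
  \<open>du du f\<close>, \<open>dv dv f\<close> and \<open>du du du f\<close> are zero. This eliminates \<open>\<partial> \<partial> f\<close>, the only quantity that is not determined
  along \<open>q\<close>. What remains is a relation between \<open>P\<close>, \<open>H\<close> and their first two derivatives along \<open>q\<close>, namely \<open>umbilic f q = 0\<close>.\<close>

lemma umbilic_at_cross:
  assumes E: "[:p:] dvd asymptotic f (a', b', e')" and P: "\<not> p dvd poly (grad_w f (a, b, e)) \<theta>"
  shows "p dvd poly (umbilic f (a, b, e)) \<theta>"
proof -
  define dv' where "dv' g = val' (Dx g) + a' * val' (Dy g) + a'\<^sup>2 * val' (Dw g)" for g
  have dv'_cong: "[dv' g = dv g] (mod p)" for g
    unfolding dv'_def dv_def by (intro cong_add cong_mult cong_refl val'_cong)
  define \<delta> where "\<delta> = a' - a"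
  define P0 where "P0 = val (Dw f)"
  define P1 where "P1 = du (Dw f)"
  define P2 where "P2 = du (Dx (Dw f)) + a * du (Dy (Dw f)) + a\<^sup>2 * du (Dw (Dw f))"
  define H0 where "H0 = val (Dy f) + 2 * a * val (Dw f)"
  define H1 where "H1 = du (Dy f) + 2 * a * du (Dw f)"
  define H2 where "H2 = (du (Dx (Dy f)) + a * du (Dy (Dy f)) + a\<^sup>2 * du (Dy (Dw f))) + 2 * a * P2"
  define K where "K = H0 + \<delta> * P0"
  have K: "p dvd K" using second_root by (simp add: K_def H0_def P0_def \<delta>_def algebra_simps)
  have P0: "\<not> p dvd val' (Dw f)"
    using P val'_cong[of "Dw f"] cong_dvd_iff unfolding grad_w_def val_def by blast
  define X1 where "X1 = H1 + \<delta> * P1"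
  define Y1 where "Y1 = val (Dy (Dy f)) + 2 * (a + a') * val (Dy (Dw f)) + (a + a')\<^sup>2 * val (Dw (Dw f))"
  have "(dv (Dx f) + a' * dv (Dy f) + a'\<^sup>2 * dv (Dw f)) - (du (Dx f) + a * du (Dy f) + a\<^sup>2 * du (Dw f))
      = \<delta> * (2 * X1 + \<delta> * Y1)"
    by (simp add: X1_def Y1_def \<delta>_def du_def dv_def H1_def P1_def Dy_Dx Dw_Dx Dw_Dy algebra_simps power2_eq_square)
  then have "p dvd \<delta> * (2 * X1 + \<delta> * Y1)" using second_order_q second_order_q' by (metis dvd_diff)
  then have XY: "p dvd 2 * X1 + \<delta> * Y1" using p delta by (simp add: \<delta>_def prime_dvd_mult_iff)
  define Ta where "Ta \<equiv> \<lambda>val. 2 * val (Dx (Dy f)) + 2 * a * (val (Dy (Dy f)) + 2 * val (Dx (Dw f)))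
    + 3 * a\<^sup>2 * (2 * val (Dy (Dw f))) + 4 * a ^ 3 * val (Dw (Dw f))"
  define S where "S \<equiv> \<lambda>dv. dv (Dx (Dx f)) + a * (2 * dv (Dx (Dy f))) + a\<^sup>2 * (dv (Dy (Dy f)) + 2 * dv (Dx (Dw f)))
    + a ^ 3 * (2 * dv (Dy (Dw f))) + a ^ 4 * dv (Dw (Dw f))"
  have "p dvd ((- dv' (Dy f) - a' * dv' (Dw f)) - a * dv' (Dw f)) * Ta val' + val' (Dw f) * S dv'"
    unfolding Ta_def S_def
  proof (rule quartic_derivative_at_root[OF p P0 N_cong asymptotic_T])
    have "p dvd poly (pderiv (asymptotic f (a', b', e'))) \<theta>"
      by (intro const_dvd_poly const_dvd_pderiv E)
    then show "p dvd (4 * val' (Dw f) ^ 3 * dv' (Dw f) * val' (Dx (Dx f)) + val' (Dw f) ^ 4 * dv' (Dx (Dx f))) +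
     ((3 * (val' (Dw f))\<^sup>2 * dv' (Dw f) * (- val' (Dy f) - a' * val' (Dw f)) +
       val' (Dw f) ^ 3 * (- dv' (Dy f) - a' * dv' (Dw f))) * (2 * val' (Dx (Dy f))) +
      val' (Dw f) ^ 3 * (- val' (Dy f) - a' * val' (Dw f)) * (2 * dv' (Dx (Dy f)))) +
     ((2 * val' (Dw f) * dv' (Dw f) * (- val' (Dy f) - a' * val' (Dw f))\<^sup>2 +
       2 * (val' (Dw f))\<^sup>2 * (- val' (Dy f) - a' * val' (Dw f)) * (- dv' (Dy f) - a' * dv' (Dw f))) *
      (val' (Dy (Dy f)) + 2 * val' (Dx (Dw f))) +
      (val' (Dw f))\<^sup>2 * (- val' (Dy f) - a' * val' (Dw f))\<^sup>2 * (dv' (Dy (Dy f)) + 2 * dv' (Dx (Dw f)))) +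
     ((dv' (Dw f) * (- val' (Dy f) - a' * val' (Dw f)) ^ 3 +
       3 * val' (Dw f) * (- val' (Dy f) - a' * val' (Dw f))\<^sup>2 * (- dv' (Dy f) - a' * dv' (Dw f))) *
      (2 * val' (Dy (Dw f))) +
      val' (Dw f) * (- val' (Dy f) - a' * val' (Dw f)) ^ 3 * (2 * dv' (Dy (Dw f)))) +
     (4 * (- val' (Dy f) - a' * val' (Dw f)) ^ 3 * (- dv' (Dy f) - a' * dv' (Dw f)) * val' (Dw (Dw f)) +
      (- val' (Dy f) - a' * val' (Dw f)) ^ 4 * dv' (Dw (Dw f)))"
    proof -
      define Z where "Z = - along (Dy f) (a', b', e') - smult a' (along (Dw f) (a', b', e'))"
      have Z: "poly Z \<theta> = - val' (Dy f) - a' * val' (Dw f)" by (simp add: Z_def val'_def)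
      have dV: "poly (pderiv (along g (a', b', e'))) \<theta> = dv' g" for g
        by (simp add: pderiv_along dv'_def val'_def)
      have dZ: "poly (pderiv Z) \<theta> = - dv' (Dy f) - a' * dv' (Dw f)"
        by (simp add: Z_def pderiv_diff pderiv_minus pderiv_smult dV)
      have pw: "pderiv (X ^ 2) = smult 2 X * pderiv X" "pderiv (X ^ 3) = smult 3 (X ^ 2) * pderiv X"
        "pderiv (X ^ 4) = smult 4 (X ^ 3) * pderiv X" for X :: "int poly"
        using pderiv_power_Suc[of X 1] pderiv_power_Suc[of X 2] pderiv_power_Suc[of X 3]
        by (simp_all add: numeral_2_eq_2 eval_nat_numeral)
      have "asymptotic f (a', b', e') = along (Dw f) (a', b', e') ^ 4 * along (Dx (Dx f)) (a', b', e')
         + along (Dw f) (a', b', e') ^ 3 * Z * smult 2 (along (Dx (Dy f)) (a', b', e'))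
         + along (Dw f) (a', b', e') ^ 2 * Z ^ 2 * (along (Dy (Dy f)) (a', b', e') + smult 2 (along (Dx (Dw f)) (a', b', e')))
         + along (Dw f) (a', b', e') * Z ^ 3 * smult 2 (along (Dy (Dw f)) (a', b', e'))
         + Z ^ 4 * along (Dw (Dw f)) (a', b', e')"
        by (simp add: asymptotic_def Z_def Let_def)
      then have "poly (pderiv (asymptotic f (a', b', e'))) \<theta> = 
        poly (pderiv (along (Dw f) (a', b', e') ^ 4 * along (Dx (Dx f)) (a', b', e'))) \<theta>
         + poly (pderiv (along (Dw f) (a', b', e') ^ 3 * Z * smult 2 (along (Dx (Dy f)) (a', b', e')))) \<theta>
         + poly (pderiv (along (Dw f) (a', b', e') ^ 2 * Z ^ 2 * (along (Dy (Dy f)) (a', b', e') + smult 2 (along (Dx (Dw f)) (a', b', e'))))) \<theta>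
         + poly (pderiv (along (Dw f) (a', b', e') * Z ^ 3 * smult 2 (along (Dy (Dw f)) (a', b', e')))) \<theta>
         + poly (pderiv (Z ^ 4 * along (Dw (Dw f)) (a', b', e'))) \<theta>"
        by (simp add: pderiv_add)
      with \<open>p dvd poly (pderiv (asymptotic f (a', b', e'))) \<theta>\<close> show ?thesis
        by (simp add: pderiv_mult pderiv_add pderiv_smult pw dV dZ Z flip: val'_def)
           (simp add: algebra_simps)
    qed
  qed
  moreover have "[((- dv' (Dy f) - a' * dv' (Dw f)) - a * dv' (Dw f)) * Ta val' + val' (Dw f) * S dv'
     = ((- dv (Dy f) - a' * dv (Dw f)) - a * dv (Dw f)) * Ta val + val (Dw f) * S dv] (mod p)"
    unfolding Ta_def S_def by (intro cong_add cong_diff cong_mult cong_refl cong_minus_minus_iff[THEN iffD2] val'_cong dv'_cong)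
  ultimately have 1: "p dvd ((- dv (Dy f) - a' * dv (Dw f)) - a * dv (Dw f)) * Ta val + val (Dw f) * S dv"
    using cong_dvd_iff by blast
  have "(- dv (Dy f) - a' * dv (Dw f)) - a * dv (Dw f) = X1 - (2 * X1 + \<delta> * Y1)"
    by (simp add: X1_def Y1_def \<delta>_def du_def dv_def H1_def P1_def Dy_Dx Dw_Dx Dw_Dy algebra_simps power2_eq_square)
  moreover have "Ta val = 2 * H1"
    by (simp add: Ta_def H1_def du_def Dy_Dx Dw_Dx Dw_Dy algebra_simps power2_eq_square power3_eq_cube)
  moreover define U3 where "U3 = (du (Dx (Dx f)) + a * du (Dx (Dy f)) + a\<^sup>2 * du (Dx (Dw f)))
       + a * (du (Dx (Dy f)) + a * du (Dy (Dy f)) + a\<^sup>2 * du (Dy (Dw f)))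
       + a\<^sup>2 * (du (Dx (Dw f)) + a * du (Dy (Dw f)) + a\<^sup>2 * du (Dw (Dw f)))"
  have "S dv = U3 + \<delta> * (H2 + \<delta> * P2)"
    by (simp add: S_def U3_def H2_def P2_def \<delta>_def du_def dv_def Dy_Dx Dw_Dx Dw_Dy algebra_simps power2_eq_square power3_eq_cube power4_eq_xxxx)
  ultimately have 2: "p dvd (X1 - (2 * X1 + \<delta> * Y1)) * (2 * H1) + P0 * (U3 + \<delta> * (H2 + \<delta> * P2))"
    using 1 by (simp add: P0_def)
  have R: "p dvd 2 * X1 * H1 + P0 * \<delta> * (H2 + \<delta> * P2)"
  proof -
    have "2 * X1 * H1 + P0 * \<delta> * (H2 + \<delta> * P2) = ((X1 - (2 * X1 + \<delta> * Y1)) * (2 * H1) + P0 * (U3 + \<delta> * (H2 + \<delta> * P2)))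
       + (2 * H1) * (2 * X1 + \<delta> * Y1) - P0 * U3"
      by (simp add: algebra_simps)
    moreover have "p dvd U3" using third_order_q by (simp add: U3_def)
    ultimately show ?thesis using 2 XY by (metis dvd_add dvd_diff dvd_mult)
  qed
  have "poly (umbilic f (a, b, e)) \<theta> = H0 * (P0 * H2 - H0 * P2) - 2 * (H1 * (P0 * H1 - H0 * P1))"
    by (simp add: umbilic_def Let_def grad_w_def grad_n_def pderiv_along pderiv_add pderiv_smult
        H0_def H1_def H2_def P0_def P1_def P2_def du_def Dy_Dx Dw_Dx Dw_Dy algebra_simps flip: val_def)
  also have "\<dots> = (2 * H1 * P1 + P0 * H2 + (K - H0) * P2 - H0 * P2) * K - P0 * (2 * X1 * H1 + P0 * \<delta> * (H2 + \<delta> * P2))"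
    by (simp add: K_def X1_def algebra_simps)
  finally show ?thesis using K R by (metis dvd_diff dvd_mult)
qed

end

section \<open>Polynomials of least degree on families of rays\<close>

lemma ex_nonroot_if_coeff:
  fixes p :: int and g :: "nat \<Rightarrow> int"
  assumes p: "prime p" and "int s < p" and i: "i \<le> s" "\<not> p dvd g i"
  shows "\<exists>x. \<not> p dvd (\<Sum>i\<le>s. g i * x ^ i)"
proof (rule ccontr)
  assume "\<not> ?thesis"
  define G where "G = (\<Sum>i\<le>s. monom (g i) i)"
  have "poly G x = (\<Sum>i\<le>s. g i * x ^ i)" for x
    by (simp add: G_def poly_sum poly_monom)
  with \<open>\<not> ?thesis\<close> have root: "p dvd poly G x" for x by auto
  have "degree G \<le> s"
    unfolding G_def by (intro degree_sum_le) (auto intro: order.trans[OF degree_monom_le])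
  then have "[:p:] dvd G"
    using p \<open>int s < p\<close> root prime_gt_0_int[OF p] by (intro const_dvd_if_many_roots[of p G s "{0..<p}"]) auto
  moreover have "coeff G i = g i"
    using i(1) by (simp add: G_def coeff_sum)
  ultimately show False using i(2) by (metis const_poly_dvd_iff)
qed

definition cube_poly :: "nat \<Rightarrow> (nat \<times> nat \<times> nat \<Rightarrow> int) \<Rightarrow> poly3" where
  "cube_poly s c = map (\<lambda>(i, j, k). (c (i, j, k), i, j, k)) (List.product [0..<Suc s] (List.product [0..<Suc s] [0..<Suc s]))"

lemma ev_cube_poly:
  fixes x y w :: "'a::comm_ring_1"
  shows "ev (cube_poly s c) x y w = (\<Sum>i\<le>s. \<Sum>j\<le>s. \<Sum>k\<le>s. of_int (c (i, j, k)) * x ^ i * y ^ j * w ^ k)"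
proof -
  let ?xs = "List.product [0..<Suc s] (List.product [0..<Suc s] [0..<Suc s])"
  have "ev (cube_poly s c) x y w = (\<Sum>(i, j, k)\<leftarrow>?xs. of_int (c (i, j, k)) * x ^ i * y ^ j * w ^ k)"
    by (simp add: ev_def cube_poly_def comp_def case_prod_unfold)
  also have "\<dots> = (\<Sum>(i, j, k)\<in>set ?xs. of_int (c (i, j, k)) * x ^ i * y ^ j * w ^ k)"
    by (intro sum_list_distinct_conv_sum_set distinct_product distinct_upt)
  also have "set ?xs = {..s} \<times> {..s} \<times> {..s}" by auto
  finally show ?thesis by (simp add: sum.cartesian_product)
qed

lemma degree3_le_cube_poly: "degree3_le (cube_poly s c) (3 * s)"
  by (auto simp: degree3_le_def cube_poly_def)

text \<open>There are more coefficient vectors modulo \<open>p\<close>, of polynomials of degree at most \<open>s\<close> in each variable, than possible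
  restrictions to the rays. Two polynomials with equal restrictions have the desired difference, which is a nonzero function
  because \<open>s < p\<close>.\<close>

lemma ex_poly3_vanishing_on_rays:
  fixes p :: int
  assumes p: "prime p" and s: "int s < p" and fin: "finite L" and card: "card L * (3 * s + 1) < (s + 1) ^ 3"
  obtains f x y w where "degree3_le f (3 * s)" "\<not> p dvd ev f x y w" "\<And>q. q \<in> L \<Longrightarrow> [:p:] dvd along f q"
proof -
  let ?I = "{..s} \<times> {..s} \<times> {..s}" and ?J = "L \<times> {..3 * s}"
  have p1: "p > 1" using p prime_gt_1_int by blast
  let ?C = "?I \<rightarrow>\<^sub>E {0..<p}" and ?R = "?J \<rightarrow>\<^sub>E {0..<p}"
  define \<Phi> where "\<Phi> c = (\<lambda>(q, i) \<in> ?J. coeff (along (cube_poly s c) q) i mod p)" for c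
  have "card ?R = nat p ^ (card L * (3 * s + 1))"
    using fin by (simp add: card_PiE card_cartesian_product)
  also have "\<dots> < nat p ^ (s + 1) ^ 3" using card p1 by (intro power_strict_increasing) auto
  also have "\<dots> = card ?C"
    by (simp add: card_PiE card_cartesian_product power3_eq_cube algebra_simps)
  finally have "card ?R < card ?C" .
  moreover have "\<Phi> ` ?C \<subseteq> ?R" using p1 by (auto simp: \<Phi>_def split: if_splits)
  moreover have "finite ?R" using fin by (intro finite_PiE) auto
  ultimately have "\<not> inj_on \<Phi> ?C" by (metis card_inj_on_le not_less)
  then obtain c c' where c: "c \<in> ?C" "c' \<in> ?C" "c \<noteq> c'" "\<Phi> c = \<Phi> c'" by (auto simp: inj_on_def)
  then obtain i j k where ijk: "i \<le> s" "j \<le> s" "k \<le> s" "c (i, j, k) \<noteq> c' (i, j, k)"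
    by (metis (no_types, lifting) PiE_ext SigmaE atMost_iff)
  define d where "d t = c t - c' t" for t
  have d: "\<not> p dvd d (i, j, k)"
    unfolding d_def using c(1,2) ijk by (intro not_dvd_diff_residues) (auto simp: PiE_iff)
  have "\<exists>w. \<not> p dvd (\<Sum>k\<le>s. d (i, j, k) * w ^ k)"
    using ex_nonroot_if_coeff[OF p s ijk(3), of "\<lambda>k. d (i, j, k)"] d by simp
  then obtain w where w: "\<not> p dvd (\<Sum>k\<le>s. d (i, j, k) * w ^ k)" by blast
  have "\<exists>y. \<not> p dvd (\<Sum>j\<le>s. (\<Sum>k\<le>s. d (i, j, k) * w ^ k) * y ^ j)"
    using ex_nonroot_if_coeff[OF p s ijk(2), of "\<lambda>j. \<Sum>k\<le>s. d (i, j, k) * w ^ k"] w by simp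
  then obtain y where y: "\<not> p dvd (\<Sum>j\<le>s. (\<Sum>k\<le>s. d (i, j, k) * w ^ k) * y ^ j)" by blast
  have "\<exists>x. \<not> p dvd (\<Sum>i\<le>s. (\<Sum>j\<le>s. (\<Sum>k\<le>s. d (i, j, k) * w ^ k) * y ^ j) * x ^ i)"
    using ex_nonroot_if_coeff[OF p s ijk(1), of "\<lambda>i. \<Sum>j\<le>s. (\<Sum>k\<le>s. d (i, j, k) * w ^ k) * y ^ j"] y by simp
  then obtain x where x: "\<not> p dvd (\<Sum>i\<le>s. (\<Sum>j\<le>s. (\<Sum>k\<le>s. d (i, j, k) * w ^ k) * y ^ j) * x ^ i)" by blast
  show thesis
  proof (rule that)
    show "degree3_le (cube_poly s d) (3 * s)" by (rule degree3_le_cube_poly)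
    have "ev (cube_poly s d) x y w = (\<Sum>i\<le>s. (\<Sum>j\<le>s. (\<Sum>k\<le>s. d (i, j, k) * w ^ k) * y ^ j) * x ^ i)"
      by (simp add: ev_cube_poly sum_distrib_left sum_distrib_right mult_ac)
    then show "\<not> p dvd ev (cube_poly s d) x y w" using x by simp
    fix q assume q: "q \<in> L"
    have eq: "along (cube_poly s d) q = along (cube_poly s c) q - along (cube_poly s c') q"
      by (simp add: along_def ev_cube_poly d_def sum_subtractf algebra_simps split: prod.splits)
    have "p dvd coeff (along (cube_poly s d) q) m" for m
    proof (cases "m \<le> 3 * s")
      case True
      then have "coeff (along (cube_poly s c) q) m mod p = coeff (along (cube_poly s c') q) m mod p"
        using fun_cong[OF c(4), of "(q, m)"] q by (simp add: \<Phi>_def)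
      then show ?thesis by (simp add: eq mod_eq_dvd_iff)
    next
      case False
      then have "degree (along (cube_poly s d) q) < m"
        using degree_along_le[OF degree3_le_cube_poly, of s d q] by linarith
      then show ?thesis by (simp add: coeff_eq_0)
    qed
    then show "[:p:] dvd along (cube_poly s d) q" by (simp add: const_poly_dvd_iff)
  qed
qed

lemma constant_if_pderiv_vanishes:
  fixes p :: int
  assumes p: "prime p" and deg: "int (degree g) < p" and "\<And>x. p dvd poly (pderiv g) x"
  shows "[poly g x = poly g 0] (mod p)"
proof -
  have "degree (pderiv g) < card {0..<p}" using deg by (simp add: degree_pderiv)
  then have D: "[:p:] dvd pderiv g"
    using assms by (intro const_dvd_if_many_roots[of p _ "degree (pderiv g)" "{0..<p}"]) auto
  have "p dvd coeff g (Suc i)" for i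
  proof (cases "Suc i \<le> degree g")
    case True
    have "p dvd int (Suc i) * coeff g (Suc i)"
      using D by (simp add: const_poly_dvd_iff coeff_pderiv)
    moreover have "\<not> p dvd int (Suc i)" using True deg by (auto dest: zdvd_imp_le)
    ultimately show ?thesis using p by (metis prime_dvd_multD)
  qed (simp add: coeff_eq_0)
  then have "[:p:] dvd g - [:coeff g 0:]"
    by (auto simp: const_poly_dvd_iff coeff_pCons split: nat.splits)
  from const_dvd_poly[OF this, of x] show ?thesis by (simp add: cong_iff_dvd_diff poly_0_coeff_0)
qed

text \<open>Again the degree below \<open>p\<close> excludes \<open>p\<close>-th powers.\<close>

lemma ev_const_if_derivs_vanish:
  fixes p :: int
  assumes p: "prime p" and f: "degree3_le f d" "int d < p"
    and D: "\<And>x y w. p dvd ev (Dx f) x y w" "\<And>x y w. p dvd ev (Dy f) x y w" "\<And>x y w. p dvd ev (Dw f) x y w"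
  shows "[ev f x y w = ev f x' y' w'] (mod p)"
proof -
  have 0: "[ev f x y w = ev f 0 0 0] (mod p)" for x y w
  proof -
    have 1: "[ev f x y w = ev f 0 y w] (mod p)"
      using constant_if_pderiv_vanishes[OF p, of "ev f [:0, 1:] [:y:] [:w:]" x] degree_ev_le[OF f(1), of "[:0, 1:]" "[:y:]" "[:w:]"] f(2) D(1)
      by (simp add: poly_ev pderiv_ev pderiv_pCons)
    have 2: "[ev f 0 y w = ev f 0 0 w] (mod p)"
      using constant_if_pderiv_vanishes[OF p, of "ev f [:0:] [:0, 1:] [:w:]" y] degree_ev_le[OF f(1), of "[:0:]" "[:0, 1:]" "[:w:]"] f(2) D(2)
      by (simp add: poly_ev pderiv_ev pderiv_pCons)
    have 3: "[ev f 0 0 w = ev f 0 0 0] (mod p)"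
      using constant_if_pderiv_vanishes[OF p, of "ev f [:0:] [:0:] [:0, 1:]" w] degree_ev_le[OF f(1), of "[:0:]" "[:0:]" "[:0, 1:]"] f(2) D(3)
      by (simp add: poly_ev pderiv_ev pderiv_pCons)
    from 1 2 3 show ?thesis using cong_trans by blast
  qed
  show ?thesis using 0[of x y w] 0[of x' y' w'] by (metis cong_sym cong_trans)
qed

text \<open>For a nonzero polynomial of least degree that vanishes on the rays, some derivative does not vanish on all rays:
  otherwise all derivatives, being of lower degree, are zero, and the polynomial is a nonzero constant.\<close>

lemma ex_minimal_poly3_vanishing_on_rays:
  fixes p :: int
  assumes p: "prime p" and s: "3 * int s < p" and fin: "finite L" "L \<noteq> {}" and card: "card L * (3 * s + 1) < (s + 1) ^ 3"
  obtains f q where "degree3_le f (3 * s)" "\<And>q. q \<in> L \<Longrightarrow> [:p:] dvd along f q"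
    "q \<in> L" "\<not> ([:p:] dvd along (Dx f) q \<and> [:p:] dvd along (Dy f) q \<and> [:p:] dvd along (Dw f) q)"
proof -
  define \<P> where "\<P> d \<longleftrightarrow> (\<exists>f x y w. degree3_le f d \<and> \<not> p dvd ev f x y w \<and> (\<forall>q\<in>L. [:p:] dvd along f q))" for d
  have "\<P> (3 * s)"
  proof -
    have "int s < p" using s by linarith
    then obtain f x y w where "degree3_le f (3 * s)" "\<not> p dvd ev f x y w" "\<And>q. q \<in> L \<Longrightarrow> [:p:] dvd along f q"
      using ex_poly3_vanishing_on_rays[OF p _ fin(1) card] by blast
    then show ?thesis unfolding \<P>_def by blast
  qed
  define d where "d = (LEAST d. \<P> d)"
  have d: "\<P> d" "d \<le> 3 * s" "\<And>d'. \<P> d' \<Longrightarrow> d \<le> d'"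
    using \<open>\<P> (3 * s)\<close> by (auto simp: d_def intro: LeastI Least_le)
  obtain f x y w where f: "degree3_le f d" "\<not> p dvd ev f x y w" "\<And>q. q \<in> L \<Longrightarrow> [:p:] dvd along f q"
    using d(1) unfolding \<P>_def by blast
  have "\<exists>q\<in>L. \<not> ([:p:] dvd along (Dx f) q \<and> [:p:] dvd along (Dy f) q \<and> [:p:] dvd along (Dw f) q)"
  proof (rule ccontr)
    assume no: "\<not> ?thesis"
    have van: "p dvd ev g x y w" if "g \<in> {Dx f, Dy f, Dw f}" for g x y w
    proof (cases "d = 0")
      case True
      then have "\<forall>(c, i, j, k) \<in> set g. c = 0"
        using that f(1) by (fastforce simp: degree3_le_def Dx_def Dy_def Dw_def)
      then have "ev g x y w = 0" by (induction g) auto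
      then show ?thesis by simp
    next
      case False
      have "degree3_le g (d - 1)" using that degree3_le_derivs[OF f(1)] by auto
      moreover have "\<forall>q\<in>L. [:p:] dvd along g q" using that no by auto
      moreover have "\<not> \<P> (d - 1)" using d(3)[of "d - 1"] False by auto
      ultimately show ?thesis unfolding \<P>_def by blast
    qed
    obtain a b e where q: "(a, b, e) \<in> L" using fin(2) by auto
    have "int d < p" using d(2) s by linarith
    then have "[ev f x y w = ev f 0 b e] (mod p)"
      using van by (intro ev_const_if_derivs_vanish[OF p f(1)]) auto
    moreover have "p dvd ev f 0 b e"
      using const_dvd_poly[OF f(3)[OF q], of 0] by (simp add: along_def poly_ev)
    ultimately show False using f(2) cong_dvd_iff by blast
  qed
  then show thesis using that f(1,3) d(2) degree3_le_mono by blast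
qed

lemma degree_asymptotic_le: "degree3_le f D \<Longrightarrow> degree (asymptotic f q) \<le> 5 * D"
proof -
  assume f: "degree3_le f D"
  have dd: "degree (along (Dx f) q) \<le> D" "degree (along (Dy f) q) \<le> D" "degree (along (Dw f) q) \<le> D"
    "degree3_le (Dx f) D" "degree3_le (Dy f) D" "degree3_le (Dw f) D"
    using degree3_le_derivs[OF f] by (auto intro!: degree_along_le intro: degree3_le_mono)
  have dd2: "degree (along (A (B f)) q) \<le> D" if "A \<in> {Dx, Dy, Dw}" "B \<in> {Dx, Dy, Dw}" for A B
    using that degree3_le_derivs[OF dd(4)] degree3_le_derivs[OF dd(5)] degree3_le_derivs[OF dd(6)]
    by (auto intro!: degree_along_le intro: degree3_le_mono)
  define P N where "P = along (Dw f) q" and "N = - along (Dy f) q - smult (fst q) P"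
  have P: "degree P \<le> D" using dd by (simp add: P_def)
  have N: "degree N \<le> D"
    unfolding N_def using dd P by (intro degree_diff_le order.trans[OF degree_smult_le]) auto
  have pw: "degree (Z ^ m) \<le> m * D" if "degree Z \<le> D" for Z :: "int poly" and m
    by (rule order.trans[OF degree_power_le]) (use mult_le_mono1[OF that, of m] in \<open>simp add: mult.commute\<close>)
  have ml: "degree (X * Y) \<le> m + n" if "degree X \<le> m" "degree Y \<le> n" for X Y :: "int poly" and m n
    using degree_mult_le[of X Y] that by linarith
  have sm: "degree (smult c X) \<le> m" if "degree X \<le> m" for c and X :: "int poly" and m
    using degree_smult_le[of c X] that by linarith
  have t1: "degree (P ^ 4 * along (Dx (Dx f)) q) \<le> 4 * D + D"
    by (intro ml pw P dd2) auto
  have t2: "degree (P ^ 3 * N * smult 2 (along (Dx (Dy f)) q)) \<le> (3 * D + D) + D"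
    by (intro ml pw P N sm dd2) auto
  have t3: "degree (P ^ 2 * N ^ 2 * (along (Dy (Dy f)) q + smult 2 (along (Dx (Dw f)) q))) \<le> (2 * D + 2 * D) + D"
    by (intro ml pw P N sm dd2 degree_add_le) auto
  have t4: "degree (P * N ^ 3 * smult 2 (along (Dy (Dw f)) q)) \<le> (D + 3 * D) + D"
    by (intro ml pw P N sm dd2) auto
  have t5: "degree (N ^ 4 * along (Dw (Dw f)) q) \<le> 4 * D + D"
    by (intro ml pw P N dd2) auto
  show ?thesis
    unfolding asymptotic_def Let_def P_def[symmetric] N_def[symmetric]
    using t1 t2 t3 t4 t5 by (intro degree_add_le) linarith+
qed

lemma degree_grad_le:
  assumes "degree3_le f D"
  shows "degree (grad_w f q) \<le> D" "degree (grad_n f q) \<le> D"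
proof -
  have dd: "degree (along (Dy f) q) \<le> D" "degree (along (Dw f) q) \<le> D"
    using degree3_le_derivs[OF assms] by (auto intro!: degree_along_le intro: degree3_le_mono)
  then show "degree (grad_w f q) \<le> D" by (simp add: grad_w_def)
  show "degree (grad_n f q) \<le> D"
    unfolding grad_n_def using dd by (intro degree_add_le order.trans[OF degree_smult_le])
qed

lemma degree_umbilic_le:
  assumes "degree3_le f D"
  shows "degree (umbilic f q) \<le> 3 * D"
proof -
  note g = degree_grad_le[OF assms, of q]
  have pd: "degree (pderiv X) \<le> D" if "degree X \<le> D" for X :: "int poly"
    using that by (simp add: degree_pderiv)
  have ml: "degree (X * Y) \<le> m + n" if "degree X \<le> m" "degree Y \<le> n" for X Y :: "int poly" and m n
    using degree_mult_le[of X Y] that by linarith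
  have sm: "degree (smult c X) \<le> m" if "degree X \<le> m" for c and X :: "int poly" and m
    using degree_smult_le[of c X] that by linarith
  have "degree (umbilic f q) \<le> D + (D + D)"
    unfolding umbilic_def Let_def by (intro degree_diff_le ml sm pd g)
  then show ?thesis by simp
qed

text \<open>The quotient rule for \<open>- P / H\<close> gives the first derivative \<open>- W / H^2\<close> with the Wronskian \<open>W = P' H - P H'\<close>; so the
  vanishing of \<open>umbilic\<close> is the vanishing of the Wronskian of \<open>W\<close> and \<open>H^2\<close>.\<close>

lemma wronskian_of_umbilic:
  fixes P H :: "int poly"
  shows "pderiv (pderiv P * H - P * pderiv H) * H\<^sup>2 - (pderiv P * H - P * pderiv H) * pderiv (H\<^sup>2)
    = - H * (H * (P * pderiv (pderiv H) - H * pderiv (pderiv P)) - smult 2 (pderiv H * (P * pderiv H - H * pderiv P)))"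
proof -
  have "smult 2 X = X + X" for X :: "int poly"
    by (metis one_add_one smult_1_left smult_add_left)
  then show ?thesis
    by (simp add: pderiv_mult pderiv_diff power2_eq_square algebra_simps)
qed

text \<open>The rays have to cross in more points than the degrees, at most \<open>5 (3 s)\<close>, of the polynomials that are shown to vanish
  on them. The conclusion for one ray \<open>(a, b, e)\<close> is a fixed linear relation between the parameters \<open>a'\<close> and \<open>b'\<close> of
  the rays that cross it, except for at most \<open>3 s\<close> crossings, the singular points of the surface on this ray.\<close>

theorem rays_crossing_often_are_collinear:
  fixes p :: int
  assumes p: "prime p" and s: "6 * int s < p" and fin: "finite L" "L \<noteq> {}" and card: "card L * (3 * s + 1) < (s + 1) ^ 3"
    and \<Theta>: "\<And>q. q \<in> L \<Longrightarrow> \<Theta> q \<subseteq> {0..<p}" "\<And>q. q \<in> L \<Longrightarrow> 15 * s < card (\<Theta> q)"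
    and cross: "\<And>q \<theta>. q \<in> L \<Longrightarrow> \<theta> \<in> \<Theta> q \<Longrightarrow> \<exists>q'\<in>L. cross p q q' \<theta>"
  shows "\<exists>a b e \<kappa> \<mu> T. (a, b, e) \<in> L \<and> T \<subseteq> \<Theta> (a, b, e) \<and> card (\<Theta> (a, b, e)) \<le> card T + 3 * s \<and>
    (\<forall>\<theta>\<in>T. \<forall>a' b' e'. (a', b', e') \<in> L \<longrightarrow> cross p (a, b, e) (a', b', e') \<theta> \<longrightarrow>
       p dvd 1 + \<kappa> * (a' - a) + \<mu> * (b - b'))"
proof -
  define D where "D = 3 * s"
  have s3: "3 * int s < p" using s by linarith
  have s1: "s \<ge> 1" using card fin by (cases s) (auto simp: card_gt_0_iff)
  obtain f q where f: "degree3_le f D" and van: "\<And>q. q \<in> L \<Longrightarrow> [:p:] dvd along f q"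
    and q: "q \<in> L" "\<not> ([:p:] dvd along (Dx f) q \<and> [:p:] dvd along (Dy f) q \<and> [:p:] dvd along (Dw f) q)"
    unfolding D_def using ex_minimal_poly3_vanishing_on_rays[OF p s3 fin card] by blast
  obtain a b e where qe: "q = (a, b, e)" by (metis prod_cases3)
  have fin\<Theta>: "finite (\<Theta> q)" using \<Theta>(1)[OF q(1)] finite_subset by blast
  have big: "5 * D < card (\<Theta> q')" if "q' \<in> L" for q' using \<Theta>(2)[OF that] by (simp add: D_def)
  have loc: "crossing_rays p a b e a' b' e' \<theta> f"
    if "(a, b, e) \<in> L" "(a', b', e') \<in> L" "cross p (a, b, e) (a', b', e') \<theta>" for a b e a' b' e' \<theta>
    by unfold_locales (use p that van in auto)
  define P where "P = grad_w f q"
  define H where "H = grad_n f q"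
  (* If the w-derivative vanishes on q, then by the crossings so does the y-derivative, and finally the x-derivative. *)
  have P0: "\<not> [:p:] dvd P"
  proof
    assume "[:p:] dvd P"
    then have w0: "[:p:] dvd along (Dw f) q" by (simp add: P_def grad_w_def)
    have "p dvd poly (along (Dy f) q) \<theta>" if \<theta>: "\<theta> \<in> \<Theta> q" for \<theta>
    proof -
      obtain a' b' e' where q': "(a', b', e') \<in> L" "cross p q (a', b', e') \<theta>" using cross[OF q(1) \<theta>] by auto
      interpret crossing_rays p a b e a' b' e' \<theta> f using loc q q' qe by simp
      have "p dvd (a + a') * poly (along (Dw f) q) \<theta>" using const_dvd_poly[OF w0] by (rule dvd_mult)
      then show ?thesis using second_root by (simp add: val_def qe dvd_add_left_iff)
    qed
    moreover have "degree (along (Dy f) q) \<le> D"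
      using degree3_le_derivs(2)[OF f] by (auto intro!: degree_along_le intro: degree3_le_mono)
    ultimately have y0: "[:p:] dvd along (Dy f) q"
      using big[OF q(1)] \<Theta>(1)[OF q(1)] by (intro const_dvd_if_many_roots[OF p, of _ D "\<Theta> q"]) auto
    have "[:p:] dvd pderiv (along f q)" using van[OF q(1)] by (rule const_dvd_pderiv)
    moreover have "pderiv (along f q) = along (Dx f) q + (smult a (along (Dy f) q) + smult (a\<^sup>2) (along (Dw f) q))"
      by (simp add: pderiv_along qe)
    ultimately have "[:p:] dvd along (Dx f) q"
      using w0 y0 by (metis dvd_add_left_iff dvd_add dvd_smult)
    with w0 y0 q(2) show False by blast
  qed
  (* At each crossing of q' the other null direction is asymptotic, and there are more crossings than the degree. *)
  have asym: "[:p:] dvd asymptotic f q'" if q': "q' \<in> L" for q'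
  proof (rule const_dvd_if_many_roots[OF p degree_asymptotic_le[OF f] \<Theta>(1)[OF q'] _ big[OF q']])
    fix \<theta> assume \<theta>: "\<theta> \<in> \<Theta> q'"
    obtain a1 b1 e1 where q1: "(a1, b1, e1) \<in> L" "cross p q' (a1, b1, e1) \<theta>" using cross[OF q' \<theta>] by auto
    obtain a2 b2 e2 where q2: "q' = (a2, b2, e2)" by (metis prod_cases3)
    interpret crossing_rays p a1 b1 e1 a2 b2 e2 \<theta> f using loc q1 q2 q' cross_sym by blast
    show "p dvd poly (asymptotic f q') \<theta>" using asymptotic_at_cross q2 by simp
  qed
  define T where "T = {\<theta> \<in> \<Theta> q. \<not> p dvd poly P \<theta>}"
  have "card (\<Theta> q - T) \<le> D"
    using \<Theta>(1)[OF q(1)] by (intro card_roots_mod_prime_le[OF p P0]) (auto simp: P_def T_def degree_grad_le[OF f])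
  then have T: "card (\<Theta> q) \<le> card T + D"
    using fin\<Theta> card_Diff_subset[of T "\<Theta> q"] card_mono[of "\<Theta> q" T] by (auto simp: T_def)
  have rel: "p dvd poly H \<theta> + (a' - a) * poly P \<theta>"
    if "(a', b', e') \<in> L" "cross p (a, b, e) (a', b', e') \<theta>" for a' b' e' \<theta>
  proof -
    interpret crossing_rays p a b e a' b' e' \<theta> f using loc q qe that by simp
    show ?thesis using normal_relation by (simp add: P_def H_def qe)
  qed
  have "p dvd poly (umbilic f q) \<theta>" if \<theta>: "\<theta> \<in> T" for \<theta>
  proof -
    obtain a' b' e' where q': "(a', b', e') \<in> L" "cross p q (a', b', e') \<theta>"
      using cross[OF q(1), of \<theta>] \<theta> by (auto simp: T_def)
    interpret crossing_rays p a b e a' b' e' \<theta> f using loc q q' qe by simp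
    show ?thesis using umbilic_at_cross asym[OF q'(1)] \<theta> by (simp add: P_def T_def qe)
  qed
  then have umb: "[:p:] dvd umbilic f q"
    using \<Theta>(1)[OF q(1)] T big[OF q(1)] by (intro const_dvd_if_many_roots[OF p degree_umbilic_le[OF f], of T]) (auto simp: T_def)
  have "T \<noteq> {}" using T big[OF q(1)] by auto
  then obtain \<theta>0 where \<theta>0: "\<theta>0 \<in> T" by blast
  then obtain a0 b0 e0 where q0: "(a0, b0, e0) \<in> L" "cross p q (a0, b0, e0) \<theta>0"
    using cross[OF q(1), of \<theta>0] by (auto simp: T_def)
  have H0: "\<not> [:p:] dvd H"
  proof
    assume "[:p:] dvd H"
    then have "p dvd poly H \<theta>0" by (rule const_dvd_poly)
    then have "p dvd (a0 - a) * poly P \<theta>0" using rel q0 qe by (metis dvd_add_right_iff)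
    moreover have "\<not> p dvd a0 - a" using q0(2) by (simp add: cross_def qe)
    ultimately show False using \<theta>0 p by (simp add: T_def prime_dvd_mult_iff)
  qed
  have degP: "degree P \<le> D" and degH: "degree H \<le> D" using degree_grad_le[OF f] by (simp_all add: P_def H_def)
  let ?W = "pderiv P * H - P * pderiv H"
  have "[:p:] dvd pderiv ?W * H\<^sup>2 - ?W * pderiv (H\<^sup>2)"
    unfolding wronskian_of_umbilic using umb by (simp add: umbilic_def Let_def P_def H_def)
  moreover have "\<not> [:p:] dvd H\<^sup>2" using H0 by (simp add: power2_eq_square const_prime_dvd_mult_iff[OF p])
  moreover have "degree ?W \<le> D + D"
    using degP degH degree_mult_le[of "pderiv P" H] degree_mult_le[of P "pderiv H"]
    by (intro degree_diff_le) (simp_all add: degree_pderiv)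
  moreover have "degree (H\<^sup>2) \<le> D + D"
    using degH degree_mult_le[of H H] by (simp add: power2_eq_square)
  ultimately obtain \<mu> where \<mu>: "[:p:] dvd ?W - smult \<mu> (H\<^sup>2)"
    using proportional_if_wronskian_vanishes[OF p, of ?W "H\<^sup>2"] s by (auto simp: D_def)
  (* The derivative of P / H is the constant \<mu>, so (P - \<mu> X H) / H is constant. *)
  let ?P = "P - smult \<mu> ([:0, 1:] * H)"
  have "pderiv ?P * H - ?P * pderiv H = ?W - smult \<mu> (H\<^sup>2)"
    by (simp add: pderiv_mult pderiv_diff pderiv_smult pderiv_pCons algebra_simps power2_eq_square smult_diff_right smult_add_right)
  moreover have "degree ?P \<le> D + 1"
  proof (rule degree_diff_le)
    show "degree P \<le> D + 1" using degP by simp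
    have "degree ([:0, 1:] * H) \<le> D + 1"
      by (rule order.trans[OF degree_mult_le]) (use degH in simp)
    then show "degree (smult \<mu> ([:0, 1:] * H)) \<le> D + 1"
      by (rule order.trans[OF degree_smult_le])
  qed
  ultimately obtain \<kappa> where \<kappa>: "[:p:] dvd ?P - smult \<kappa> H"
    using proportional_if_wronskian_vanishes[OF p, of ?P H] \<mu> H0 degH s s1 by (auto simp: D_def)
  have final: "p dvd 1 + \<kappa> * (a' - a) + \<mu> * (b - b')"
    if \<theta>: "\<theta> \<in> T" and q': "(a', b', e') \<in> L" "cross p (a, b, e) (a', b', e') \<theta>" for \<theta> a' b' e'
  proof -
    have k: "p dvd poly P \<theta> - \<mu> * (\<theta> * poly H \<theta>) - \<kappa> * poly H \<theta>"
      using const_dvd_poly[OF \<kappa>, of \<theta>] by (simp add: mult.left_commute)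
    have r: "p dvd poly H \<theta> + (a' - a) * poly P \<theta>" using rel q' by blast
    have "[b + a * \<theta> = b' + a' * \<theta>] (mod p)" using q'(2) by (simp add: cross_def)
    then have \<theta>b: "p dvd (b + a * \<theta>) - (b' + a' * \<theta>)" by (simp add: cong_iff_dvd_diff)
    have "poly P \<theta> * (1 + \<kappa> * (a' - a) + \<mu> * (b - b')) = (poly P \<theta> - \<mu> * (\<theta> * poly H \<theta>) - \<kappa> * poly H \<theta>)
        + (\<kappa> + \<mu> * \<theta>) * (poly H \<theta> + (a' - a) * poly P \<theta>) + (poly P \<theta> * \<mu>) * ((b + a * \<theta>) - (b' + a' * \<theta>))"
      by (simp add: algebra_simps)
    then have "p dvd poly P \<theta> * (1 + \<kappa> * (a' - a) + \<mu> * (b - b'))"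
      using k r \<theta>b by (metis dvd_add dvd_mult)
    then show ?thesis using \<theta> p by (simp add: T_def prime_dvd_mult_iff)
  qed
  have "(a, b, e) \<in> L" "T \<subseteq> \<Theta> (a, b, e)" "card (\<Theta> (a, b, e)) \<le> card T + 3 * s"
    using q qe T by (auto simp: T_def D_def)
  with final show ?thesis by blast
qed

section \<open>Counting in finite graphs\<close>

lemma card_filter_pairs_fst:
  assumes "finite X" "finite Y"
  shows "card {(x, y). x \<in> X \<and> y \<in> Y \<and> R x y} = (\<Sum>x\<in>X. card {y \<in> Y. R x y})"
proof -
  have "{(x, y). x \<in> X \<and> y \<in> Y \<and> R x y} = (SIGMA x:X. {y \<in> Y. R x y})" by auto
  then show ?thesis using assms by (simp add: card_SigmaI)
qed

lemma card_filter_pairs_snd: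
  assumes "finite X" "finite Y"
  shows "card {(x, y). x \<in> X \<and> y \<in> Y \<and> R x y} = (\<Sum>y\<in>Y. card {x \<in> X. R x y})"
proof -
  have "{(x, y). x \<in> X \<and> y \<in> Y \<and> R x y} = prod.swap ` (SIGMA y:Y. {x \<in> X. R x y})" by auto
  then show ?thesis using assms by (simp add: card_SigmaI card_image)
qed

lemma card_Un5_le: "card (A \<union> B \<union> C \<union> D \<union> E) \<le> card A + card B + card C + card D + card E"
  using card_Un_le[of "A \<union> B \<union> C \<union> D" E] card_Un_le[of "A \<union> B \<union> C" D] card_Un_le[of "A \<union> B" C] card_Un_le[of A B]
  by linarith

lemma sum_card_swap:
  assumes "finite X" "finite Y"
  shows "(\<Sum>x\<in>X. card {y \<in> Y. R x y}) = (\<Sum>y\<in>Y. card {x \<in> X. R x y})"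
  using card_filter_pairs_fst[OF assms] card_filter_pairs_snd[OF assms] by simp

text \<open>Delete vertices of too small degree as long as there are any. The deleted edges are fewer than \<open>\<Sum> f + \<Sum> g\<close>, so an edge
  survives.\<close>

lemma prune_bipartite_graph:
  fixes f :: "'a \<Rightarrow> real" and g :: "'b \<Rightarrow> real"
  assumes f: "\<And>x. 0 \<le> f x" and g: "\<And>y. 0 \<le> g y"
    and "finite X" "finite Y" "(\<Sum>x\<in>X. f x) + (\<Sum>y\<in>Y. g y) < card {(x, y). x \<in> X \<and> y \<in> Y \<and> R x y}"
  shows "\<exists>X' Y'. X' \<subseteq> X \<and> Y' \<subseteq> Y \<and> (\<exists>x\<in>X'. \<exists>y\<in>Y'. R x y) \<and>
    (\<forall>x\<in>X'. f x \<le> card {y \<in> Y'. R x y}) \<and> (\<forall>y\<in>Y'. g y \<le> card {x \<in> X'. R x y})" (is "?goal X Y")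
  using assms(3-)
proof (induction "card X + card Y" arbitrary: X Y rule: less_induct)
  case less
  note fin = less.prems(1,2)
  consider x where "x \<in> X" "card {y \<in> Y. R x y} < f x" | y where "y \<in> Y" "card {x \<in> X. R x y} < g y"
    | "\<And>x. x \<in> X \<Longrightarrow> f x \<le> card {y \<in> Y. R x y}" "\<And>y. y \<in> Y \<Longrightarrow> g y \<le> card {x \<in> X. R x y}"
    by (meson not_le)
  then show ?case
  proof cases
    case 1
    have "real (card {(x, y). x \<in> X \<and> y \<in> Y \<and> R x y})
        = card {y \<in> Y. R x y} + real (card {(u, y). u \<in> X - {x} \<and> y \<in> Y \<and> R u y})"
      using card_filter_pairs_fst[of X Y R] card_filter_pairs_fst[of "X - {x}" Y R] fin 1(1)
      by (simp add: sum.remove del: Diff_iff)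
    moreover have "sum f X = f x + sum f (X - {x})" using fin(1) 1(1) by (rule sum.remove)
    ultimately have "sum f (X - {x}) + sum g Y < real (card {(u, y). u \<in> X - {x} \<and> y \<in> Y \<and> R u y})"
      using less.prems(3) 1(2) by linarith
    moreover have "card (X - {x}) + card Y < card X + card Y"
      using card_Diff1_less[OF fin(1) 1(1)] by linarith
    ultimately have "?goal (X - {x}) Y" using fin by (intro less.hyps) auto
    then obtain X' Y' where "X' \<subseteq> X - {x}" "Y' \<subseteq> Y" and *: "\<exists>x\<in>X'. \<exists>y\<in>Y'. R x y"
      "\<forall>x\<in>X'. f x \<le> card {y \<in> Y'. R x y}" "\<forall>y\<in>Y'. g y \<le> card {x \<in> X'. R x y}" by (elim exE conjE)
    then have "X' \<subseteq> X" "Y' \<subseteq> Y" by auto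
    with * show ?thesis by (intro exI[of _ X'] exI[of _ Y'] conjI)
  next
    case 2
    have "real (card {(x, y). x \<in> X \<and> y \<in> Y \<and> R x y})
        = card {x \<in> X. R x y} + real (card {(x, v). x \<in> X \<and> v \<in> Y - {y} \<and> R x v})"
      using card_filter_pairs_snd[of X Y R] card_filter_pairs_snd[of X "Y - {y}" R] fin 2(1)
      by (simp add: sum.remove del: Diff_iff)
    moreover have "sum g Y = g y + sum g (Y - {y})" using fin(2) 2(1) by (rule sum.remove)
    ultimately have "sum f X + sum g (Y - {y}) < real (card {(x, v). x \<in> X \<and> v \<in> Y - {y} \<and> R x v})"
      using less.prems(3) 2(2) by linarith
    moreover have "card X + card (Y - {y}) < card X + card Y"
      using card_Diff1_less[OF fin(2) 2(1)] by linarith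
    ultimately have "?goal X (Y - {y})" using fin by (intro less.hyps) auto
    then obtain X' Y' where "X' \<subseteq> X" "Y' \<subseteq> Y - {y}" and *: "\<exists>x\<in>X'. \<exists>y\<in>Y'. R x y"
      "\<forall>x\<in>X'. f x \<le> card {y \<in> Y'. R x y}" "\<forall>y\<in>Y'. g y \<le> card {x \<in> X'. R x y}" by (elim exE conjE)
    then have "X' \<subseteq> X" "Y' \<subseteq> Y" by auto
    with * show ?thesis by (intro exI[of _ X'] exI[of _ Y'] conjI)
  next
    case 3
    have "{(x, y). x \<in> X \<and> y \<in> Y \<and> R x y} \<noteq> {}"
    proof
      assume "{(x, y). x \<in> X \<and> y \<in> Y \<and> R x y} = {}"
      then have "sum f X + sum g Y < 0" using less.prems(3) by (simp only: card.empty)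
      moreover have "0 \<le> sum f X + sum g Y" using f g by (simp add: sum_nonneg)
      ultimately show False by simp
    qed
    then have "\<exists>x\<in>X. \<exists>y\<in>Y. R x y" by auto
    with 3 show ?thesis by (intro exI[of _ X] exI[of _ Y] conjI) auto
  qed
qed

text \<open>Cauchy--Schwarz for the sizes of the fibres of \<open>h\<close>.\<close>

lemma card_squared_le_image_times_collisions:
  assumes "finite S"
  shows "(real (card S))\<^sup>2 \<le> card (h ` S) * card {(x, y). x \<in> S \<and> y \<in> S \<and> h x = h y}"
proof -
  let ?F = "\<lambda>v. {x \<in> S. h x = v}"
  have "card S = (\<Sum>v\<in>h ` S. card (?F v))"
    using sum.image_gen[OF assms, of "\<lambda>_. 1" h] by (simp only: card_eq_sum)
  then have "(real (card S))\<^sup>2 = (\<Sum>v\<in>h ` S. real (card (?F v)))\<^sup>2" by simp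
  also have "\<dots> \<le> (\<Sum>v\<in>h ` S. (real (card (?F v)))\<^sup>2) * card (h ` S)"
    by (rule sum_squared_le_sum_of_squares)
  also have "(\<Sum>v\<in>h ` S. (real (card (?F v)))\<^sup>2) = real (\<Sum>v\<in>h ` S. card (?F v) * card (?F v))"
    by (simp add: power2_eq_square)
  also have "(\<Sum>v\<in>h ` S. card (?F v) * card (?F v)) = (\<Sum>v\<in>h ` S. \<Sum>x\<in>?F v. card {y \<in> S. h x = h y})"
  proof (intro sum.cong refl)
    fix v
    have "{y \<in> S. h x = h y} = ?F v" if "x \<in> ?F v" for x using that by auto
    then have "(\<Sum>x\<in>?F v. card {y \<in> S. h x = h y}) = (\<Sum>x\<in>?F v. card (?F v))"
      by (intro sum.cong refl arg_cong[of _ _ card])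
    then show "card (?F v) * card (?F v) = (\<Sum>x\<in>?F v. card {y \<in> S. h x = h y})"
      by (simp only: sum_constant of_nat_id)
  qed
  also have "\<dots> = (\<Sum>x\<in>S. card {y \<in> S. h x = h y})"
    by (rule sum.image_gen[OF assms, symmetric])
  also have "\<dots> = card {(x, y). x \<in> S \<and> y \<in> S \<and> h x = h y}"
    using assms by (simp add: card_filter_pairs_fst)
  finally show ?thesis by (simp add: mult.commute)
qed

text \<open>The bound is \<open>1 / (1 / |S| + 512 / p)\<close> for the size of the image, in which both terms of the denominator are at most
  \<open>1 / (100 Q)\<close>.\<close>

lemma card_image_ge_if_few_collisions:
  assumes S: "finite S" "100 * real Q \<le> card S" and Q: "0 < Q" and p: "51200 * real Q \<le> p"
    and coll: "real (card {(x, y). x \<in> S \<and> y \<in> S \<and> x \<noteq> y \<and> h x = h y}) * p \<le> 512 * (real (card S))\<^sup>2"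
  shows "50 * Q \<le> card (h ` S)"
proof -
  let ?n = "real (card S)" and ?C = "{(x, y). x \<in> S \<and> y \<in> S \<and> x \<noteq> y \<and> h x = h y}"
  have p0: "p > 0" using p Q by linarith
  have "{(x, y). x \<in> S \<and> y \<in> S \<and> h x = h y} = (\<lambda>x. (x, x)) ` S \<union> ?C" by auto
  then have "card {(x, y). x \<in> S \<and> y \<in> S \<and> h x = h y} \<le> card S + card ?C"
    by (metis (no_types, lifting) S(1) card_Un_le card_image_le add_le_mono1 le_trans)
  then have "real (card {(x, y). x \<in> S \<and> y \<in> S \<and> h x = h y}) \<le> ?n + card ?C" by (simp flip: of_nat_add)
  then have "card (h ` S) * real (card {(x, y). x \<in> S \<and> y \<in> S \<and> h x = h y}) \<le> card (h ` S) * (?n + card ?C)"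
    by (rule mult_left_mono) simp
  then have "?n\<^sup>2 \<le> card (h ` S) * (?n + card ?C)"
    using card_squared_le_image_times_collisions[OF S(1), of h] by (simp only: of_nat_mult)
  then have "?n\<^sup>2 * (100 * real Q) \<le> (card (h ` S) * (?n + card ?C)) * (100 * real Q)"
    by (rule mult_right_mono) simp
  also have "\<dots> = card (h ` S) * (?n * (100 * real Q) + real (card ?C) * (100 * real Q))"
    by (simp add: algebra_simps)
  also have "\<dots> \<le> card (h ` S) * (?n\<^sup>2 + ?n\<^sup>2)"
  proof (intro mult_left_mono add_mono)
    show "?n * (100 * real Q) \<le> ?n\<^sup>2" using S(2) by (simp add: power2_eq_square mult_left_mono)
    have "card ?C * (51200 * real Q) \<le> card ?C * p" using p by (intro mult_left_mono) auto
    then have "card ?C * (51200 * real Q) \<le> 512 * ?n\<^sup>2" using coll by linarith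
    then show "real (card ?C) * (100 * real Q) \<le> ?n\<^sup>2" by (simp add: mult_ac)
  qed simp
  finally have "?n\<^sup>2 * (50 * real Q) \<le> ?n\<^sup>2 * card (h ` S)" by (simp add: algebra_simps)
  moreover have "?n\<^sup>2 > 0" using S(2) Q by (simp add: zero_less_power)
  ultimately have "(50 * real Q) \<le> card (h ` S)" by (simp only: mult_le_cancel_left_pos)
  then show ?thesis by linarith
qed

text \<open>Averaging over the parameters.\<close>

lemma ex_parameter_with_few_bad:
  fixes E :: "'e set" and W :: "'w set" and c :: real
  assumes "finite E" "finite W" "W \<noteq> {}" and "\<And>e. e \<in> E \<Longrightarrow> real (card {\<tau> \<in> W. B e \<tau>}) \<le> c * card W"
  shows "\<exists>\<tau>\<in>W. real (card {e \<in> E. B e \<tau>}) \<le> c * card E"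
proof (rule ccontr)
  assume *: "\<not> ?thesis"
  have "(\<Sum>\<tau>\<in>W. c * card E) < (\<Sum>\<tau>\<in>W. real (card {e \<in> E. B e \<tau>}))"
    using assms(2,3) * by (intro sum_strict_mono) (auto simp: not_le)
  also have "\<dots> = real (card {(e, \<tau>). e \<in> E \<and> \<tau> \<in> W \<and> B e \<tau>})"
    using assms(1,2) by (simp add: card_filter_pairs_snd)
  also have "\<dots> = (\<Sum>e\<in>E. real (card {\<tau> \<in> W. B e \<tau>}))"
    using assms(1,2) by (simp add: card_filter_pairs_fst)
  also have "\<dots> \<le> (\<Sum>e\<in>E. c * card W)" by (intro sum_mono assms)
  finally show False by (simp add: mult_ac)
qed

section \<open>Points and planes as light rays\<close>

type_synonym vec3 = "int \<times> int \<times> int"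

fun dot3 :: "vec3 \<Rightarrow> vec3 \<Rightarrow> int" where
  "dot3 (x1, x2, x3) (y1, y2, y3) = x1 * y1 + x2 * y2 + x3 * y3"

text \<open>The parametrised curve \<open>m\<close> of pure quaternions which defines the alternating forms \<open>X \<cdot> (m Y)\<close> below. What
  matters is that a plane through the origin contains at most two of its vectors.\<close>

definition conic_vec :: "int \<Rightarrow> vec3" where
  "conic_vec \<tau> = (1, \<tau>, \<tau>\<^sup>2)"

definition conic_norm :: "int \<Rightarrow> int" where
  "conic_norm \<tau> = 1 + \<tau>\<^sup>2 + \<tau> ^ 4"

text \<open>For rays with different slopes this vanishes if and only if they meet. In the coordinates \<open>a\<close>, \<open>b\<close> and \<open>c = e - a b\<close> it is
  \<open>c - c' + a b' - a' b\<close>, an alternating form of the vectors \<open>(1, a, b, c)\<close> and \<open>(1, a', b', c')\<close>: light rays are points of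
  projective space, and meeting is orthogonality for a symplectic form.\<close>

fun twist :: "ray \<Rightarrow> ray \<Rightarrow> int" where
  "twist (a, b, e) (a', b', e') = (e - e') - (a + a') * (b - b')"

text \<open>The value of the alternating form \<open>X \<cdot> (m Y)\<close> for the quaternions \<open>X = (1, x)\<close> and \<open>Y = (1, y)\<close>, which is the inner
  product of \<open>m\<close> with the vector \<open>x - y - x \<times> y\<close>.\<close>

fun symp :: "int \<Rightarrow> vec3 \<Rightarrow> vec3 \<Rightarrow> int" where
  "symp \<tau> (x1, x2, x3) (y1, y2, y3) =
     (x1 - y1 - (x2 * y3 - x3 * y2)) + \<tau> * (x2 - y2 - (x3 * y1 - x1 * y3)) + \<tau>\<^sup>2 * (x3 - y3 - (x1 * y2 - x2 * y1))"

text \<open>Coordinates in which the alternating form of the parameter \<open>\<tau>\<close> becomes \<open>twist\<close>. The shear \<open>a \<mapsto> a + \<tau>^4 b\<close> leaves the form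
  unchanged. It ensures that the ray of a point and the ray of an incident plane are parallel for at most eight values of \<open>\<tau>\<close>.\<close>

fun point_ray :: "int \<Rightarrow> vec3 \<Rightarrow> ray" where
  "point_ray \<tau> (x1, x2, x3) = (let b = x3 - \<tau>\<^sup>2 * x1; a = x2 - \<tau> * x1 + \<tau> ^ 4 * b
     in (a, b, a * b - dot3 (conic_vec \<tau>) (x1, x2, x3)))"

definition minv :: "int \<Rightarrow> int \<Rightarrow> int" where
  "minv p a = (SOME b. p dvd a * b - 1)"

text \<open>Numerators of the coordinates of the quaternion \<open>m Y\<close> for \<open>Y = (1, y)\<close>; the common denominator is its real part \<open>m \<cdot> y\<close>, up
  to sign.\<close>

fun plane_num :: "int \<Rightarrow> vec3 \<Rightarrow> int \<times> int" where
  "plane_num \<tau> (y1, y2, y3) = (let b = - (y2 - \<tau> * y1 - \<tau> ^ 3 * y3 + \<tau> ^ 4 * y2)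
     in (y3 - \<tau>\<^sup>2 * y1 + \<tau>\<^sup>2 * y3 - \<tau> ^ 3 * y2 + \<tau> ^ 4 * b, b))"

text \<open>The plane \<open>1 + x \<cdot> y = 0\<close> consists of the points \<open>X\<close> orthogonal to \<open>Y = (1, y)\<close>, hence of the points that are
  orthogonal to \<open>m Y\<close> for the alternating form \<open>X \<cdot> (m Y)\<close>, as \<open>m m Y\<close> is a multiple of \<open>Y\<close>. The plane is represented by the ray
  of the point \<open>m Y\<close>.\<close>

definition plane_ray :: "int \<Rightarrow> int \<Rightarrow> vec3 \<Rightarrow> ray" where
  "plane_ray p \<tau> y = (let i = minv p (dot3 (conic_vec \<tau>) y); a = fst (plane_num \<tau> y) * i; b = snd (plane_num \<tau> y) * i
     in (a, b, a * b + conic_norm \<tau> * i))"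

lemma minv:
  assumes "prime p" "\<not> p dvd a"
  shows "p dvd a * minv p a - 1"
proof -
  obtain b where "p dvd a * b - 1" using prime_obtain_inverse[OF assms] by blast
  then show ?thesis unfolding minv_def by (rule someI)
qed

lemma minv_not_dvd:
  assumes "prime p" "\<not> p dvd a"
  shows "\<not> p dvd minv p a"
proof
  assume "p dvd minv p a"
  then have "p dvd a * minv p a" by (rule dvd_mult)
  then have "p dvd a * minv p a - (a * minv p a - 1)" using minv[OF assms] by (rule dvd_diff)
  then have "p dvd 1" by simp
  then show False using assms(1) not_prime_unit by blast
qed

lemma twist_if_meet:
  assumes "[b + a * \<theta> = b' + a' * \<theta>] (mod p)" "[e + a\<^sup>2 * \<theta> = e' + a'\<^sup>2 * \<theta>] (mod p)"
  shows "p dvd twist (a, b, e) (a', b', e')"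
proof -
  have "twist (a, b, e) (a', b', e') = ((e + a\<^sup>2 * \<theta>) - (e' + a'\<^sup>2 * \<theta>)) - (a + a') * ((b + a * \<theta>) - (b' + a' * \<theta>))"
    by (simp add: algebra_simps power2_eq_square)
  also have "p dvd \<dots>" using assms unfolding cong_iff_dvd_diff by (intro dvd_diff[of p _ "(a + a') * _"] dvd_mult)
  finally show ?thesis .
qed

text \<open>Rays of one kind through a common point of a third ray meet each other. So concurrence is controlled by \<open>symp\<close>, a
  condition on two rays instead of three.\<close>

lemma twist_if_common_cross:
  assumes "cross p q q1 \<theta>" "cross p q q2 \<theta>"
  shows "p dvd twist q1 q2"
proof -
  obtain a b e a1 b1 e1 a2 b2 e2 where q: "q = (a, b, e)" "q1 = (a1, b1, e1)" "q2 = (a2, b2, e2)"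
    by (metis prod_cases3)
  have "[b1 + a1 * \<theta> = b2 + a2 * \<theta>] (mod p)" "[e1 + a1\<^sup>2 * \<theta> = e2 + a2\<^sup>2 * \<theta>] (mod p)"
    using assms unfolding cross_def q by (auto intro: cong_trans cong_sym)
  then show ?thesis unfolding q by (rule twist_if_meet)
qed

lemma ex_cross_if_twist:
  assumes p: "prime p" and tw: "p dvd twist q q'" and ne: "\<not> p dvd fst q' - fst q"
  shows "\<exists>\<theta>\<in>{0..<p}. cross p q q' \<theta>"
proof -
  obtain a b e a' b' e' where q: "q = (a, b, e)" "q' = (a', b', e')" by (metis prod_cases3)
  obtain i where i: "p dvd (a' - a) * i - 1" using prime_obtain_inverse[OF p] ne q by auto
  define \<theta> where "\<theta> = ((b - b') * i) mod p"
  have \<theta>: "\<theta> \<in> {0..<p}" using prime_gt_0_int[OF p] by (simp add: \<theta>_def)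
  have m: "p dvd (b - b') * i - \<theta>" unfolding \<theta>_def by (simp add: mod_eq_dvd_iff[symmetric])
  have eb: "(b + a * \<theta>) - (b' + a' * \<theta>) = (a' - a) * ((b - b') * i - \<theta>) - (b - b') * ((a' - a) * i - 1)"
    by (simp add: algebra_simps)
  have b: "p dvd (b + a * \<theta>) - (b' + a' * \<theta>)" unfolding eb using i m by simp
  have "(e + a\<^sup>2 * \<theta>) - (e' + a'\<^sup>2 * \<theta>) = twist q q' + (a + a') * ((b + a * \<theta>) - (b' + a' * \<theta>))"
    by (simp add: q algebra_simps power2_eq_square)
  then have "p dvd (e + a\<^sup>2 * \<theta>) - (e' + a'\<^sup>2 * \<theta>)" using tw b by simp
  then have "cross p q q' \<theta>" using b ne by (simp add: cross_def q cong_iff_dvd_diff)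
  then show ?thesis using \<theta> by blast
qed

lemma twist_point_point: "twist (point_ray \<tau> x) (point_ray \<tau> y) = - symp \<tau> x y"
proof -
  have "twist (point_ray \<tau> x) (point_ray \<tau> y) + symp \<tau> x y = 0"
    by (cases x; cases y) (simp add: Let_def conic_vec_def algebra_simps power2_eq_square power4_eq_xxxx)
  then show ?thesis by linarith
qed

lemma twist_point_plane:
  assumes "prime p" "\<not> p dvd dot3 (conic_vec \<tau>) y"
  shows "p dvd twist (point_ray \<tau> x) (plane_ray p \<tau> y) \<longleftrightarrow> p dvd conic_norm \<tau> * (1 + dot3 x y)"
proof -
  define i where "i = minv p (dot3 (conic_vec \<tau>) y)"
  have i: "p dvd dot3 (conic_vec \<tau>) y * i - 1" "\<not> p dvd i"
    using minv[OF assms] minv_not_dvd[OF assms] by (simp_all add: i_def)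
  have "twist (point_ray \<tau> x) (plane_ray p \<tau> y) = dot3 (conic_vec \<tau>) x * (dot3 (conic_vec \<tau>) y * i - 1) - i * (conic_norm \<tau> * (1 + dot3 x y))"
    unfolding plane_ray_def i_def[symmetric]
    by (cases x; cases y) (simp add: Let_def conic_vec_def conic_norm_def algebra_simps power2_eq_square power3_eq_cube power4_eq_xxxx)
  then have "p dvd twist (point_ray \<tau> x) (plane_ray p \<tau> y) \<longleftrightarrow> p dvd i * (conic_norm \<tau> * (1 + dot3 x y))"
    using i(1) by (metis dvd_mult dvd_diff_right_iff)
  then show ?thesis using i(2) assms(1) by (simp add: prime_dvd_mult_iff)
qed

text \<open>Left multiplication by \<open>m\<close> preserves the alternating form up to the factor \<open>conic_norm \<tau>\<close>.\<close>

lemma twist_plane_plane: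
  assumes p: "prime p" and x: "\<not> p dvd dot3 (conic_vec \<tau>) x" and y: "\<not> p dvd dot3 (conic_vec \<tau>) y"
    and N: "\<not> p dvd conic_norm \<tau>" and tw: "p dvd twist (plane_ray p \<tau> x) (plane_ray p \<tau> y)"
  shows "p dvd symp \<tau> x y"
proof -
  define i where "i = minv p (dot3 (conic_vec \<tau>) x)"
  define j where "j = minv p (dot3 (conic_vec \<tau>) y)"
  have i: "p dvd dot3 (conic_vec \<tau>) x * i - 1" "\<not> p dvd i"
    using minv[OF p x] minv_not_dvd[OF p x] by (simp_all add: i_def)
  have j: "p dvd dot3 (conic_vec \<tau>) y * j - 1" "\<not> p dvd j"
    using minv[OF p y] minv_not_dvd[OF p y] by (simp_all add: j_def)
  have "twist (plane_ray p \<tau> x) (plane_ray p \<tau> y) = conic_norm \<tau> * j * (dot3 (conic_vec \<tau>) x * i - 1)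
      - conic_norm \<tau> * i * (dot3 (conic_vec \<tau>) y * j - 1) - (i * j * conic_norm \<tau>) * symp \<tau> x y"
    unfolding plane_ray_def i_def[symmetric] j_def[symmetric]
    by (cases x; cases y) (simp add: Let_def conic_vec_def conic_norm_def algebra_simps power2_eq_square power3_eq_cube power4_eq_xxxx)
  then have "(i * j * conic_norm \<tau>) * symp \<tau> x y = conic_norm \<tau> * j * (dot3 (conic_vec \<tau>) x * i - 1)
      - conic_norm \<tau> * i * (dot3 (conic_vec \<tau>) y * j - 1) - twist (plane_ray p \<tau> x) (plane_ray p \<tau> y)" by simp
  then have "p dvd (i * j * conic_norm \<tau>) * symp \<tau> x y" using i(1) j(1) tw by (metis dvd_mult dvd_diff)
  then show ?thesis using i(2) j(2) N p by (simp add: prime_dvd_mult_iff)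
qed

lemma card_roots_coeffs_le:
  fixes p :: int
  assumes "prime p" "\<not> (\<forall>c\<in>set cs. p dvd c)" "length cs \<le> Suc D"
  shows "card {\<tau> \<in> {0..<p}. p dvd poly (Poly cs) \<tau>} \<le> D"
proof (rule card_roots_mod_prime_le[OF assms(1)])
  show "\<not> [:p:] dvd Poly cs"
  proof
    assume "[:p:] dvd Poly cs"
    then have "p dvd cs ! i" if "i < length cs" for i
      using that by (simp add: const_poly_dvd_iff nth_default_def) (metis nth_default_nth)
    then show False using assms(2) by (metis in_set_conv_nth)
  qed
  show "degree (Poly cs) \<le> D" 
    using assms(3) by (intro degree_le) (auto simp: nth_default_beyond)
qed auto

text \<open>The condition is quadratic in \<open>\<tau>\<close>, with the components of \<open>x - y - x \<times> y\<close> as coefficients. If they all vanish,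
  then \<open>w = x - y\<close> satisfies \<open>w = w \<times> y\<close>, hence \<open>w = (w \<times> y) \<times> y = - w |y|^2\<close>, which is excluded by \<open>1 + |y|^2 \<noteq> 0\<close>.\<close>

lemma card_symp_zero_le:
  assumes p: "prime p" and x: "x \<in> {0..<p} \<times> {0..<p} \<times> {0..<p}" and y: "y \<in> {0..<p} \<times> {0..<p} \<times> {0..<p}"
    and "x \<noteq> y" and iso: "\<not> p dvd 1 + dot3 y y"
  shows "card {\<tau> \<in> {0..<p}. p dvd symp \<tau> x y} \<le> 2"
proof -
  obtain x1 x2 x3 y1 y2 y3 where xy: "x = (x1, x2, x3)" "y = (y1, y2, y3)" by (metis prod_cases3)
  define c1 c2 c3 where "c1 = x1 - y1 - (x2 * y3 - x3 * y2)" and "c2 = x2 - y2 - (x3 * y1 - x1 * y3)"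
    and "c3 = x3 - y3 - (x1 * y2 - x2 * y1)"
  define n where "n = 1 + dot3 y y"
  have eqs: "n * (x1 - y1) = c1 + (c2 * y3 - c3 * y2) + y1 * (c1 * y1 + c2 * y2 + c3 * y3)"
     "n * (x2 - y2) = c2 + (c3 * y1 - c1 * y3) + y2 * (c1 * y1 + c2 * y2 + c3 * y3)"
     "n * (x3 - y3) = c3 + (c1 * y2 - c2 * y1) + y3 * (c1 * y1 + c2 * y2 + c3 * y3)"
    by (simp_all add: n_def c1_def c2_def c3_def xy algebra_simps)
  have "\<not> (p dvd c1 \<and> p dvd c2 \<and> p dvd c3)"
  proof
    assume "p dvd c1 \<and> p dvd c2 \<and> p dvd c3"
    then have "p dvd n * (x1 - y1)" "p dvd n * (x2 - y2)" "p dvd n * (x3 - y3)"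
      unfolding eqs by simp_all
    then have "p dvd x1 - y1" "p dvd x2 - y2" "p dvd x3 - y3"
      using iso p by (simp_all add: n_def prime_dvd_mult_iff)
    then have "x1 = y1" "x2 = y2" "x3 = y3"
      using x y not_dvd_diff_residues[of _ p] by (fastforce simp: xy)+
    then show False using \<open>x \<noteq> y\<close> xy by simp
  qed
  then have "card {\<tau> \<in> {0..<p}. p dvd poly (Poly [c1, c2, c3]) \<tau>} \<le> 2"
    by (intro card_roots_coeffs_le[OF p]) auto
  moreover have "poly (Poly [c1, c2, c3]) \<tau> = symp \<tau> x y" for \<tau>
    by (simp add: xy c1_def c2_def c3_def algebra_simps power2_eq_square)
  ultimately show ?thesis by simp
qed

lemma card_conic_norm_zero_le:
  assumes "prime p"
  shows "card {\<tau> \<in> {0..<p}. p dvd conic_norm \<tau>} \<le> 4"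
proof -
  have "card {\<tau> \<in> {0..<p}. p dvd poly (Poly [1, 0, 1, 0, 1]) \<tau>} \<le> 4"
    using assms not_prime_unit[of p] by (intro card_roots_coeffs_le[OF assms]) auto
  moreover have "poly (Poly [1, 0, 1, 0, 1]) \<tau> = conic_norm \<tau>" for \<tau>
    by (simp add: conic_norm_def algebra_simps power2_eq_square power4_eq_xxxx)
  ultimately show ?thesis by simp
qed

lemma card_conic_dot_zero_le:
  assumes p: "prime p" and inc: "p dvd 1 + dot3 x y"
  shows "card {\<tau> \<in> {0..<p}. p dvd dot3 (conic_vec \<tau>) y} \<le> 2"
proof -
  obtain x1 x2 x3 y1 y2 y3 where xy: "x = (x1, x2, x3)" "y = (y1, y2, y3)" by (metis prod_cases3)
  have "\<not> (p dvd y1 \<and> p dvd y2 \<and> p dvd y3)"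
  proof
    assume *: "p dvd y1 \<and> p dvd y2 \<and> p dvd y3"
    then have "p dvd dot3 x y" by (simp add: xy)
    then have "p dvd 1" using inc by (metis dvd_add_left_iff)
    then show False using p not_prime_unit[of p] by simp
  qed
  then have "card {\<tau> \<in> {0..<p}. p dvd poly (Poly [y1, y2, y3]) \<tau>} \<le> 2"
    by (intro card_roots_coeffs_le[OF p]) auto
  moreover have "poly (Poly [y1, y2, y3]) \<tau> = dot3 (conic_vec \<tau>) y" for \<tau>
    by (simp add: xy conic_vec_def algebra_simps power2_eq_square)
  ultimately show ?thesis by simp
qed

text \<open>The slopes agree if a polynomial of degree eight in \<open>\<tau>\<close> vanishes; \<open>cs\<close> lists its coefficients. If all of them were zero,
  a combination of four of them with the incidence relation would give \<open>2 = 0\<close>.\<close>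

lemma card_parallel_le:
  assumes p: "prime p" "p > 2" and inc: "p dvd 1 + dot3 x y"
  shows "card {\<tau> \<in> {0..<p}. \<not> p dvd dot3 (conic_vec \<tau>) y \<and> p dvd fst (plane_ray p \<tau> y) - fst (point_ray \<tau> x)} \<le> 8"
proof -
  obtain x1 x2 x3 y1 y2 y3 where xy: "x = (x1, x2, x3)" "y = (y1, y2, y3)" by (metis prod_cases3)
  define cs where "cs = [x2 * y1 - y3, x2 * y2 - x1 * y1, x2 * y3 - x1 * y2 + y1 - y3, y2 - x1 * y3,
     x3 * y1 + y2, x3 * y2 - y1, x3 * y3 - x1 * y1, - x1 * y2 - y3, y2 - x1 * y3]"
  have "\<not> (\<forall>c\<in>set cs. p dvd c)"
  proof
    assume "\<forall>c\<in>set cs. p dvd c"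
    then have d: "p dvd x2 * y1 - y3" "p dvd x2 * y2 - x1 * y1" "p dvd x3 * y1 + y2" "p dvd x3 * y3 - x1 * y1"
      by (simp_all add: cs_def)
    have "2 = 2 * (1 + dot3 x y) + ((x2 * y2 - x1 * y1) + (x3 * y3 - x1 * y1))
        - 3 * (x2 * (x3 * y1 + y2) - x3 * (x2 * y1 - y3))"
      by (simp add: xy algebra_simps)
    then have "p dvd 2" using d inc by (metis dvd_add dvd_diff dvd_mult)
    then show False using \<open>p > 2\<close> zdvd_imp_le by fastforce
  qed
  then have 8: "card {\<tau> \<in> {0..<p}. p dvd poly (Poly cs) \<tau>} \<le> 8"
    by (intro card_roots_coeffs_le[OF p(1)]) (simp_all add: cs_def)
  have "p dvd poly (Poly cs) \<tau>" if \<tau>: "\<not> p dvd dot3 (conic_vec \<tau>) y" "p dvd fst (plane_ray p \<tau> y) - fst (point_ray \<tau> x)" for \<tau>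
  proof -
    define i where "i = minv p (dot3 (conic_vec \<tau>) y)"
    have i: "p dvd dot3 (conic_vec \<tau>) y * i - 1" using minv[OF p(1) \<tau>(1)] by (simp add: i_def)
    have "poly (Poly cs) \<tau> = fst (point_ray \<tau> x) * dot3 (conic_vec \<tau>) y - fst (plane_num \<tau> y)"
      by (simp add: xy cs_def conic_vec_def Let_def algebra_simps power2_eq_square power3_eq_cube power4_eq_xxxx)
    also have "\<dots> = fst (plane_num \<tau> y) * (dot3 (conic_vec \<tau>) y * i - 1) - dot3 (conic_vec \<tau>) y * (fst (plane_ray p \<tau> y) - fst (point_ray \<tau> x))"
      unfolding plane_ray_def i_def[symmetric] Let_def fst_conv by (simp add: algebra_simps)
    finally show ?thesis using i \<tau>(2) by simp
  qed
  then have "{\<tau> \<in> {0..<p}. \<not> p dvd dot3 (conic_vec \<tau>) y \<and> p dvd fst (plane_ray p \<tau> y) - fst (point_ray \<tau> x)}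
     \<subseteq> {\<tau> \<in> {0..<p}. p dvd poly (Poly cs) \<tau>}" by blast
  then have "card {\<tau> \<in> {0..<p}. \<not> p dvd dot3 (conic_vec \<tau>) y \<and> p dvd fst (plane_ray p \<tau> y) - fst (point_ray \<tau> x)}
     \<le> card {\<tau> \<in> {0..<p}. p dvd poly (Poly cs) \<tau>}"
    by (intro card_mono) (auto intro: finite_subset[of _ "{0..<p}"])
  with 8 show ?thesis by linarith
qed

section \<open>Point--plane incidences over a prime field\<close>

fun inner4 :: "int vec4 \<Rightarrow> int vec4 \<Rightarrow> int" where
  "inner4 (x1, x2, x3, x4) (y1, y2, y3, y4) = x1 * y1 + x2 * y2 + x3 * y3 + x4 * y4"

fun scl :: "int \<Rightarrow> int vec4 \<Rightarrow> int vec4" where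
  "scl c (x1, x2, x3, x4) = (c * x1, c * x2, c * x3, c * x4)"

fun zero_mod :: "int \<Rightarrow> int vec4 \<Rightarrow> bool" where
  "zero_mod p (x1, x2, x3, x4) \<longleftrightarrow> p dvd x1 \<and> p dvd x2 \<and> p dvd x3 \<and> p dvd x4"

text \<open>Linear independence over the field with \<open>p\<close> elements.\<close>

definition indep :: "int \<Rightarrow> int vec4 \<Rightarrow> int vec4 \<Rightarrow> bool" where
  "indep p U V \<longleftrightarrow> (\<forall>\<alpha> \<beta>. zero_mod p (scl \<alpha> U + scl \<beta> V) \<longrightarrow> p dvd \<alpha> \<and> p dvd \<beta>)"

text \<open>A linear relation between the parameters of the rays of planes is a linear equation for the planes. It is independent of
  the equation expressing incidence with the point \<open>x\<close>.\<close>

lemma planes_of_collinear_rays: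
  assumes p: "prime p" and N: "\<not> p dvd conic_norm \<tau>" and q: "point_ray \<tau> x = (a, b, e)"
  shows "\<exists>V. indep p (1, x) V \<and> (\<forall>y a' b' e'. \<not> p dvd dot3 (conic_vec \<tau>) y \<longrightarrow> plane_ray p \<tau> y = (a', b', e') \<longrightarrow>
     p dvd 1 + \<kappa> * (a' - a) + \<mu> * (b - b') \<longrightarrow> p dvd inner4 V (1, y))"
proof -
  define l where "l = 1 - \<kappa> * a + \<mu> * b"
  define r where "r = \<kappa> * \<tau> ^ 4 - \<mu>"
  define V1 V2 V3 where "V1 = l - \<kappa> * \<tau>\<^sup>2 + r * \<tau>" and "V2 = l * \<tau> - \<kappa> * \<tau> ^ 3 - r * (1 + \<tau> ^ 4)"
    and "V3 = l * \<tau>\<^sup>2 + \<kappa> * (1 + \<tau>\<^sup>2) + r * \<tau> ^ 3"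
  obtain x1 x2 x3 where x: "x = (x1, x2, x3)" by (metis prod_cases3)
  have "indep p (1, x) (0, V1, V2, V3)"
    unfolding indep_def
  proof (intro allI impI)
    fix \<alpha> \<beta> assume z: "zero_mod p (scl \<alpha> (1, x) + scl \<beta> (0, V1, V2, V3))"
    then have \<alpha>: "p dvd \<alpha>" by (simp add: x)
    then have V: "p dvd \<beta> * V1" "p dvd \<beta> * V2" "p dvd \<beta> * V3"
      using z by (auto simp: x dvd_add_right_iff)
    have "p dvd \<beta>"
    proof (rule ccontr)
      assume "\<not> p dvd \<beta>"
      then have V: "p dvd V1" "p dvd V2" "p dvd V3" using V p by (simp_all add: prime_dvd_mult_iff)
      have "l * conic_norm \<tau> = V1 + \<tau> * V2 + \<tau>\<^sup>2 * V3"
        "r * conic_norm \<tau> = \<tau> * V1 - V2" "\<kappa> * conic_norm \<tau> = V3 - \<tau>\<^sup>2 * V1"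
        by (simp_all add: V1_def V2_def V3_def conic_norm_def algebra_simps power2_eq_square power3_eq_cube power4_eq_xxxx)
      then have "p dvd l * conic_norm \<tau>" "p dvd r * conic_norm \<tau>" "p dvd \<kappa> * conic_norm \<tau>"
        using V by simp_all
      then have lrk: "p dvd l" "p dvd r" "p dvd \<kappa>" using N p by (simp_all add: prime_dvd_mult_iff)
      have "1 = l + \<kappa> * a - (\<kappa> * \<tau> ^ 4 - r) * b" by (simp add: l_def r_def)
      then have "p dvd 1" using lrk by (metis dvd_add dvd_diff dvd_mult2)
      then show False using p not_prime_unit by blast
    qed
    with \<alpha> show "p dvd \<alpha> \<and> p dvd \<beta>" by blast
  qed
  moreover have "p dvd inner4 (0, V1, V2, V3) (1, y)"
    if y: "\<not> p dvd dot3 (conic_vec \<tau>) y" and pl: "plane_ray p \<tau> y = (a', b', e')" and rel: "p dvd 1 + \<kappa> * (a' - a) + \<mu> * (b - b')" for y a' b' e'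
  proof -
    define i where "i = minv p (dot3 (conic_vec \<tau>) y)"
    have i: "p dvd dot3 (conic_vec \<tau>) y * i - 1" using minv[OF p y] by (simp add: i_def)
    have a': "a' = fst (plane_num \<tau> y) * i" and b': "b' = snd (plane_num \<tau> y) * i"
      using pl by (auto simp: plane_ray_def i_def Let_def)
    have "inner4 (0, V1, V2, V3) (1, y) = dot3 (conic_vec \<tau>) y * l + \<kappa> * fst (plane_num \<tau> y) - \<mu> * snd (plane_num \<tau> y)"
      by (cases y) (simp add: V1_def V2_def V3_def r_def conic_vec_def Let_def algebra_simps power2_eq_square power3_eq_cube power4_eq_xxxx)
    also have "\<dots> = dot3 (conic_vec \<tau>) y * (1 + \<kappa> * (a' - a) + \<mu> * (b - b'))
       - (\<kappa> * fst (plane_num \<tau> y) - \<mu> * snd (plane_num \<tau> y)) * (dot3 (conic_vec \<tau>) y * i - 1)"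
      by (simp add: a' b' l_def algebra_simps)
    finally show ?thesis using i rel by simp
  qed
  ultimately show ?thesis by blast
qed

text \<open>The dual statement, with points and planes exchanged.\<close>

lemma points_of_collinear_rays:
  assumes p: "prime p" and y: "\<not> p dvd dot3 (conic_vec \<tau>) y"
  shows "\<exists>V. indep p (1, y) V \<and> (\<forall>x a' b' e'. point_ray \<tau> x = (a', b', e') \<longrightarrow>
     p dvd 1 + \<kappa> * (a' - a) + \<mu> * (b - b') \<longrightarrow> p dvd inner4 V (1, x))"
proof -
  define l where "l = 1 - \<kappa> * a + \<mu> * b"
  define r where "r = \<kappa> * \<tau> ^ 4 - \<mu>"
  let ?V = "(l, - \<kappa> * \<tau> - r * \<tau>\<^sup>2, \<kappa>, r)"
  obtain y1 y2 y3 where y': "y = (y1, y2, y3)" by (metis prod_cases3)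
  have "indep p (1, y) ?V"
    unfolding indep_def
  proof (intro allI impI)
    fix \<alpha> \<beta> assume "zero_mod p (scl \<alpha> (1, y) + scl \<beta> ?V)"
    then have z: "p dvd \<alpha> + \<beta> * l" "p dvd \<alpha> * y1 + \<beta> * (- \<kappa> * \<tau> - r * \<tau>\<^sup>2)" "p dvd \<alpha> * y2 + \<beta> * \<kappa>" "p dvd \<alpha> * y3 + \<beta> * r"
      by (simp_all add: y')
    have "\<alpha> * dot3 (conic_vec \<tau>) y = (\<alpha> * y1 + \<beta> * (- \<kappa> * \<tau> - r * \<tau>\<^sup>2)) + \<tau> * (\<alpha> * y2 + \<beta> * \<kappa>) + \<tau>\<^sup>2 * (\<alpha> * y3 + \<beta> * r)"
      by (simp add: y' conic_vec_def algebra_simps)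
    then have "p dvd \<alpha> * dot3 (conic_vec \<tau>) y" using z by (metis dvd_add dvd_mult)
    then have \<alpha>: "p dvd \<alpha>" using y p by (simp add: prime_dvd_mult_iff)
    then have V: "p dvd \<beta> * l" "p dvd \<beta> * \<kappa>" "p dvd \<beta> * r"
      using z by (auto simp: dvd_add_right_iff)
    have "p dvd \<beta>"
    proof (rule ccontr)
      assume "\<not> p dvd \<beta>"
      then have lrk: "p dvd l" "p dvd r" "p dvd \<kappa>" using V p by (simp_all add: prime_dvd_mult_iff)
      have "1 = l + \<kappa> * a - (\<kappa> * \<tau> ^ 4 - r) * b" by (simp add: l_def r_def)
      then have "p dvd 1" using lrk by (metis dvd_add dvd_diff dvd_mult2)
      then show False using p not_prime_unit by blast
    qed
    with \<alpha> show "p dvd \<alpha> \<and> p dvd \<beta>" by blast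
  qed
  moreover have "p dvd inner4 ?V (1, x)"
    if "point_ray \<tau> x = (a', b', e')" "p dvd 1 + \<kappa> * (a' - a) + \<mu> * (b - b')" for x a' b' e'
  proof -
    have "inner4 ?V (1, x) = 1 + \<kappa> * (a' - a) + \<mu> * (b - b')"
    proof -
      obtain x1 x2 x3 where x: "x = (x1, x2, x3)" by (metis prod_cases3)
      have eqs: "b' = x3 - \<tau>\<^sup>2 * x1" "a' = x2 - \<tau> * x1 + \<tau> ^ 4 * (x3 - \<tau>\<^sup>2 * x1)"
        using that(1) by (auto simp: x Let_def)
      show ?thesis unfolding x eqs l_def r_def by (simp add: algebra_simps power2_eq_square)
    qed
    then show ?thesis using that(2) by simp
  qed
  ultimately show ?thesis by blast
qed

text \<open>Two rays of one kind meet for at most two parameters, so on average over \<open>\<tau>\<close> there are at most \<open>2 |S|^2 / p\<close> meeting pairs;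
  Markov's inequality.\<close>

lemma few_parameters_with_many_collisions:
  assumes p: "prime p" and S: "S \<subseteq> {0..<p} \<times> {0..<p} \<times> {0..<p}" and iso: "\<And>x. x \<in> S \<Longrightarrow> \<not> p dvd 1 + dot3 x x"
  defines "C \<equiv> \<lambda>\<tau>. {(x, y). x \<in> S \<and> y \<in> S \<and> x \<noteq> y \<and> p dvd symp \<tau> x y}"
  shows "real (card {\<tau> \<in> {0..<p}. 32 * (real (card S))\<^sup>2 < real (card (C \<tau>)) * p}) \<le> p / 16"
proof -
  have finS: "finite S" using S finite_subset by blast
  have p0: "p > 0" using p prime_gt_0_int by blast
  let ?B = "{\<tau> \<in> {0..<p}. 32 * (real (card S))\<^sup>2 < real (card (C \<tau>)) * p}"
  show ?thesis
  proof (cases "S = {}")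
    case True
    then show ?thesis using p0 by (simp add: C_def)
  next
    case False
    let ?D = "{t \<in> S \<times> S. fst t \<noteq> snd t}"
    have Dfin: "finite ?D" using finS by simp
    have CD: "C \<tau> = {t \<in> ?D. p dvd symp \<tau> (fst t) (snd t)}" for \<tau> by (auto simp: C_def)
    have "(\<Sum>\<tau>\<in>{0..<p}. card (C \<tau>)) = (\<Sum>t\<in>?D. card {\<tau> \<in> {0..<p}. p dvd symp \<tau> (fst t) (snd t)})"
      unfolding CD using Dfin by (intro sum_card_swap) auto
    also have "\<dots> \<le> (\<Sum>t\<in>?D. 2)"
      by (intro sum_mono card_symp_zero_le[OF p]) (use S iso in auto)
    also have "\<dots> \<le> 2 * (card S * card S)"
      using card_mono[of "S \<times> S" ?D] finS by (simp add: card_cartesian_product)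
    finally have tot: "(\<Sum>\<tau>\<in>{0..<p}. card (C \<tau>)) \<le> 2 * (card S * card S)" .
    have "real (card ?B) * (32 * (real (card S))\<^sup>2) = (\<Sum>\<tau>\<in>?B. 32 * (real (card S))\<^sup>2)" by simp
    also have "\<dots> \<le> (\<Sum>\<tau>\<in>?B. real (card (C \<tau>)) * p)" by (intro sum_mono) auto
    also have "\<dots> \<le> (\<Sum>\<tau>\<in>{0..<p}. real (card (C \<tau>)) * p)" using p0 by (intro sum_mono2) auto
    also have "\<dots> = real (\<Sum>\<tau>\<in>{0..<p}. card (C \<tau>)) * p" by (simp add: sum_distrib_right)
    also have "\<dots> \<le> real (2 * (card S * card S)) * p" using tot p0 by (intro mult_right_mono) (simp_all only: of_nat_le_iff of_int_0_le_iff)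
    finally have "(real (card S))\<^sup>2 * (real (card ?B) * 32) \<le> (real (card S))\<^sup>2 * (2 * p)"
      by (simp add: power2_eq_square algebra_simps)
    moreover have "(real (card S))\<^sup>2 > 0" using False finS by (simp add: card_gt_0_iff)
    ultimately have "real (card ?B) * 32 \<le> 2 * p" by (simp only: mult_le_cancel_left_pos)
    then show ?thesis by simp
  qed
qed


text \<open>Every line of the dual projective space contains at most \<open>Q\<close> of the vectors \<open>(1, x)\<close>. Suppose that there are more
  incidences. Prune to a graph with all degrees at least \<open>400 Q\<close>, choose \<open>\<tau>\<close> such that at most a quarter of its edges are
  bad, delete the bad edges and prune again, now relative to the old degrees. Every remaining ray meets the
  others in at least \<open>50 Q\<close> distinct points, and \<open>rays_crossing_often_are_collinear\<close> applies with \<open>s = 3 Q\<close>: there are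
  polynomials of degree \<open>9 Q\<close> vanishing on all \<open>2 Q^2\<close> rays. It gives \<open>41 Q\<close> collinear points.\<close>

theorem card_point_plane_incidences_le:
  fixes p :: int
  assumes p: "prime p" and P: "P \<subseteq> {0..<p} \<times> {0..<p} \<times> {0..<p}" and iso: "\<And>x. x \<in> P \<Longrightarrow> \<not> p dvd 1 + dot3 x x"
    and Q: "0 < Q" "card P \<le> Q\<^sup>2" "51200 * int Q \<le> p"
    and coll: "\<And>U V. indep p U V \<Longrightarrow> card {x \<in> P. p dvd inner4 U (1, x) \<and> p dvd inner4 V (1, x)} \<le> Q"
  shows "card {(x, y). x \<in> P \<and> y \<in> P \<and> p dvd 1 + dot3 x y} \<le> 800 * card P * Q"
proof (rule ccontr)
  assume neg: "\<not> ?thesis"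
  define R where "R x y \<longleftrightarrow> p dvd 1 + dot3 x y" for x y
  have finP: "finite P" using P finite_subset by blast
  have pQ: "51200 * real Q \<le> real_of_int p" using Q(3) by (metis of_int_le_iff of_int_mult of_int_numeral of_int_of_nat_eq)
  have p2: "p > 51199" using Q(1,3) by linarith
  have sum1: "(\<Sum>x\<in>P. 400 * real Q) + (\<Sum>y\<in>P. 400 * real Q) < real (card {(x, y). x \<in> P \<and> y \<in> P \<and> R x y})"
  proof -
    have "800 * card P * Q < card {(x, y). x \<in> P \<and> y \<in> P \<and> R x y}" using neg by (simp add: R_def)
    then have "real (800 * card P * Q) < real (card {(x, y). x \<in> P \<and> y \<in> P \<and> R x y})" by (simp only: of_nat_less_iff)
    then show ?thesis by (simp add: algebra_simps)
  qed
  have "\<And>x :: vec3. 0 \<le> 400 * real Q" by simp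
  from prune_bipartite_graph[OF this this finP finP sum1]
  obtain X1 Y1 where XY1: "X1 \<subseteq> P" "Y1 \<subseteq> P" "\<exists>x\<in>X1. \<exists>y\<in>Y1. R x y"
    and deg1: "\<And>x. x \<in> X1 \<Longrightarrow> 400 * real Q \<le> card {y \<in> Y1. R x y}" "\<And>y. y \<in> Y1 \<Longrightarrow> 400 * real Q \<le> card {x \<in> X1. R x y}"
    by blast
  have fin1: "finite X1" "finite Y1" using XY1 finP finite_subset by blast+
  define N where "N x = {y \<in> Y1. R x y}" for x
  define M where "M y = {x \<in> X1. R x y}" for y
  define C where "C S \<tau> = {(x, y). x \<in> S \<and> y \<in> S \<and> x \<noteq> y \<and> p dvd symp \<tau> x y}" for S \<tau>
  define many where "many S \<tau> \<longleftrightarrow> 32 * (real (card S))\<^sup>2 < real (card (C S \<tau>)) * p" for S \<tau>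
  define E where "E = {(x, y). x \<in> X1 \<and> y \<in> Y1 \<and> R x y}"
  have finE: "finite E" unfolding E_def by (rule finite_subset[of _ "X1 \<times> Y1"]) (use fin1 in auto)
  have E0: "card E > 0" 
  proof -
    have "E \<noteq> {}" using XY1(3) unfolding E_def by blast
    then show ?thesis using finE by (simp add: card_gt_0_iff)
  qed
  (* For a bad edge the representation by rays degenerates, or one of its ends has many pairs of concurrent neighbours. *)
  define B where "B t \<tau> \<longleftrightarrow> p dvd conic_norm \<tau> \<or> p dvd dot3 (conic_vec \<tau>) (snd t)
     \<or> (\<not> p dvd dot3 (conic_vec \<tau>) (snd t) \<and> p dvd fst (plane_ray p \<tau> (snd t)) - fst (point_ray \<tau> (fst t)))
     \<or> many (N (fst t)) \<tau> \<or> many (M (snd t)) \<tau>" for t \<tau>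
  have few: "real (card {\<tau> \<in> {0..<p}. many S \<tau>}) \<le> p / 16" if "S \<subseteq> P" for S
    unfolding many_def C_def using that P iso by (intro few_parameters_with_many_collisions[OF p]) auto
  have bad: "real (card {\<tau> \<in> {0..<p}. B t \<tau>}) \<le> 1 / 4 * card {0..<p}" if t: "t \<in> E" for t
  proof -
    obtain x y where xy: "t = (x, y)" "x \<in> X1" "y \<in> Y1" "R x y" using t by (auto simp: E_def)
    have inc: "p dvd 1 + dot3 x y" using xy by (simp add: R_def)
    let ?A1 = "{\<tau> \<in> {0..<p}. p dvd conic_norm \<tau>}" and ?A2 = "{\<tau> \<in> {0..<p}. p dvd dot3 (conic_vec \<tau>) y}"
      and ?A3 = "{\<tau> \<in> {0..<p}. \<not> p dvd dot3 (conic_vec \<tau>) y \<and> p dvd fst (plane_ray p \<tau> y) - fst (point_ray \<tau> x)}"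
      and ?A4 = "{\<tau> \<in> {0..<p}. many (N x) \<tau>}" and ?A5 = "{\<tau> \<in> {0..<p}. many (M y) \<tau>}"
    have "{\<tau> \<in> {0..<p}. B t \<tau>} = ?A1 \<union> ?A2 \<union> ?A3 \<union> ?A4 \<union> ?A5" by (auto simp: B_def xy(1))
    then have "card {\<tau> \<in> {0..<p}. B t \<tau>} \<le> card ?A1 + card ?A2 + card ?A3 + card ?A4 + card ?A5"
      by (simp only: card_Un5_le)
    moreover have "card ?A1 \<le> 4" "card ?A2 \<le> 2" "card ?A3 \<le> 8"
      using card_conic_norm_zero_le[OF p] card_conic_dot_zero_le[OF p inc] card_parallel_le[OF p _ inc] p2 by auto
    moreover have "real (card ?A4) \<le> p / 16" "real (card ?A5) \<le> p / 16"
      using few[of "N x"] few[of "M y"] XY1 by (auto simp: N_def M_def)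
    ultimately have "real (card {\<tau> \<in> {0..<p}. B t \<tau>}) \<le> 14 + p / 16 + p / 16" by linarith
    then show ?thesis using p2 by simp
  qed
  have ne: "{0..<p} \<noteq> {}" using p2 by simp
  have "\<exists>\<tau>\<in>{0..<p}. real (card {t \<in> E. B t \<tau>}) \<le> 1 / 4 * card E"
    by (rule ex_parameter_with_few_bad[OF finE finite_atLeastLessThan_int ne]) (rule bad)
  then obtain \<tau> where \<tau>: "real (card {t \<in> E. B t \<tau>}) \<le> 1 / 4 * card E"
    by blast
  define R2 where "R2 x y \<longleftrightarrow> R x y \<and> \<not> B (x, y) \<tau>" for x y
  have "{t \<in> E. \<not> B t \<tau>} = {(x, y). x \<in> X1 \<and> y \<in> Y1 \<and> R2 x y}" by (auto simp: E_def R2_def)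
  moreover have "card E = card {t \<in> E. B t \<tau>} + card {t \<in> E. \<not> B t \<tau>}"
    using finE by (subst card_Un_disjoint[symmetric]) (auto intro: arg_cong[of _ _ card])
  ultimately have "3 / 4 * real (card E) \<le> card {(x, y). x \<in> X1 \<and> y \<in> Y1 \<and> R2 x y}" using \<tau> by simp
  moreover have "(\<Sum>x\<in>X1. real (card (N x)) / 4) = real (card E) / 4"
    using fin1 by (simp add: E_def N_def card_filter_pairs_fst flip: sum_divide_distrib)
  moreover have "(\<Sum>y\<in>Y1. real (card (M y)) / 4) = real (card E) / 4"
    using fin1 by (simp add: E_def M_def card_filter_pairs_snd flip: sum_divide_distrib)
  ultimately have sum2: "(\<Sum>x\<in>X1. real (card (N x)) / 4) + (\<Sum>y\<in>Y1. real (card (M y)) / 4) < card {(x, y). x \<in> X1 \<and> y \<in> Y1 \<and> R2 x y}"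
    using E0 by linarith
  have "\<And>x. 0 \<le> real (card (N x)) / 4" "\<And>y. 0 \<le> real (card (M y)) / 4" by simp_all
  from prune_bipartite_graph[OF this fin1 sum2]
  obtain X Y where XY: "X \<subseteq> X1" "Y \<subseteq> Y1" "\<exists>x\<in>X. \<exists>y\<in>Y. R2 x y"
    and deg2: "\<And>x. x \<in> X \<Longrightarrow> card (N x) / 4 \<le> card {y \<in> Y. R2 x y}" "\<And>y. y \<in> Y \<Longrightarrow> card (M y) / 4 \<le> card {x \<in> X. R2 x y}"
    by blast
  have fin: "finite X" "finite Y" using XY fin1 finite_subset by blast+
  have R2: "\<not> p dvd conic_norm \<tau>" "\<not> p dvd dot3 (conic_vec \<tau>) y" "\<not> many (N x) \<tau>" "\<not> many (M y) \<tau>" "p dvd 1 + dot3 x y"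
    "\<not> p dvd fst (plane_ray p \<tau> y) - fst (point_ray \<tau> x)" if "R2 x y" for x y
    using that by (auto simp: R2_def B_def R_def)
  define h where "h x y = (SOME \<theta>. \<theta> \<in> {0..<p} \<and> cross p (point_ray \<tau> x) (plane_ray p \<tau> y) \<theta>)" for x y
  have h: "h x y \<in> {0..<p} \<and> cross p (point_ray \<tau> x) (plane_ray p \<tau> y) (h x y)" if xy: "R2 x y" for x y
  proof -
    have "p dvd twist (point_ray \<tau> x) (plane_ray p \<tau> y)"
      using twist_point_plane[OF p R2(2)[OF xy]] R2(5)[OF xy] by simp
    then have "\<exists>\<theta>. \<theta> \<in> {0..<p} \<and> cross p (point_ray \<tau> x) (plane_ray p \<tau> y) \<theta>"
      using ex_cross_if_twist[OF p _ R2(6)[OF xy]] by blast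
    then show ?thesis unfolding h_def by (rule someI_ex)
  qed
  have N: "\<not> p dvd conic_norm \<tau>" using XY(3) R2(1) by blast
  define SX where "SX x = {y \<in> Y. R2 x y}" for x
  define SY where "SY y = {x \<in> X. R2 x y}" for y
  have finC: "finite (C S \<tau>)" if "S \<subseteq> P" for S
    unfolding C_def by (rule finite_subset[of _ "P \<times> P"]) (use that finP in auto)
  (* S' is the neighbourhood of a vertex before, S after the second pruning; g gives the crossing points. *)
  have big: "50 * Q \<le> card (g ` S)"
    if S: "S \<subseteq> S'" "S' \<subseteq> P" "400 * real Q \<le> card S'" "card S' / 4 \<le> card S" "\<not> many S' \<tau>"
      and g: "\<And>u v. u \<in> S \<Longrightarrow> v \<in> S \<Longrightarrow> g u = g v \<Longrightarrow> p dvd symp \<tau> u v" for g :: "vec3 \<Rightarrow> int" and S S'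
  proof (rule card_image_ge_if_few_collisions[OF _ _ Q(1) pQ])
    show "finite S" using finite_subset[OF subset_trans[OF S(1,2)] finP] .
    show "100 * real Q \<le> card S" using S by linarith
    have "card {(x, y). x \<in> S \<and> y \<in> S \<and> x \<noteq> y \<and> g x = g y} \<le> card (C S' \<tau>)"
      by (rule card_mono[OF finC[OF S(2)]]) (use S(1) g in \<open>auto simp: C_def\<close>)
    then have "real (card {(x, y). x \<in> S \<and> y \<in> S \<and> x \<noteq> y \<and> g x = g y}) * p \<le> real (card (C S' \<tau>)) * p"
      using p2 by (intro mult_right_mono) auto
    also have "\<dots> \<le> 32 * (real (card S'))\<^sup>2" using S(5) by (simp add: many_def)
    also have "\<dots> \<le> 32 * (4 * real (card S))\<^sup>2" using S(4) by (intro mult_left_mono power_mono) auto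
    also have "\<dots> = 512 * (real (card S))\<^sup>2" by (simp add: power2_eq_square)
    finally show "real (card {(x, y). x \<in> S \<and> y \<in> S \<and> x \<noteq> y \<and> g x = g y}) * p \<le> 512 * (real (card S))\<^sup>2" .
  qed
  have bigX: "50 * Q \<le> card (h x ` SX x)" if x: "x \<in> X" for x
  proof (rule big[of _ "N x"])
    show "SX x \<subseteq> N x" using XY by (auto simp: SX_def N_def R2_def)
    show "N x \<subseteq> P" using XY1 by (auto simp: N_def)
    show d: "400 * real Q \<le> card (N x)" using deg1(1)[of x] x XY by (auto simp: N_def)
    show d': "card (N x) / 4 \<le> card (SX x)" using deg2(1)[OF x] by (simp add: SX_def)
    have "card (SX x) > 0" using d d' Q(1) by linarith
    then obtain y where "y \<in> SX x" by (metis card_gt_0_iff ex_in_conv)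
    then show "\<not> many (N x) \<tau>" using R2(3)[of x y] by (simp add: SX_def)
    fix u v assume uv: "u \<in> SX x" "v \<in> SX x" "h x u = h x v"
    then have uv': "R2 x u" "R2 x v" by (auto simp: SX_def)
    then have "p dvd twist (plane_ray p \<tau> u) (plane_ray p \<tau> v)"
      using h[OF uv'(1)] h[OF uv'(2)] uv(3) by (metis twist_if_common_cross)
    then show "p dvd symp \<tau> u v" using twist_plane_plane[OF p R2(2)[OF uv'(1)] R2(2)[OF uv'(2)] N] by blast
  qed
  have bigY: "50 * Q \<le> card ((\<lambda>x. h x y) ` SY y)" if y: "y \<in> Y" for y
  proof (rule big[of _ "M y"])
    show "SY y \<subseteq> M y" using XY by (auto simp: SY_def M_def R2_def)
    show "M y \<subseteq> P" using XY1 by (auto simp: M_def)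
    show d: "400 * real Q \<le> card (M y)" using deg1(2)[of y] y XY by (auto simp: M_def)
    show d': "card (M y) / 4 \<le> card (SY y)" using deg2(2)[OF y] by (simp add: SY_def)
    have "card (SY y) > 0" using d d' Q(1) by linarith
    then obtain x where "x \<in> SY y" by (metis card_gt_0_iff ex_in_conv)
    then show "\<not> many (M y) \<tau>" using R2(4)[of x y] by (simp add: SY_def)
    fix u v assume uv: "u \<in> SY y" "v \<in> SY y" "h u y = h v y"
    then have uv': "R2 u y" "R2 v y" by (auto simp: SY_def)
    then have "p dvd twist (point_ray \<tau> u) (point_ray \<tau> v)"
      using h[OF uv'(1)] h[OF uv'(2)] uv(3) by (metis twist_if_common_cross cross_sym)
    then show "p dvd symp \<tau> u v" by (simp add: twist_point_point)
  qed
  define L where "L = point_ray \<tau> ` X \<union> plane_ray p \<tau> ` Y"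
  (* Only the crossings with rays of the other kind are used: the final count concerns points, or planes, alone. *)
  define good where "good q \<Theta> \<longleftrightarrow> \<Theta> \<subseteq> {0..<p} \<and> 50 * Q \<le> card \<Theta> \<and>
     ((\<exists>x\<in>X. q = point_ray \<tau> x \<and> \<Theta> = h x ` SX x) \<or> (\<exists>y\<in>Y. q = plane_ray p \<tau> y \<and> \<Theta> = (\<lambda>x. h x y) ` SY y))" for q \<Theta>
  have "\<exists>\<Theta>. good q \<Theta>" if q: "q \<in> L" for q
  proof -
    consider x where "x \<in> X" "q = point_ray \<tau> x" | y where "y \<in> Y" "q = plane_ray p \<tau> y" using q by (auto simp: L_def)
    then show ?thesis
    proof cases
      case 1
      have "h x ` SX x \<subseteq> {0..<p}" using h by (fastforce simp: SX_def)
      then have "good q (h x ` SX x)" using 1 bigX by (auto simp: good_def)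
      then show ?thesis by blast
    next
      case 2
      have "(\<lambda>x. h x y) ` SY y \<subseteq> {0..<p}" using h by (fastforce simp: SY_def)
      then have "good q ((\<lambda>x. h x y) ` SY y)" using 2 bigY by (auto simp: good_def)
      then show ?thesis by blast
    qed
  qed
  then obtain \<Theta> where \<Theta>: "\<And>q. q \<in> L \<Longrightarrow> good q (\<Theta> q)" by metis
  have finL: "finite L" "L \<noteq> {}" using fin XY(3) by (auto simp: L_def)
  have XYP: "X \<subseteq> P" "Y \<subseteq> P" using XY XY1 by blast+
  have "card L \<le> card X + card Y"
    unfolding L_def using fin by (meson card_Un_le card_image_le add_mono le_trans)
  also have "\<dots> \<le> 2 * Q\<^sup>2"
    using card_mono[OF finP XYP(1)] card_mono[OF finP XYP(2)] Q(2) by linarith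
  finally have "card L * (3 * (3 * Q) + 1) \<le> 2 * Q\<^sup>2 * (3 * (3 * Q) + 1)" by (rule mult_le_mono1)
  also have "\<dots> < (3 * Q + 1) ^ 3" by (simp add: power2_eq_square power3_eq_cube algebra_simps)
  finally have cardL: "card L * (3 * (3 * Q) + 1) < (3 * Q + 1) ^ 3" .
  have crossing: "\<exists>q'\<in>L. cross p q q' \<theta>" if q: "q \<in> L" and \<theta>: "\<theta> \<in> \<Theta> q" for q \<theta>
  proof -
    consider x y where "x \<in> X" "y \<in> Y" "R2 x y" "q = point_ray \<tau> x" "\<theta> = h x y"
      | x y where "x \<in> X" "y \<in> Y" "R2 x y" "q = plane_ray p \<tau> y" "\<theta> = h x y"
      using \<Theta>[OF q] \<theta> by (auto simp: good_def SX_def SY_def)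
    then show ?thesis
    proof cases
      case 1
      then show ?thesis using h[OF 1(3)] by (intro bexI[of _ "plane_ray p \<tau> y"]) (auto simp: L_def)
    next
      case 2
      then show ?thesis using h[OF 2(3)] cross_sym[of p "point_ray \<tau> x" "plane_ray p \<tau> y" "h x y"]
        by (intro bexI[of _ "point_ray \<tau> x"]) (auto simp: L_def)
    qed
  qed
  have big\<Theta>: "15 * (3 * Q) < card (\<Theta> q)" if "q \<in> L" for q
    using \<Theta>[OF that] Q(1) by (simp add: good_def)
  have sub\<Theta>: "\<Theta> q \<subseteq> {0..<p}" if "q \<in> L" for q using \<Theta>[OF that] by (simp add: good_def)
  have six: "6 * int (3 * Q) < p" using Q(1,3) by linarith
  have "\<exists>a b e \<kappa> \<mu> T. (a, b, e) \<in> L \<and> T \<subseteq> \<Theta> (a, b, e) \<and> card (\<Theta> (a, b, e)) \<le> card T + 3 * (3 * Q) \<and>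
    (\<forall>\<theta>\<in>T. \<forall>a' b' e'. (a', b', e') \<in> L \<longrightarrow> cross p (a, b, e) (a', b', e') \<theta> \<longrightarrow>
       p dvd 1 + \<kappa> * (a' - a) + \<mu> * (b - b'))"
    by (rule rays_crossing_often_are_collinear[OF p six finL cardL]) (rule sub\<Theta> big\<Theta> crossing; assumption)+
  then obtain a b e \<kappa> \<mu> T where q: "(a, b, e) \<in> L" and T: "T \<subseteq> \<Theta> (a, b, e)" "card (\<Theta> (a, b, e)) \<le> card T + 3 * (3 * Q)"
    and "\<forall>\<theta>\<in>T. \<forall>a' b' e'. (a', b', e') \<in> L \<longrightarrow> cross p (a, b, e) (a', b', e') \<theta> \<longrightarrow>
       p dvd 1 + \<kappa> * (a' - a) + \<mu> * (b - b')"
    by blast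
  then have rel: "p dvd 1 + \<kappa> * (a' - a) + \<mu> * (b - b')"
    if "\<theta> \<in> T" "(a', b', e') \<in> L" "cross p (a, b, e) (a', b', e') \<theta>" for \<theta> a' b' e'
    using that by blast
  have "Q < card T" using T(2) \<Theta>[OF q] Q(1) by (simp add: good_def)
  moreover have "card T \<le> Q"
  proof -
    consider x where "x \<in> X" "point_ray \<tau> x = (a, b, e)" "\<Theta> (a, b, e) = h x ` SX x"
      | y where "y \<in> Y" "plane_ray p \<tau> y = (a, b, e)" "\<Theta> (a, b, e) = (\<lambda>x. h x y) ` SY y"
      using \<Theta>[OF q] by (auto simp: good_def)
    then show ?thesis
    proof cases
      case 1
      obtain V where V: "indep p (1, x) V" "\<And>y a' b' e'. \<not> p dvd dot3 (conic_vec \<tau>) y \<Longrightarrow> plane_ray p \<tau> y = (a', b', e') \<Longrightarrow>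
         p dvd 1 + \<kappa> * (a' - a) + \<mu> * (b - b') \<Longrightarrow> p dvd inner4 V (1, y)"
        using planes_of_collinear_rays[OF p N 1(2), of \<kappa> \<mu>] by blast
      let ?Z = "{y \<in> P. p dvd inner4 (1, x) (1, y) \<and> p dvd inner4 V (1, y)}"
      have "T \<subseteq> h x ` ?Z"
      proof
        fix \<theta> assume \<theta>: "\<theta> \<in> T"
        then obtain y where y: "y \<in> Y" "R2 x y" "\<theta> = h x y" using T(1) 1(3) by (auto simp: SX_def)
        obtain a' b' e' where pl: "plane_ray p \<tau> y = (a', b', e')" by (metis prod_cases3)
        have "(a', b', e') \<in> L" using y(1) pl by (auto simp: L_def intro!: rev_image_eqI)
        moreover have "cross p (a, b, e) (a', b', e') \<theta>" using h[OF y(2)] y(3) 1(2) pl by simp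
        ultimately have "p dvd inner4 V (1, y)" using V(2) R2(2)[OF y(2)] pl rel[OF \<theta>] by blast
        moreover have "p dvd inner4 (1, x) (1, y)" using R2(5)[OF y(2)] by (cases x; cases y) (simp add: algebra_simps)
        ultimately show "\<theta> \<in> h x ` ?Z" using y XY XY1 by auto
      qed
      then have "card T \<le> card ?Z" using finP by (intro surj_card_le) auto
      also have "\<dots> \<le> Q" by (rule coll[OF V(1)])
      finally show ?thesis .
    next
      case 2
      have "\<Theta> (a, b, e) \<noteq> {}" using big\<Theta>[OF q] by auto
      then obtain x0 where "R2 x0 y" using 2(3) by (auto simp: SY_def)
      then obtain V where V: "indep p (1, y) V" "\<And>x a' b' e'. point_ray \<tau> x = (a', b', e') \<Longrightarrow>
         p dvd 1 + \<kappa> * (a' - a) + \<mu> * (b - b') \<Longrightarrow> p dvd inner4 V (1, x)"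
        using points_of_collinear_rays[OF p R2(2), of x0 y \<kappa> a \<mu> b] by blast
      let ?Z = "{x \<in> P. p dvd inner4 (1, y) (1, x) \<and> p dvd inner4 V (1, x)}"
      have "T \<subseteq> (\<lambda>x. h x y) ` ?Z"
      proof
        fix \<theta> assume \<theta>: "\<theta> \<in> T"
        then obtain x where x: "x \<in> X" "R2 x y" "\<theta> = h x y" using T(1) 2(3) by (auto simp: SY_def)
        obtain a' b' e' where pl: "point_ray \<tau> x = (a', b', e')" by (metis prod_cases3)
        have "(a', b', e') \<in> L" using x(1) pl by (auto simp: L_def intro!: rev_image_eqI)
        moreover have "cross p (a, b, e) (a', b', e') \<theta>" using h[OF x(2)] x(3) 2(2) pl cross_sym by metis
        ultimately have "p dvd inner4 V (1, x)" using V(2) pl rel[OF \<theta>] by blast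
        moreover have "p dvd inner4 (1, y) (1, x)" using R2(5)[OF x(2)] by (cases x; cases y) (simp add: algebra_simps)
        ultimately show "\<theta> \<in> (\<lambda>x. h x y) ` ?Z" using x XY XY1 by auto
      qed
      then have "card T \<le> card ?Z" using finP by (intro surj_card_le) auto
      also have "\<dots> \<le> Q" by (rule coll[OF V(1)])
      finally show ?thesis .
    qed
  qed
  ultimately show False by simp
qed

section \<open>Linear algebra in four dimensions modulo a prime\<close>

lemma inner4_add_left: "inner4 (x + y) z = inner4 x z + inner4 y z"
  and inner4_add_right: "inner4 z (x + y) = inner4 z x + inner4 z y"
  and inner4_diff_left: "inner4 (x - y) z = inner4 x z - inner4 y z"
  and inner4_diff_right: "inner4 z (x - y) = inner4 z x - inner4 z y"
  and inner4_scl_left: "inner4 (scl c x) z = c * inner4 x z"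
  and inner4_scl_right: "inner4 z (scl c x) = c * inner4 z x"
  and inner4_commute: "inner4 x z = inner4 z x"
  by (cases x; cases y; cases z; simp add: algebra_simps)+

lemmas inner4_simps = inner4_add_left inner4_add_right inner4_diff_left inner4_diff_right inner4_scl_left inner4_scl_right

lemma zero_mod_inner4: "zero_mod p x \<Longrightarrow> p dvd inner4 x y"
  by (cases x; cases y) auto

lemma zero_mod_add: "zero_mod p x \<Longrightarrow> zero_mod p y \<Longrightarrow> zero_mod p (x + y)"
  and zero_mod_diff: "zero_mod p x \<Longrightarrow> zero_mod p y \<Longrightarrow> zero_mod p (x - y)"
  and zero_mod_scl: "zero_mod p x \<Longrightarrow> zero_mod p (scl c x)"
  and zero_mod_scl_dvd: "p dvd c \<Longrightarrow> zero_mod p (scl c x)"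
  by (cases x; cases y; auto)+

lemma scl_cancel:
  assumes "prime p" "zero_mod p (scl c x)" "\<not> p dvd c"
  shows "zero_mod p x"
  using assms by (cases x) (auto simp: prime_dvd_mult_iff)

definition box4 :: "int \<Rightarrow> int vec4 set" where
  "box4 p = {0..<p} \<times> {0..<p} \<times> {0..<p} \<times> {0..<p}"

lemma box4_eqI: "x \<in> box4 p \<Longrightarrow> y \<in> box4 p \<Longrightarrow> zero_mod p (x - y) \<Longrightarrow> x = y"
proof -
  assume *: "x \<in> box4 p" "y \<in> box4 p" "zero_mod p (x - y)"
  obtain x1 x2 x3 x4 y1 y2 y3 y4 where xy: "x = (x1, x2, x3, x4)" "y = (y1, y2, y3, y4)" by (metis prod_cases4)
  have "a = b" if "a \<in> {0..<p}" "b \<in> {0..<p}" "p dvd a - b" for a b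
    using not_dvd_diff_residues that by blast
  then show "x = y" using * by (simp add: xy box4_def)
qed

lemma indepD: "indep p U V \<Longrightarrow> zero_mod p (scl \<alpha> U + scl \<beta> V) \<Longrightarrow> p dvd \<alpha> \<and> p dvd \<beta>"
  by (simp add: indep_def)

lemma two_linear_equations:
  fixes p :: int
  assumes p: "prime p" and det: "\<not> p dvd u * v' - u' * v" and xy: "p dvd x" "p dvd y"
    and eqs: "p dvd u * a + u' * b + (c * x + c' * y)" "p dvd v * a + v' * b + (d * x + d' * y)"
  shows "p dvd a \<and> p dvd b"
proof -
  have "p dvd u * a + u' * b" "p dvd v * a + v' * b"
    using eqs xy by (simp_all add: dvd_add_left_iff)
  moreover have "(u * v' - u' * v) * a = v' * (u * a + u' * b) - u' * (v * a + v' * b)"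
    "(u * v' - u' * v) * b = u * (v * a + v' * b) - v * (u * a + u' * b)"
    by (simp_all add: algebra_simps)
  ultimately have "p dvd (u * v' - u' * v) * a" "p dvd (u * v' - u' * v) * b" by simp_all
  then show ?thesis using det p by (simp add: prime_dvd_mult_iff)
qed

text \<open>A nonvanishing minor of the two equations singles out two coordinates that determine the others. If all minors vanish, the
  equations are dependent.\<close>

lemma indep_ex_coordinates:
  assumes p: "prime p" and UV: "indep p U V"
  shows "\<exists>e e'. \<forall>w. p dvd inner4 U w \<longrightarrow> p dvd inner4 V w \<longrightarrow> p dvd inner4 e w \<longrightarrow> p dvd inner4 e' w \<longrightarrow> zero_mod p w"
    (is "\<exists>e e'. ?good e e'")
proof -
  obtain u1 u2 u3 u4 v1 v2 v3 v4 where U: "U = (u1, u2, u3, u4)" and V: "V = (v1, v2, v3, v4)"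
    by (metis prod_cases4)
  let ?e1 = "(1, 0, 0, 0)" and ?e2 = "(0, 1, 0, 0)" and ?e3 = "(0, 0, 1, 0)" and ?e4 = "(0, 0, 0, 1)"
  have good: "?good e e'"
    if "\<And>w1 w2 w3 w4. p dvd inner4 U (w1, w2, w3, w4) \<Longrightarrow> p dvd inner4 V (w1, w2, w3, w4) \<Longrightarrow>
      p dvd inner4 e (w1, w2, w3, w4) \<Longrightarrow> p dvd inner4 e' (w1, w2, w3, w4) \<Longrightarrow> zero_mod p (w1, w2, w3, w4)" for e e'
    using that by (simp only: split_paired_All) blast
  consider "\<not> p dvd u1 * v2 - u2 * v1" | "\<not> p dvd u1 * v3 - u3 * v1" | "\<not> p dvd u1 * v4 - u4 * v1"
    | "\<not> p dvd u2 * v3 - u3 * v2" | "\<not> p dvd u2 * v4 - u4 * v2" | "\<not> p dvd u3 * v4 - u4 * v3"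
    | "p dvd u1 * v2 - u2 * v1 \<and> p dvd u1 * v3 - u3 * v1 \<and> p dvd u1 * v4 - u4 * v1
       \<and> p dvd u2 * v3 - u3 * v2 \<and> p dvd u2 * v4 - u4 * v2 \<and> p dvd u3 * v4 - u4 * v3"
    by blast
  then show ?thesis
  proof cases
    case 1
    have "?good ?e3 ?e4"
    proof (rule good)
      fix w1 w2 w3 w4
      assume "p dvd inner4 U (w1, w2, w3, w4)" "p dvd inner4 V (w1, w2, w3, w4)"
        "p dvd inner4 ?e3 (w1, w2, w3, w4)" "p dvd inner4 ?e4 (w1, w2, w3, w4)"
      then show "zero_mod p (w1, w2, w3, w4)"
        using two_linear_equations[OF p 1, of w3 w4 w1 w2 u3 u4 v3 v4] by (simp add: U V add_ac)
    qed
    then show ?thesis by blast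
  next
    case 2
    have "?good ?e2 ?e4"
    proof (rule good)
      fix w1 w2 w3 w4
      assume "p dvd inner4 U (w1, w2, w3, w4)" "p dvd inner4 V (w1, w2, w3, w4)"
        "p dvd inner4 ?e2 (w1, w2, w3, w4)" "p dvd inner4 ?e4 (w1, w2, w3, w4)"
      then show "zero_mod p (w1, w2, w3, w4)"
        using two_linear_equations[OF p 2, of w2 w4 w1 w3 u2 u4 v2 v4] by (simp add: U V add_ac)
    qed
    then show ?thesis by blast
  next
    case 3
    have "?good ?e2 ?e3"
    proof (rule good)
      fix w1 w2 w3 w4
      assume "p dvd inner4 U (w1, w2, w3, w4)" "p dvd inner4 V (w1, w2, w3, w4)"
        "p dvd inner4 ?e2 (w1, w2, w3, w4)" "p dvd inner4 ?e3 (w1, w2, w3, w4)"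
      then show "zero_mod p (w1, w2, w3, w4)"
        using two_linear_equations[OF p 3, of w2 w3 w1 w4 u2 u3 v2 v3] by (simp add: U V add_ac)
    qed
    then show ?thesis by blast
  next
    case 4
    have "?good ?e1 ?e4"
    proof (rule good)
      fix w1 w2 w3 w4
      assume "p dvd inner4 U (w1, w2, w3, w4)" "p dvd inner4 V (w1, w2, w3, w4)"
        "p dvd inner4 ?e1 (w1, w2, w3, w4)" "p dvd inner4 ?e4 (w1, w2, w3, w4)"
      then show "zero_mod p (w1, w2, w3, w4)"
        using two_linear_equations[OF p 4, of w1 w4 w2 w3 u1 u4 v1 v4] by (simp add: U V add_ac)
    qed
    then show ?thesis by blast
  next
    case 5
    have "?good ?e1 ?e3"
    proof (rule good)
      fix w1 w2 w3 w4
      assume "p dvd inner4 U (w1, w2, w3, w4)" "p dvd inner4 V (w1, w2, w3, w4)"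
        "p dvd inner4 ?e1 (w1, w2, w3, w4)" "p dvd inner4 ?e3 (w1, w2, w3, w4)"
      then show "zero_mod p (w1, w2, w3, w4)"
        using two_linear_equations[OF p 5, of w1 w3 w2 w4 u1 u3 v1 v3] by (simp add: U V add_ac)
    qed
    then show ?thesis by blast
  next
    case 6
    have "?good ?e1 ?e2"
    proof (rule good)
      fix w1 w2 w3 w4
      assume "p dvd inner4 U (w1, w2, w3, w4)" "p dvd inner4 V (w1, w2, w3, w4)"
        "p dvd inner4 ?e1 (w1, w2, w3, w4)" "p dvd inner4 ?e2 (w1, w2, w3, w4)"
      then show "zero_mod p (w1, w2, w3, w4)"
        using two_linear_equations[OF p 6, of w1 w2 w3 w4 u1 u2 v1 v2] by (simp add: U V add_ac)
    qed
    then show ?thesis by blast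
  next
    case 7
    have "\<not> p dvd 1" using p not_prime_unit by blast
    have "\<not> (p dvd u1 \<and> p dvd u2 \<and> p dvd u3 \<and> p dvd u4)"
      using indepD[OF UV, of 1 0] \<open>\<not> p dvd 1\<close> by (auto simp: U V)
    moreover have "p dvd u1" "p dvd u2" "p dvd u3" "p dvd u4"
      using indepD[OF UV, of v1 "- u1"] indepD[OF UV, of v2 "- u2"] indepD[OF UV, of v3 "- u3"] indepD[OF UV, of v4 "- u4"] 7
      by (auto simp: U V algebra_simps dvd_diff_commute)
    ultimately show ?thesis by blast
  qed
qed

text \<open>By the pigeonhole principle: there are \<open>p^3\<close> combinations of the three vectors, and each of them is determined by two
  coordinates.\<close>

lemma dependent_of_three_orthogonal:
  assumes p: "prime p" and UV: "indep p U V" and rs: "indep p r1 r2"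
    and perp: "p dvd inner4 U r1" "p dvd inner4 V r1" "p dvd inner4 U r2" "p dvd inner4 V r2" "p dvd inner4 U r3" "p dvd inner4 V r3"
  obtains \<alpha> \<beta> where "zero_mod p (r3 - scl \<alpha> r1 - scl \<beta> r2)"
proof -
  obtain e e' where ee: "\<And>w. p dvd inner4 U w \<Longrightarrow> p dvd inner4 V w \<Longrightarrow> p dvd inner4 e w \<Longrightarrow> p dvd inner4 e' w \<Longrightarrow> zero_mod p w"
    using indep_ex_coordinates[OF p UV] by blast
  have p0: "p > 0" and p1: "p > 1" using p prime_gt_0_int prime_gt_1_int by blast+
  let ?S = "{0..<p} \<times> {0..<p} \<times> {0..<p}"
  define W where "W = (\<lambda>(a, b, c). scl a r1 + scl b r2 + scl c r3)"
  define h where "h t = (inner4 e (W t) mod p, inner4 e' (W t) mod p)" for t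
  have "h ` ?S \<subseteq> {0..<p} \<times> {0..<p}" using p0 by (auto simp: h_def)
  moreover have "card ({0..<p} \<times> {0..<p}) < card ?S"
    using p1 by (simp add: card_cartesian_product)
  ultimately have "\<not> inj_on h ?S"
    by (metis card_inj_on_le finite_SigmaI finite_atLeastLessThan_int not_less)
  then obtain a b c a' b' c' where t: "(a, b, c) \<in> ?S" "(a', b', c') \<in> ?S" "(a, b, c) \<noteq> (a', b', c')" "h (a, b, c) = h (a', b', c')"
    unfolding inj_on_def by (metis prod_cases3)
  define w where "w = scl (a - a') r1 + scl (b - b') r2 + scl (c - c') r3"
  have "p dvd inner4 e w" "p dvd inner4 e' w"
    using t(4) by (simp_all add: h_def W_def w_def inner4_simps mod_eq_dvd_iff algebra_simps)
  moreover have "p dvd inner4 U w" "p dvd inner4 V w"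
    using perp by (simp_all add: w_def inner4_simps)
  ultimately have w: "zero_mod p w" using ee by blast
  (* Otherwise the collision would be a relation between the independent vectors r1 and r2. *)
  have "\<not> p dvd c - c'"
  proof
    assume c: "p dvd c - c'"
    have "scl (a - a') r1 + scl (b - b') r2 = w - scl (c - c') r3" by (simp add: w_def)
    then have "zero_mod p (scl (a - a') r1 + scl (b - b') r2)"
      using w zero_mod_scl_dvd[OF c] by (metis zero_mod_diff)
    then have "p dvd a - a' \<and> p dvd b - b'" by (rule indepD[OF rs])
    then show False using t c not_dvd_diff_residues[of _ p] by fastforce
  qed
  then obtain i where i: "p dvd (c - c') * i - 1" using prime_obtain_inverse[OF p] by blast
  have "r3 - scl (- i * (a - a')) r1 - scl (- i * (b - b')) r2 = scl i w - scl ((c - c') * i - 1) r3"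
    by (cases r1; cases r2; cases r3) (simp add: w_def algebra_simps)
  then show thesis using that[of "- i * (a - a')" "- i * (b - b')"] zero_mod_scl[OF w, of i] zero_mod_scl_dvd[OF i, of r3]
    by (metis zero_mod_diff)
qed

lemma indepI:
  assumes p: "prime p" and r: "\<not> zero_mod p r" and s: "\<And>c. \<not> zero_mod p (s - scl c r)"
  shows "indep p r s"
  unfolding indep_def
proof (intro allI impI)
  fix \<alpha> \<beta> assume z: "zero_mod p (scl \<alpha> r + scl \<beta> s)"
  have "p dvd \<beta>"
  proof (rule ccontr)
    assume "\<not> p dvd \<beta>"
    then obtain i where i: "p dvd \<beta> * i - 1" using prime_obtain_inverse[OF p] by blast
    have "s - scl (- i * \<alpha>) r = scl i (scl \<alpha> r + scl \<beta> s) - scl (\<beta> * i - 1) s"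
      by (cases r; cases s) (simp add: algebra_simps)
    then show False using s zero_mod_scl[OF z, of i] zero_mod_scl_dvd[OF i, of s] by (metis zero_mod_diff)
  qed
  moreover have "scl \<alpha> r = (scl \<alpha> r + scl \<beta> s) - scl \<beta> s" by simp
  ultimately have "zero_mod p (scl \<alpha> r)" using z by (metis zero_mod_diff zero_mod_scl_dvd)
  then have "p dvd \<alpha>" using scl_cancel[OF p] r by blast
  with \<open>p dvd \<beta>\<close> show "p dvd \<alpha> \<and> p dvd \<beta>" by blast
qed

text \<open>A set \<open>A\<close> of points on the sphere of squared radius \<open>t\<close>, represented by reduced residues, with at most \<open>k\<close> points on
  each isotropic line.\<close>

locale sphere_points =
  fixes p t :: int and A :: "int vec4 set" and k :: nat
  assumes p: "prime p" "p > 2" and t: "\<not> p dvd t" and A: "A \<subseteq> box4 p" and sphere: "\<And>x. x \<in> A \<Longrightarrow> p dvd inner4 x x - t"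
    and k: "\<And>x r. \<not> zero_mod p r \<Longrightarrow> p dvd inner4 r r \<Longrightarrow> card {y \<in> A. \<exists>c. zero_mod p (y - x - scl c r)} \<le> k"
begin

lemma finite_A: "finite A"
  by (rule finite_subset[OF A]) (simp add: box4_def)

lemma not_dvd2: "\<not> p dvd 2"
  using p(2) zdvd_imp_le[of p 2] by auto

lemma dvd_double: "p dvd 2 * a \<longleftrightarrow> p dvd a"
  using p(1) not_dvd2 by (simp add: prime_dvd_mult_iff)

lemma eq_if_zero_mod: "x \<in> A \<Longrightarrow> y \<in> A \<Longrightarrow> zero_mod p (x - y) \<Longrightarrow> x = y"
  using A box4_eqI by blast

lemma inner_diff_sphere:
  assumes "x \<in> A" "y \<in> A"
  shows "p dvd inner4 (x - y) (x - y) + 2 * inner4 (x - y) y"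
proof -
  have "inner4 (x - y) (x - y) + 2 * inner4 (x - y) y = (inner4 x x - t) - (inner4 y y - t)"
    by (simp add: inner4_simps inner4_commute[of y x])
  then show ?thesis using sphere assms by (metis dvd_diff)
qed

lemma isotropic_perp:
  assumes "x \<in> A" "y \<in> A" "p dvd inner4 (x - y) (x - y)"
  shows "p dvd inner4 (x - y) y"
  using inner_diff_sphere[OF assms(1,2)] assms(3) by (simp add: dvd_add_right_iff dvd_double)

lemma sphere_nonzero: "x \<in> A \<Longrightarrow> \<not> p dvd inner4 x x"
  using sphere t by (metis dvd_diff_right_iff)

text \<open>Three pairwise nonproportional isotropic vectors of a plane would make the plane totally isotropic. Chords of the
  sphere that are isotropic are orthogonal to the radius \<open>x\<close>, so \<open>x\<close> would be orthogonal to a totally isotropic plane, thus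
  contained in it, and isotropic.\<close>

lemma card_isotropic_in_plane_le:
  assumes x: "x \<in> A" and UV: "indep p U V"
  shows "card {y \<in> A. y \<noteq> x \<and> p dvd inner4 (y - x) (y - x) \<and> p dvd inner4 U (y - x) \<and> p dvd inner4 V (y - x)} \<le> 2 * k"
    (is "card ?I \<le> _")
proof (cases "?I = {}")
  case False
  then obtain y1 where y1: "y1 \<in> ?I" by blast
  define r1 where "r1 = y1 - x"
  have r1: "\<not> zero_mod p r1" "p dvd inner4 r1 r1" 
    using y1 x eq_if_zero_mod[of y1 x] unfolding r1_def by blast+
  let ?L = "\<lambda>r. {y \<in> A. \<exists>c. zero_mod p (y - x - scl c r)}"
  show ?thesis
  proof (cases "?I \<subseteq> ?L r1")
    case True
    then have "card ?I \<le> card (?L r1)" using finite_A by (intro card_mono) auto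
    then show ?thesis using k[OF r1, of x] by linarith
  next
    case False
    then obtain y2 where y2: "y2 \<in> ?I" "y2 \<notin> ?L r1" by blast
    define r2 where "r2 = y2 - x"
    have r2: "\<not> zero_mod p r2" "p dvd inner4 r2 r2" 
    using y2 x eq_if_zero_mod[of y2 x] unfolding r2_def by blast+
    have "\<not> zero_mod p (r2 - scl c r1)" for c using y2 by (auto simp: r2_def)
    then have r12: "indep p r1 r2" using indepI[OF p(1) r1(1)] by blast
    have perp: "p dvd inner4 (y - x) x" if "y \<in> ?I" for y using isotropic_perp that x by auto
    have cross: "\<not> p dvd inner4 r1 r2"
    proof
      assume c: "p dvd inner4 r1 r2"
      obtain \<alpha> \<beta> where z: "zero_mod p (x - scl \<alpha> r1 - scl \<beta> r2)"
      proof (rule dependent_of_three_orthogonal[OF p(1) r12 r12])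
        show "p dvd inner4 r1 r1" "p dvd inner4 r2 r1" "p dvd inner4 r1 r2" "p dvd inner4 r2 r2" 
          using r1 r2 c inner4_commute by metis+
        show "p dvd inner4 r1 x" "p dvd inner4 r2 x" using perp y1 y2 by (simp_all add: r1_def r2_def)
      qed
      have "inner4 x x = inner4 (x - scl \<alpha> r1 - scl \<beta> r2) x + \<alpha> * inner4 r1 x + \<beta> * inner4 r2 x"
        by (simp add: inner4_simps)
      also have "p dvd \<dots>"
        using zero_mod_inner4[OF z, of x] perp y1 y2 unfolding r1_def r2_def by (intro dvd_add dvd_mult) auto
      finally show False using sphere_nonzero[OF x] by blast
    qed
    have "?I \<subseteq> ?L r1 \<union> ?L r2"
    proof
      fix y assume y: "y \<in> ?I"
      define r where "r = y - x"
      obtain \<alpha> \<beta> where z: "zero_mod p (r - scl \<alpha> r1 - scl \<beta> r2)"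
        by (rule dependent_of_three_orthogonal[OF p(1) UV r12, of r]) (use y y1 y2 in \<open>auto simp: r_def r1_def r2_def\<close>)
      have "2 * (\<alpha> * \<beta> * inner4 r1 r2) = inner4 r r - inner4 (r - scl \<alpha> r1 - scl \<beta> r2) (r + scl \<alpha> r1 + scl \<beta> r2)
          - \<alpha>\<^sup>2 * inner4 r1 r1 - \<beta>\<^sup>2 * inner4 r2 r2"
        by (simp add: inner4_simps inner4_commute[of r1 r] inner4_commute[of r2 r] inner4_commute[of r2 r1] algebra_simps power2_eq_square)
      also have "p dvd \<dots>"
        using zero_mod_inner4[OF z] r1(2) r2(2) y unfolding r_def by (intro dvd_diff dvd_mult) auto
      finally have "p dvd \<alpha> * \<beta> * inner4 r1 r2" by (simp only: dvd_double)
      then have "p dvd \<alpha> \<or> p dvd \<beta>" using cross p(1) by (simp add: prime_dvd_mult_iff)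
      then show "y \<in> ?L r1 \<union> ?L r2"
      proof
        assume "p dvd \<alpha>"
        have "y - x - scl \<beta> r2 = (r - scl \<alpha> r1 - scl \<beta> r2) + scl \<alpha> r1" by (simp add: r_def)
        then have "zero_mod p (y - x - scl \<beta> r2)" using z zero_mod_scl_dvd[OF \<open>p dvd \<alpha>\<close>] by (metis zero_mod_add)
        then show ?thesis using y by blast
      next
        assume "p dvd \<beta>"
        have "y - x - scl \<alpha> r1 = (r - scl \<alpha> r1 - scl \<beta> r2) + scl \<beta> r2" by (simp add: r_def)
        then have "zero_mod p (y - x - scl \<alpha> r1)" using z zero_mod_scl_dvd[OF \<open>p dvd \<beta>\<close>] by (metis zero_mod_add)
        then show ?thesis using y by blast
      qed
    qed
    then have "card ?I \<le> card (?L r1 \<union> ?L r2)" using finite_A by (intro card_mono) auto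
    also have "\<dots> \<le> card (?L r1) + card (?L r2)" by (rule card_Un_le)
    finally show ?thesis using k[OF r1, of x] k[OF r2, of x] by linarith
  qed
qed (simp only: card.empty)

end

section \<open>The second moment bound for incidences\<close>

definition box3 :: "int \<Rightarrow> vec3 set" where
  "box3 p = {0..<p} \<times> {0..<p} \<times> {0..<p}"

lemma card_linear_root:
  fixes p :: int
  assumes p: "prime p" and a: "\<not> p dvd a"
  shows "card {x \<in> {0..<p}. p dvd a * x + r} = 1"
proof -
  obtain i where i: "p dvd a * i - 1" using prime_obtain_inverse[OF p a] by blast
  define x where "x = (- r * i) mod p"
  have x: "x \<in> {0..<p}" using prime_gt_0_int[OF p] by (simp add: x_def)
  have "p dvd (- r * i) - x" unfolding x_def by (simp add: mod_eq_dvd_iff[symmetric])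
  moreover have "a * x + r = - (a * ((- r * i) - x)) - r * (a * i - 1)" by (simp add: algebra_simps)
  ultimately have root: "p dvd a * x + r" using i by simp
  have "{x \<in> {0..<p}. p dvd a * x + r} = {x}"
  proof (intro equalityI subsetI)
    fix y assume y: "y \<in> {x \<in> {0..<p}. p dvd a * x + r}"
    have "a * (y - x) = (a * y + r) - (a * x + r)" by (simp add: algebra_simps)
    then have "p dvd a * (y - x)" using y root by (metis (no_types, lifting) dvd_diff mem_Collect_eq)
    then have "p dvd y - x" using a p by (simp add: prime_dvd_mult_iff)
    then show "y \<in> {x}" using x y not_dvd_diff_residues[of y p x] by blast
  qed (use x root in auto)
  then show ?thesis by simp
qed

lemma card_plane:
  fixes p :: int
  assumes p: "prime p" and x: "x \<in> box3 p" "x \<noteq> 0"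
  shows "card {y \<in> box3 p. p dvd 1 + dot3 x y} = (nat p)\<^sup>2"
proof -
  obtain x1 x2 x3 where xx: "x = (x1, x2, x3)" by (metis prod_cases3)
  let ?F = "{0..<p}"
  have c: "card {(y, z). y \<in> ?F \<times> ?F \<and> z \<in> ?F \<and> p dvd a * z + g y} = (nat p)\<^sup>2" if "\<not> p dvd a" for a and g :: "int \<times> int \<Rightarrow> int"
    using card_filter_pairs_fst[of "?F \<times> ?F" ?F "\<lambda>y z. p dvd a * z + g y"] card_linear_root[OF p that]
    by (simp add: card_cartesian_product power2_eq_square)
  have "\<not> p dvd v" if "v \<in> ?F" "v \<noteq> 0" for v using that not_dvd_diff_residues[of v p 0] by auto
  then consider "\<not> p dvd x1" | "\<not> p dvd x2" | "\<not> p dvd x3"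
    using x by (auto simp: xx box3_def zero_prod_def)
  then show ?thesis
  proof cases
    case 1
    have "bij_betw (\<lambda>((u, v), z). (z, u, v)) {(y, z). y \<in> ?F \<times> ?F \<and> z \<in> ?F \<and> p dvd x1 * z + (1 + x2 * fst y + x3 * snd y)}
       {y \<in> box3 p. p dvd 1 + dot3 x y}"
      by (rule bij_betwI[where g = "\<lambda>(z, u, v). ((u, v), z)"]) (auto simp: box3_def xx algebra_simps)
    then show ?thesis using c[OF 1, of "\<lambda>y. 1 + x2 * fst y + x3 * snd y"] bij_betw_same_card by fastforce
  next
    case 2
    have "bij_betw (\<lambda>((u, v), z). (u, z, v)) {(y, z). y \<in> ?F \<times> ?F \<and> z \<in> ?F \<and> p dvd x2 * z + (1 + x1 * fst y + x3 * snd y)}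
       {y \<in> box3 p. p dvd 1 + dot3 x y}"
      by (rule bij_betwI[where g = "\<lambda>(u, z, v). ((u, v), z)"]) (auto simp: box3_def xx algebra_simps)
    then show ?thesis using c[OF 2, of "\<lambda>y. 1 + x1 * fst y + x3 * snd y"] bij_betw_same_card by fastforce
  next
    case 3
    have "bij_betw (\<lambda>((u, v), z). (u, v, z)) {(y, z). y \<in> ?F \<times> ?F \<and> z \<in> ?F \<and> p dvd x3 * z + (1 + x1 * fst y + x2 * snd y)}
       {y \<in> box3 p. p dvd 1 + dot3 x y}"
      by (rule bij_betwI[where g = "\<lambda>(u, v, z). ((u, v), z)"]) (auto simp: box3_def xx algebra_simps)
    then show ?thesis using c[OF 3, of "\<lambda>y. 1 + x1 * fst y + x2 * snd y"] bij_betw_same_card by fastforce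
  qed
qed

text \<open>Two planes meet at most in a line. On the line some coordinate is injective; for parallel planes there are no common
  points, as both equations have the constant term one.\<close>

lemma card_two_planes_le:
  fixes p :: int
  assumes p: "prime p" and x: "x \<in> box3 p" and x': "x' \<in> box3 p" and ne: "x \<noteq> x'"
  shows "card {y \<in> box3 p. p dvd 1 + dot3 x y \<and> p dvd 1 + dot3 x' y} \<le> nat p" (is "card ?S \<le> _")
proof -
  obtain a1 a2 a3 b1 b2 b3 where xx: "x = (a1, a2, a3)" "x' = (b1, b2, b3)" by (metis prod_cases3)
  let ?F = "{0..<p}"
  have eqI: "u = v" if "u \<in> ?F" "v \<in> ?F" "p dvd u - v" for u v using that not_dvd_diff_residues by blast
  have inj: "card ?S \<le> nat p" if g: "inj_on g ?S" "\<And>y. y \<in> box3 p \<Longrightarrow> g y \<in> ?F" for g :: "vec3 \<Rightarrow> int"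
    using card_inj_on_le[OF g(1), of ?F] g(2) by (simp add: image_subset_iff)
  show ?thesis
  proof (cases "?S = {}")
    case False
    then obtain y where y: "y \<in> ?S" by blast
    obtain y1 y2 y3 where yy: "y = (y1, y2, y3)" by (metis prod_cases3)
    have yd: "p dvd 1 + dot3 x y" "p dvd 1 + dot3 x' y" using y by auto
    consider "\<not> p dvd a1 * b2 - a2 * b1" | "\<not> p dvd a1 * b3 - a3 * b1" | "\<not> p dvd a2 * b3 - a3 * b2"
      | "p dvd a1 * b2 - a2 * b1" "p dvd a1 * b3 - a3 * b1" "p dvd a2 * b3 - a3 * b2" by blast
    then show ?thesis
    proof cases
      case 1
      show ?thesis
      proof (rule inj[of "\<lambda>h. snd (snd h)"], rule inj_onI)
        fix h h' assume hh: "h \<in> ?S" "h' \<in> ?S" "snd (snd h) = snd (snd h')"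
        obtain u v w u' v' w' where e: "h = (u, v, w)" "h' = (u', v', w')" by (metis prod_cases3)
        have h: "p dvd 1 + dot3 x h" "p dvd 1 + dot3 x' h" "p dvd 1 + dot3 x h'" "p dvd 1 + dot3 x' h'" using hh by auto
        have "p dvd a1 * (u - u') + a2 * (v - v')" "p dvd b1 * (u - u') + b2 * (v - v')"
          using dvd_diff[OF h(1,3)] dvd_diff[OF h(2,4)] hh(3) by (simp_all add: xx e algebra_simps)
        then have "p dvd u - u' \<and> p dvd v - v'"
          using two_linear_equations[OF p 1, of 0 0 "u - u'" "v - v'" 0 0 0 0] by simp
        moreover have "w = w'" using hh(3) by (simp add: e)
        ultimately show "h = h'" using eqI hh(1,2) by (simp add: e box3_def)
      qed (auto simp: box3_def)
    next
      case 2
      show ?thesis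
      proof (rule inj[of "\<lambda>h. fst (snd h)"], rule inj_onI)
        fix h h' assume hh: "h \<in> ?S" "h' \<in> ?S" "fst (snd h) = fst (snd h')"
        obtain u v w u' v' w' where e: "h = (u, v, w)" "h' = (u', v', w')" by (metis prod_cases3)
        have h: "p dvd 1 + dot3 x h" "p dvd 1 + dot3 x' h" "p dvd 1 + dot3 x h'" "p dvd 1 + dot3 x' h'" using hh by auto
        have "p dvd a1 * (u - u') + a3 * (w - w')" "p dvd b1 * (u - u') + b3 * (w - w')"
          using dvd_diff[OF h(1,3)] dvd_diff[OF h(2,4)] hh(3) by (simp_all add: xx e algebra_simps)
        then have "p dvd u - u' \<and> p dvd w - w'"
          using two_linear_equations[OF p 2, of 0 0 "u - u'" "w - w'" 0 0 0 0] by simp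
        moreover have "v = v'" using hh(3) by (simp add: e)
        ultimately show "h = h'" using eqI hh(1,2) by (simp add: e box3_def)
      qed (auto simp: box3_def)
    next
      case 3
      show ?thesis
      proof (rule inj[of "\<lambda>h. fst h"], rule inj_onI)
        fix h h' assume hh: "h \<in> ?S" "h' \<in> ?S" "fst h = fst h'"
        obtain u v w u' v' w' where e: "h = (u, v, w)" "h' = (u', v', w')" by (metis prod_cases3)
        have h: "p dvd 1 + dot3 x h" "p dvd 1 + dot3 x' h" "p dvd 1 + dot3 x h'" "p dvd 1 + dot3 x' h'" using hh by auto
        have "p dvd a2 * (v - v') + a3 * (w - w')" "p dvd b2 * (v - v') + b3 * (w - w')"
          using dvd_diff[OF h(1,3)] dvd_diff[OF h(2,4)] hh(3) by (simp_all add: xx e algebra_simps)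
        then have "p dvd v - v' \<and> p dvd w - w'"
          using two_linear_equations[OF p 3, of 0 0 "v - v'" "w - w'" 0 0 0 0] by simp
        moreover have "u = u'" using hh(3) by (simp add: e)
        ultimately show "h = h'" using eqI hh(1,2) by (simp add: e box3_def)
      qed (auto simp: box3_def)
    next
      case 4
      have "a1 - b1 = a1 * (1 + dot3 x' y) - b1 * (1 + dot3 x y) - y2 * (a1 * b2 - a2 * b1) - y3 * (a1 * b3 - a3 * b1)"
        "a2 - b2 = a2 * (1 + dot3 x' y) - b2 * (1 + dot3 x y) + y1 * (a1 * b2 - a2 * b1) - y3 * (a2 * b3 - a3 * b2)"
        "a3 - b3 = a3 * (1 + dot3 x' y) - b3 * (1 + dot3 x y) + y1 * (a1 * b3 - a3 * b1) + y2 * (a2 * b3 - a3 * b2)"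
        by (simp_all add: xx yy algebra_simps)
      then have "p dvd a1 - b1" "p dvd a2 - b2" "p dvd a3 - b3"
        using yd 4 by (metis dvd_add dvd_diff dvd_mult)+
      then have "x = x'" using eqI x x' by (auto simp: xx box3_def)
      with ne show ?thesis by blast
    qed
  next
    case True
    show ?thesis unfolding True by simp
  qed
qed

text \<open>Over all \<open>p^3\<close> planes \<open>y\<close> the number \<open>N y\<close> of incident points has mean about \<open>n / p\<close> and total squared deviation at most
  \<open>3 n p^2\<close>, since two points have at most \<open>p\<close> common planes.\<close>

lemma card_point_plane_incidences_le_second_moment:
  fixes p :: int
  assumes p: "prime p" and P: "P \<subseteq> box3 p"
  shows "real (card {(x, y). x \<in> P \<and> y \<in> P \<and> p dvd 1 + dot3 x y}) \<le> (real (card P))\<^sup>2 / p + 2 * p * card P"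
proof -
  have p0: "p > 0" using p prime_gt_0_int by blast
  have finB: "finite (box3 p)" by (simp add: box3_def)
  have finP: "finite P" using P finB finite_subset by blast
  define n where "n = real (card P)"
  define q where "q = real_of_int p"
  define N where "N y = real (card {x \<in> P. p dvd 1 + dot3 x y})" for y
  have n0: "n \<ge> 0" by (simp add: n_def)
  have q0: "q > 0" and qp: "real (nat p) = q" using p0 by (simp_all add: q_def)
  have cardB: "real (card (box3 p)) = q ^ 3"
    using p0 by (simp add: box3_def card_cartesian_product power3_eq_cube q_def)
  have "real (card (P - {0})) * q\<^sup>2 = real (\<Sum>x\<in>P - {0}. (nat p)\<^sup>2)" by (simp add: qp)
  also have "(\<Sum>x\<in>P - {0}. (nat p)\<^sup>2) = (\<Sum>x\<in>P - {0}. card {y \<in> box3 p. p dvd 1 + dot3 x y})"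
    by (intro sum.cong refl card_plane[symmetric] p) (use P in auto)
  also have "real \<dots> \<le> real (\<Sum>x\<in>P. card {y \<in> box3 p. p dvd 1 + dot3 x y})"
    unfolding of_nat_le_iff using finP by (intro sum_mono2) auto
  also have "(\<Sum>x\<in>P. card {y \<in> box3 p. p dvd 1 + dot3 x y}) = (\<Sum>y\<in>box3 p. card {x \<in> P. p dvd 1 + dot3 x y})"
    by (rule sum_card_swap[OF finP finB])
  also have "real \<dots> = (\<Sum>y\<in>box3 p. N y)" by (simp add: N_def)
  finally have "real (card (P - {0})) * q\<^sup>2 \<le> (\<Sum>y\<in>box3 p. N y)" .
  moreover have "n - 1 \<le> real (card (P - {0}))"
  proof -
    have "card P - card {0 :: vec3} \<le> card (P - {0})" by (rule diff_card_le_card_Diff) simp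
    moreover have "card {0 :: vec3} = 1" by simp
    ultimately have "card P \<le> card (P - {0}) + 1" by linarith
    then have "real (card P) \<le> real (card (P - {0}) + 1)" by (simp only: of_nat_le_iff)
    then show ?thesis by (simp add: n_def)
  qed
  then have "(n - 1) * q\<^sup>2 \<le> real (card (P - {0})) * q\<^sup>2" by (intro mult_right_mono) auto
  ultimately have S1: "(n - 1) * q\<^sup>2 \<le> (\<Sum>y\<in>box3 p. N y)" by linarith
  let ?both = "\<lambda>t y. p dvd 1 + dot3 (fst t) y \<and> p dvd 1 + dot3 (snd t) y"
  have sq: "(N y)\<^sup>2 = real (card {t \<in> P \<times> P. ?both t y})" for y
  proof -
    have "{t \<in> P \<times> P. ?both t y} = {x \<in> P. p dvd 1 + dot3 x y} \<times> {x \<in> P. p dvd 1 + dot3 x y}"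
      by auto
    then show ?thesis by (simp add: N_def card_cartesian_product power2_eq_square)
  qed
  have bound: "real (card {y \<in> box3 p. ?both t y}) \<le> (if fst t = snd t then q\<^sup>2 else 0) + q"
    if t: "t \<in> P \<times> P" for t
  proof (cases "fst t = snd t")
    case True
    have "card {y \<in> box3 p. p dvd 1 + dot3 (snd t) y} \<le> (nat p)\<^sup>2"
    proof (cases "snd t = 0")
      case True
      have "\<not> p dvd 1" using p not_prime_unit by blast
      then have e: "{y \<in> box3 p. p dvd 1 + dot3 (snd t) y} = {}" by (auto simp: True zero_prod_def)
      show ?thesis unfolding e by simp
    next
      case False
      have "snd t \<in> box3 p" using t P by auto
      then show ?thesis using card_plane[OF p _ False] by simp
    qed
    then have "real (card {y \<in> box3 p. p dvd 1 + dot3 (snd t) y}) \<le> real ((nat p)\<^sup>2)" by (simp only: of_nat_le_iff)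
    then show ?thesis using True q0 by (simp add: qp)
  next
    case False
    then have "card {y \<in> box3 p. ?both t y} \<le> nat p"
      using t P by (intro card_two_planes_le[OF p]) auto
    then have "real (card {y \<in> box3 p. ?both t y}) \<le> real (nat p)" by (simp only: of_nat_le_iff)
    then show ?thesis using False by (simp add: qp)
  qed
  have "(\<Sum>y\<in>box3 p. (N y)\<^sup>2) = real (\<Sum>y\<in>box3 p. card {t \<in> P \<times> P. ?both t y})"
    unfolding sq by simp
  also have "(\<Sum>y\<in>box3 p. card {t \<in> P \<times> P. ?both t y}) = (\<Sum>t\<in>P \<times> P. card {y \<in> box3 p. ?both t y})"
    by (rule sum_card_swap) (use finB finP in auto)
  also have "real \<dots> = (\<Sum>t\<in>P \<times> P. real (card {y \<in> box3 p. ?both t y}))" by simp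
  also have "\<dots> \<le> (\<Sum>t\<in>P \<times> P. (if fst t = snd t then q\<^sup>2 else 0) + q)"
    by (rule sum_mono) (rule bound)
  also have "\<dots> = (\<Sum>t\<in>P \<times> P. if fst t = snd t then q\<^sup>2 else 0) + n\<^sup>2 * q"
    by (simp add: sum.distrib card_cartesian_product n_def power2_eq_square)
  also have "(\<Sum>t\<in>P \<times> P. if fst t = snd t then q\<^sup>2 else 0) = (\<Sum>x\<in>P. \<Sum>y\<in>P. if x = y then q\<^sup>2 else 0)"
    by (simp add: sum.cartesian_product case_prod_unfold)
  also have "\<dots> = n * q\<^sup>2" using finP by (simp add: n_def)
  finally have S2: "(\<Sum>y\<in>box3 p. (N y)\<^sup>2) \<le> n * q\<^sup>2 + n\<^sup>2 * q" .
  have "(\<Sum>y\<in>box3 p. (N y - n / q)\<^sup>2) = (\<Sum>y\<in>box3 p. (N y)\<^sup>2 - 2 * (n / q) * N y + (n / q)\<^sup>2)"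
    by (simp add: power2_diff mult_ac add_diff_eq diff_add_eq)
  also have "\<dots> = (\<Sum>y\<in>box3 p. (N y)\<^sup>2) - 2 * (n / q) * (\<Sum>y\<in>box3 p. N y) + q ^ 3 * (n / q)\<^sup>2"
    by (simp only: sum.distrib sum_subtractf sum_distrib_left[symmetric] sum_constant cardB)
  also have "q ^ 3 * (n / q)\<^sup>2 = n\<^sup>2 * q" using q0 by (simp add: field_simps power2_eq_square power3_eq_cube)
  also have "(\<Sum>y\<in>box3 p. (N y)\<^sup>2) - 2 * (n / q) * (\<Sum>y\<in>box3 p. N y) + n\<^sup>2 * q
      \<le> (n * q\<^sup>2 + n\<^sup>2 * q) - 2 * (n / q) * ((n - 1) * q\<^sup>2) + n\<^sup>2 * q"
    using S1 S2 n0 q0 by (intro add_mono diff_mono mult_left_mono order_refl) auto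
  also have "\<dots> = n * q\<^sup>2 + 2 * n * q" using q0 by (simp add: field_simps power2_eq_square)
  also have "\<dots> \<le> 3 * n * q\<^sup>2"
  proof -
    have "1 \<le> q" using p0 by (simp add: q_def)
    then have "n * q * 1 \<le> n * q * q" using q0 n0 by (intro mult_left_mono) auto
    then show ?thesis by (simp add: power2_eq_square)
  qed
  finally have var: "(\<Sum>y\<in>box3 p. (N y - n / q)\<^sup>2) \<le> 3 * n * q\<^sup>2" .
  have "real (card {(x, y). x \<in> P \<and> y \<in> P \<and> p dvd 1 + dot3 x y}) = (\<Sum>y\<in>P. N y)"
    using finP by (simp add: card_filter_pairs_snd N_def)
  also have "\<dots> \<le> (\<Sum>y\<in>P. n / q + ((N y - n / q)\<^sup>2 / (2 * q) + q / 2))"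
  proof (rule sum_mono)
    fix y
    (* The arithmetic-geometric mean inequality replaces Cauchy-Schwarz. *)
    have "0 \<le> ((N y - n / q) - q)\<^sup>2 / (2 * q)" using q0 by simp
    also have "\<dots> = (N y - n / q)\<^sup>2 / (2 * q) + q / 2 - (N y - n / q)"
    proof -
      have "(a - q)\<^sup>2 / (2 * q) = a\<^sup>2 / (2 * q) + q / 2 - a" for a
        using q0 by (simp add: field_simps power2_eq_square)
      then show ?thesis .
    qed
    finally show "N y \<le> n / q + ((N y - n / q)\<^sup>2 / (2 * q) + q / 2)" by simp
  qed
  also have "\<dots> = n\<^sup>2 / q + (\<Sum>y\<in>P. (N y - n / q)\<^sup>2) / (2 * q) + n * q / 2"
    by (simp add: sum.distrib n_def sum_divide_distrib power2_eq_square)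
  also have "\<dots> \<le> n\<^sup>2 / q + (3 * n * q\<^sup>2) / (2 * q) + n * q / 2"
  proof -
    have "(\<Sum>y\<in>P. (N y - n / q)\<^sup>2) \<le> (\<Sum>y\<in>box3 p. (N y - n / q)\<^sup>2)" using P finB by (intro sum_mono2) auto
    then have "(\<Sum>y\<in>P. (N y - n / q)\<^sup>2) \<le> 3 * n * q\<^sup>2" using var by linarith
    then show ?thesis using q0 by (simp add: divide_right_mono)
  qed
  also have "\<dots> = n\<^sup>2 / q + 2 * q * n" using q0 by (simp add: field_simps power2_eq_square)
  finally show ?thesis by (simp add: n_def q_def)
qed

section \<open>Projecting the sphere from one of its points\<close>

text \<open>Multiplication of quaternions.\<close>

fun qmul :: "int vec4 \<Rightarrow> int vec4 \<Rightarrow> int vec4" where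
  "qmul (a1, a2, a3, a4) (z1, z2, z3, z4) =
    (a1 * z1 - a2 * z2 - a3 * z3 - a4 * z4, a1 * z2 + a2 * z1 + a3 * z4 - a4 * z3,
     a1 * z3 - a2 * z4 + a3 * z1 + a4 * z2, a1 * z4 + a2 * z3 - a3 * z2 + a4 * z1)"

text \<open>The quaternion \<open>x\<close> times the conjugate of \<open>z\<close>. It is a similarity that moves \<open>z\<close> to the real axis.\<close>

fun qcoords :: "int vec4 \<Rightarrow> int vec4 \<Rightarrow> int vec4" where
  "qcoords (z1, z2, z3, z4) x = (inner4 x (z1, z2, z3, z4), inner4 x (- z2, z1, - z4, z3),
     inner4 x (- z3, z4, z1, - z2), inner4 x (- z4, - z3, z2, z1))"

lemma inner4_qcoords: "inner4 (qcoords z x) (qcoords z y) = inner4 z z * inner4 x y"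
  by (cases x; cases y; cases z) (simp add: algebra_simps)

lemma inner4_qcoords_right: "inner4 u (qcoords z x) = inner4 (qmul u z) x"
  by (cases x; cases u; cases z) (simp add: algebra_simps)

lemma qcoords_linear: "qcoords z (scl a x + scl b y) = scl a (qcoords z x) + scl b (qcoords z y)"
  by (cases x; cases y; cases z) (simp add: algebra_simps)

lemma qmul_linear: "qmul (scl a u + scl b v) z = scl a (qmul u z) + scl b (qmul v z)"
  by (cases u; cases v; cases z) (simp add: algebra_simps)

lemma zero_mod_if_inner4_zero:
  assumes "\<And>y. p dvd inner4 x y"
  shows "zero_mod p x"
  using assms[of "(1, 0, 0, 0)"] assms[of "(0, 1, 0, 0)"] assms[of "(0, 0, 1, 0)"] assms[of "(0, 0, 0, 1)"]
  by (cases x) auto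

lemma zero_mod_if_qcoords:
  assumes "prime p" "\<not> p dvd inner4 z z" "zero_mod p (qcoords z x)"
  shows "zero_mod p x"
proof (rule zero_mod_if_inner4_zero)
  fix y
  have "p dvd inner4 z z * inner4 x y" using zero_mod_inner4[OF assms(3)] inner4_qcoords by metis
  then show "p dvd inner4 x y" using assms(1,2) by (simp add: prime_dvd_mult_iff)
qed

lemma zero_mod_if_qmul:
  assumes "prime p" "\<not> p dvd inner4 z z" "zero_mod p (qmul u z)"
  shows "zero_mod p u"
proof (rule zero_mod_if_inner4_zero)
  fix y
  have "qcoords z (qmul y z) = scl (inner4 z z) y"
    by (cases y; cases z) (simp add: algebra_simps)
  then have "inner4 z z * inner4 u y = inner4 (qmul u z) (qmul y z)"
    by (metis inner4_qcoords_right inner4_scl_right)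
  then have "p dvd inner4 z z * inner4 u y" using zero_mod_inner4[OF assms(3)] by simp
  then show "p dvd inner4 u y" using assms(1,2) by (simp add: prime_dvd_mult_iff)
qed

definition niso :: "int \<Rightarrow> int vec4 \<Rightarrow> int vec4 \<Rightarrow> bool" where
  "niso p x y \<longleftrightarrow> \<not> p dvd inner4 (x - y) (x - y)"

lemma niso_commute: "niso p x y \<longleftrightarrow> niso p y x"
  by (cases x; cases y) (simp add: niso_def algebra_simps)

text \<open>Projection of the sphere from its point \<open>z\<close>: after the similarity \<open>qcoords z\<close> the chord from \<open>z\<close> to \<open>x\<close> has the real part
  \<open>(x - z) \<cdot> z = - |x - z|^2 / 2\<close>, which is invertible for anisotropic chords, and the chord is scaled to real part one.\<close>

definition pinned :: "int \<Rightarrow> int vec4 \<Rightarrow> int vec4 \<Rightarrow> vec3" where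
  "pinned p z x = (case qcoords z (x - z) of (c, c1, c2, c3) \<Rightarrow> let i = minv p c in (c1 * i mod p, c2 * i mod p, c3 * i mod p))"

context sphere_points
begin

lemma pinned_scaled:
  assumes "x \<in> A" "z \<in> A" "niso p x z"
  shows "\<not> p dvd inner4 (x - z) z" "zero_mod p (scl (inner4 (x - z) z) (1, pinned p z x) - qcoords z (x - z))"
    "pinned p z x \<in> box3 p"
proof -
  show c: "\<not> p dvd inner4 (x - z) z"
    using inner_diff_sphere[OF assms(1,2)] assms(3) by (auto simp: niso_def dvd_add_left_iff)
  obtain c1 c2 c3 where q: "qcoords z (x - z) = (inner4 (x - z) z, c1, c2, c3)" by (cases z) auto
  define c i where "c = inner4 (x - z) z" and "i = minv p c"
  have i: "p dvd c * i - 1" using minv[OF p(1) c] by (simp add: i_def c_def)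
  have pin: "pinned p z x = (c1 * i mod p, c2 * i mod p, c3 * i mod p)"
    unfolding pinned_def q by (simp add: Let_def i_def c_def)
  then show "pinned p z x \<in> box3 p" using p(2) by (simp add: box3_def)
  have "p dvd c * (v * i mod p) - v" for v
  proof -
    have "p dvd v * i - v * i mod p" by (simp add: mod_eq_dvd_iff[symmetric])
    moreover have "c * (v * i mod p) - v = v * (c * i - 1) - c * (v * i - v * i mod p)" by (simp add: algebra_simps)
    ultimately show ?thesis using i by simp
  qed
  then show "zero_mod p (scl (inner4 (x - z) z) (1, pinned p z x) - qcoords z (x - z))"
    unfolding q pin by (simp flip: c_def)
qed

lemma pinned_inner:
  assumes x: "x \<in> A" "z \<in> A" "niso p x z" and U: "p dvd inner4 U (1, pinned p z x)"
  shows "p dvd inner4 (qmul U z) (x - z)"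
proof -
  let ?D = "scl (inner4 (x - z) z) (1, pinned p z x) - qcoords z (x - z)"
  have "inner4 (qmul U z) (x - z) = inner4 U (qcoords z (x - z))" by (simp only: inner4_qcoords_right)
  also have "\<dots> = inner4 (x - z) z * inner4 U (1, pinned p z x) - inner4 U ?D"
    unfolding inner4_diff_right[of U] inner4_scl_right by simp
  also have "p dvd \<dots>"
    using U zero_mod_inner4[OF pinned_scaled(2)[OF x], of U] by (simp add: inner4_commute[of U ?D])
  finally show ?thesis .
qed

text \<open>The inner product of the scaled chords is \<open>1 + dot3\<close>.\<close>

lemma pinned_incidence:
  assumes x: "x \<in> A" "niso p x z" and y: "y \<in> A" "niso p y z" and z: "z \<in> A"
  shows "p dvd 1 + dot3 (pinned p z x) (pinned p z y) \<longleftrightarrow> p dvd inner4 (x - z) (y - z)"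
proof -
  define a where "a = scl (inner4 (x - z) z) (1, pinned p z x)"
  define b where "b = scl (inner4 (y - z) z) (1, pinned p z y)"
  have "inner4 (1, u) (1, v) = 1 + dot3 u v" for u v by (cases u; cases v) simp
  then have "inner4 (x - z) z * inner4 (y - z) z * (1 + dot3 (pinned p z x) (pinned p z y)) = inner4 a b"
    by (simp add: a_def b_def inner4_scl_left inner4_scl_right)
  also have "\<dots> = inner4 (a - qcoords z (x - z)) b + inner4 (b - qcoords z (y - z)) (qcoords z (x - z))
      + inner4 z z * inner4 (x - z) (y - z)"
  proof -
    have "inner4 a b = inner4 (a - X) b + inner4 (b - Y) X + inner4 X Y" for X Y
      by (simp add: inner4_diff_left inner4_commute[of X b] inner4_commute[of X Y])
    then show ?thesis by (simp only: inner4_qcoords[symmetric])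
  qed
  finally have "p dvd inner4 (x - z) z * inner4 (y - z) z * (1 + dot3 (pinned p z x) (pinned p z y)) \<longleftrightarrow>
     p dvd inner4 z z * inner4 (x - z) (y - z)"
    using zero_mod_inner4[OF pinned_scaled(2)[OF x(1) z x(2)]] zero_mod_inner4[OF pinned_scaled(2)[OF y(1) z y(2)]]
    unfolding a_def b_def by (metis dvd_add dvd_add_right_iff)
  then show ?thesis
    using pinned_scaled(1)[OF x(1) z x(2)] pinned_scaled(1)[OF y(1) z y(2)] sphere_nonzero[OF z] p(1)
    by (simp add: prime_dvd_mult_iff)
qed

text \<open>A line through \<open>z\<close> meets the sphere in only one more point, unless it is isotropic: the scaling factor of a chord is
  proportional to its squared length.\<close>

lemma pinned_inj:
  assumes x: "x \<in> A" "niso p x z" and y: "y \<in> A" "niso p y z" and z: "z \<in> A" and eq: "pinned p z x = pinned p z y"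
  shows "x = y"
proof -
  define c where "c = inner4 (x - z) z"
  define d where "d = inner4 (y - z) z"
  define X where "X = x - z"
  define Y where "Y = y - z"
  have cd: "\<not> p dvd c" "\<not> p dvd d"
    using pinned_scaled(1)[OF x(1) z x(2)] pinned_scaled(1)[OF y(1) z y(2)] by (simp_all add: c_def d_def)
  let ?w = "(1, pinned p z x)"
  have zx: "zero_mod p (scl c ?w - qcoords z X)" and zy: "zero_mod p (scl d ?w - qcoords z Y)"
    using pinned_scaled(2)[OF x(1) z x(2)] pinned_scaled(2)[OF y(1) z y(2)] eq by (simp_all add: c_def d_def X_def Y_def)
  have "scl d u + scl (- c) v = scl c (scl d w - v) - scl d (scl c w - u)" for u v w
    by (cases u; cases v; cases w) (simp add: algebra_simps)
  then have "qcoords z (scl d X + scl (- c) Y) = scl c (scl d ?w - qcoords z Y) - scl d (scl c ?w - qcoords z X)"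
    by (simp add: qcoords_linear)
  then have "zero_mod p (qcoords z (scl d X + scl (- c) Y))"
    using zx zy by (simp add: zero_mod_diff zero_mod_scl)
  then have D: "zero_mod p (scl d X + scl (- c) Y)" by (rule zero_mod_if_qcoords[OF p(1) sphere_nonzero[OF z]])
  have XX: "p dvd inner4 X X + 2 * c" and YY: "p dvd inner4 Y Y + 2 * d"
    using inner_diff_sphere[OF x(1) z] inner_diff_sphere[OF y(1) z] by (simp_all add: X_def Y_def c_def d_def)
  have "2 * (c * d * (c - d)) = inner4 (scl d X + scl (- c) Y) (scl d X + scl c Y)
      - d\<^sup>2 * (inner4 X X + 2 * c) + c\<^sup>2 * (inner4 Y Y + 2 * d)"
    by (simp add: inner4_simps inner4_commute[of Y X] algebra_simps power2_eq_square)
  then have "p dvd 2 * (c * d * (c - d))" using XX YY zero_mod_inner4[OF D] by (metis dvd_add dvd_diff dvd_mult)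
  then have "p dvd c - d" using cd p(1) by (simp add: dvd_double prime_dvd_mult_iff)
  moreover have "scl c (X - Y) = (scl d X + scl (- c) Y) + scl (c - d) X"
    by (cases X; cases Y) (simp add: algebra_simps)
  ultimately have "zero_mod p (scl c (X - Y))" using D by (simp add: zero_mod_add zero_mod_scl_dvd)
  then have "zero_mod p (X - Y)" using scl_cancel[OF p(1) _ cd(1)] by blast
  then show ?thesis using eq_if_zero_mod[OF x(1) y(1)] by (simp add: X_def Y_def)
qed

definition corners :: "int vec4 \<Rightarrow> (int vec4 \<times> int vec4) set" where
  "corners z = {(x, y). x \<in> A \<and> y \<in> A \<and> niso p x z \<and> niso p y z \<and> p dvd inner4 (x - z) (y - z)}"

definition shadow :: "int vec4 \<Rightarrow> vec3 set" where
  "shadow z = pinned p z ` {x \<in> A. niso p x z}"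

lemma shadow:
  assumes z: "z \<in> A"
  shows "shadow z \<subseteq> box3 p" "card (shadow z) \<le> card A" "\<And>x. x \<in> shadow z \<Longrightarrow> \<not> p dvd 1 + dot3 x x"
    "card (corners z) \<le> card {(x, y). x \<in> shadow z \<and> y \<in> shadow z \<and> p dvd 1 + dot3 x y}"
proof -
  show sub: "shadow z \<subseteq> box3 p" using pinned_scaled(3) z unfolding shadow_def by blast
  have "card (shadow z) \<le> card {x \<in> A. niso p x z}" unfolding shadow_def using finite_A by (intro card_image_le) auto
  also have "\<dots> \<le> card A" using finite_A by (intro card_mono) auto
  finally show "card (shadow z) \<le> card A" .
  show "\<not> p dvd 1 + dot3 x x" if sx: "x \<in> shadow z" for x

  proof -
    obtain y where y: "y \<in> A" "niso p y z" "x = pinned p z y" using sx unfolding shadow_def by blast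
    then show ?thesis using pinned_incidence[OF y(1,2) y(1,2) z] by (simp add: niso_def)
  qed
  have fin: "finite (shadow z)" using finite_A by (simp add: shadow_def)
  show "card (corners z) \<le> card {(x, y). x \<in> shadow z \<and> y \<in> shadow z \<and> p dvd 1 + dot3 x y}"
  proof (rule card_inj_on_le[where f = "map_prod (pinned p z) (pinned p z)"])
    show "inj_on (map_prod (pinned p z) (pinned p z)) (corners z)"

    proof (rule inj_onI)
      fix s s' assume s: "s \<in> corners z" "s' \<in> corners z" and eq: "map_prod (pinned p z) (pinned p z) s = map_prod (pinned p z) (pinned p z) s'"
      have "fst s = fst s'" "snd s = snd s'"
        using s eq z by (auto simp only: corners_def mem_Collect_eq case_prod_beta map_prod_def prod.inject fst_conv snd_conv intro!: pinned_inj)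
      then show "s = s'" by (rule prod_eqI)
    qed
    show "map_prod (pinned p z) (pinned p z) ` corners z \<subseteq> {(x, y). x \<in> shadow z \<and> y \<in> shadow z \<and> p dvd 1 + dot3 x y}"

    proof
      fix s assume "s \<in> map_prod (pinned p z) (pinned p z) ` corners z"
      then obtain x y where s: "s = (pinned p z x, pinned p z y)" and xy: "x \<in> A" "y \<in> A" "niso p x z" "niso p y z" "p dvd inner4 (x - z) (y - z)"
        unfolding corners_def by blast
      show "s \<in> {(x, y). x \<in> shadow z \<and> y \<in> shadow z \<and> p dvd 1 + dot3 x y}"
        using xy pinned_incidence[OF xy(1,3) xy(2,4) z] unfolding s shadow_def by blast
    qed
    show "finite {(x, y). x \<in> shadow z \<and> y \<in> shadow z \<and> p dvd 1 + dot3 x y}"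
      by (rule finite_subset[of _ "shadow z \<times> shadow z"]) (use fin in auto)
  qed
qed

lemma card_corners_le_large:
  assumes z: "z \<in> A"
  shows "real (card (corners z)) \<le> (real (card A))\<^sup>2 / p + 2 * p * card A"
proof -
  have "real (card (corners z)) \<le> real (card {(x, y). x \<in> shadow z \<and> y \<in> shadow z \<and> p dvd 1 + dot3 x y})"
    using shadow(4)[OF z] by simp
  also have "\<dots> \<le> (real (card (shadow z)))\<^sup>2 / p + 2 * p * card (shadow z)"
    by (rule card_point_plane_incidences_le_second_moment[OF p(1) shadow(1)[OF z]])
  also have "\<dots> \<le> (real (card A))\<^sup>2 / p + 2 * p * card A"
    using shadow(2)[OF z] p(2) by (intro add_mono divide_right_mono power_mono mult_left_mono) auto
  finally show ?thesis .
qed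

text \<open>Plane equations for the projected points pull back to independent plane equations on the sphere.\<close>

lemma indep_qmul:
  assumes z: "z \<in> A" and UV: "indep p U V"
  shows "indep p (qmul U z) (qmul V z)"
  unfolding indep_def
proof (intro allI impI)
  fix \<alpha> \<beta> assume "zero_mod p (scl \<alpha> (qmul U z) + scl \<beta> (qmul V z))"
  then have "zero_mod p (scl \<alpha> U + scl \<beta> V)"
    using zero_mod_if_qmul[OF p(1) sphere_nonzero[OF z]] by (simp add: qmul_linear)
  then show "p dvd \<alpha> \<and> p dvd \<beta>" by (rule indepD[OF UV])
qed

lemma card_corners_le_small:
  assumes z: "z \<in> A" and Q: "0 < Q" "card A \<le> Q\<^sup>2" "51200 * int Q \<le> p"
    and poor: "\<And>z U V. indep p U V \<Longrightarrow> card {x \<in> A. p dvd inner4 U (x - z) \<and> p dvd inner4 V (x - z)} \<le> Q"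
  shows "card (corners z) \<le> 800 * card A * Q"
proof -
  have "card {x \<in> shadow z. p dvd inner4 U (1, x) \<and> p dvd inner4 V (1, x)} \<le> Q" if UV: "indep p U V" for U V
  proof -
    let ?T = "{x \<in> A. p dvd inner4 (qmul U z) (x - z) \<and> p dvd inner4 (qmul V z) (x - z)}"
    have "{x \<in> shadow z. p dvd inner4 U (1, x) \<and> p dvd inner4 V (1, x)} \<subseteq> pinned p z ` ?T"
      using pinned_inner z unfolding shadow_def by blast
    then have "card {x \<in> shadow z. p dvd inner4 U (1, x) \<and> p dvd inner4 V (1, x)} \<le> card ?T"
      using finite_A by (intro surj_card_le) auto
    also have "\<dots> \<le> Q" by (rule poor[OF indep_qmul[OF z UV]])
    finally show ?thesis .
  qed
  then have "card {(x, y). x \<in> shadow z \<and> y \<in> shadow z \<and> p dvd 1 + dot3 x y} \<le> 800 * card (shadow z) * Q"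
    using shadow[OF z] Q by (intro card_point_plane_incidences_le[OF p(1)]) (auto simp: box3_def intro: order.trans)
  also have "\<dots> \<le> 800 * card A * Q" using shadow(2)[OF z] by simp
  finally show ?thesis using shadow(4)[OF z] by linarith
qed

end

section \<open>Rectangles on the sphere\<close>

text \<open>Rectangles with anisotropic sides, as quadruples in which \<open>z\<close> and \<open>u\<close> are the neighbours of both \<open>x\<close> and \<open>y\<close>.\<close>

definition rectangles :: "int \<Rightarrow> int vec4 set \<Rightarrow> (int vec4 \<times> int vec4 \<times> int vec4 \<times> int vec4) set" where
  "rectangles p A = {(x, y, z, u). x \<in> A \<and> y \<in> A \<and> z \<in> A \<and> u \<in> A \<and> zero_mod p (x + y - z - u) \<and> niso p x z \<and> niso p y z}"

context sphere_points
begin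

text \<open>Expand \<open>|x + y - z|^2 = t\<close>.\<close>

lemma right_angle:
  assumes "x \<in> A" "y \<in> A" "z \<in> A" "u \<in> A" "zero_mod p (x + y - z - u)"
  shows "p dvd inner4 (x - z) (y - z)"
proof -
  have "2 * inner4 (x - z) (y - z) = inner4 (x + y - z - u) (x + y - z + u) + (inner4 u u - t) - (inner4 x x - t) - (inner4 y y - t) + (inner4 z z - t)"
    by (simp add: inner4_simps inner4_commute[of y x] inner4_commute[of z x] inner4_commute[of z y] inner4_commute[of u x]
        inner4_commute[of u y] inner4_commute[of u z])
  also have "p dvd \<dots>" 
    by (insert zero_mod_inner4[OF assms(5), of "x + y - z + u"] sphere[OF assms(1)] sphere[OF assms(2)] sphere[OF assms(3)] sphere[OF assms(4)],
        (assumption | rule dvd_add dvd_diff)+)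
  finally show ?thesis by (simp only: dvd_double)
qed

lemma fourth_unique:
  assumes "u \<in> A" "u' \<in> A" "zero_mod p (x + y - z - u)" "zero_mod p (x + y - z - u')"
  shows "u = u'"
proof -
  have "u - u' = (x + y - z - u') - (x + y - z - u)" by simp
  then have "zero_mod p (u - u')" using assms(3,4) by (metis zero_mod_diff)
  then show ?thesis using eq_if_zero_mod assms by blast
qed

lemma card_rectangles_le_sum: "card (rectangles p A) \<le> (\<Sum>z\<in>A. card (corners z))"
proof -
  have finc: "finite (corners z)" for z
    by (rule finite_subset[of _ "A \<times> A"]) (use finite_A in \<open>auto simp: corners_def\<close>)
  have "card (rectangles p A) \<le> card (SIGMA z:A. corners z)"
  proof (rule card_inj_on_le[where f = "\<lambda>(x, y, z, u). (z, x, y)"])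
    show "inj_on (\<lambda>(x, y, z, u). (z, x, y)) (rectangles p A)"

    proof (rule inj_onI)
      fix s s' assume s: "s \<in> rectangles p A" "s' \<in> rectangles p A"
        and eq: "(\<lambda>(x, y, z, u). (z, x, y)) s = (\<lambda>(x, y, z, u). (z, x, y)) s'"
      obtain x y z u x' y' z' u' where xy: "s = (x, y, z, u)" "s' = (x', y', z', u')" by (metis prod_cases4)
      have e: "z = z'" "x = x'" "y = y'" using eq by (simp_all add: xy)
      moreover have "u = u'" using s fourth_unique[of u u' x y z] unfolding xy e rectangles_def by blast
      ultimately show "s = s'" by (simp add: xy)
    qed
    show "(\<lambda>(x, y, z, u). (z, x, y)) ` rectangles p A \<subseteq> (SIGMA z:A. corners z)"

    proof
      fix s assume "s \<in> (\<lambda>(x, y, z, u). (z, x, y)) ` rectangles p A"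
      then obtain x y z u where s: "s = (z, x, y)" and r: "(x, y, z, u) \<in> rectangles p A" by fast
      show "s \<in> (SIGMA z:A. corners z)"
        using r right_angle[of x y z u] unfolding s rectangles_def corners_def by blast
    qed
  qed (use finite_A finc in auto)
  then show ?thesis using finite_A finc by (simp add: card_SigmaI)
qed

end

section \<open>Rich plane sections\<close>

lemma sphere_points_subset:
  assumes "sphere_points p t A k" "B \<subseteq> A"
  shows "sphere_points p t B k"
proof -
  interpret sphere_points p t A k by (rule assms)
  show ?thesis
  proof
    show "prime p" "2 < p" "\<not> p dvd t" using p t by auto
    show "B \<subseteq> box4 p" using A assms(2) by blast
    show "p dvd inner4 x x - t" if "x \<in> B" for x using sphere that assms(2) by blast
    show "card {y \<in> B. \<exists>c. zero_mod p (y - x - scl c r)} \<le> k" if "\<not> zero_mod p r" "p dvd inner4 r r" for x r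
    proof -
      have "card {y \<in> B. \<exists>c. zero_mod p (y - x - scl c r)} \<le> card {y \<in> A. \<exists>c. zero_mod p (y - x - scl c r)}"
        using finite_A assms(2) by (intro card_mono) auto
      then show ?thesis using k[OF that, of x] by linarith
    qed
  qed
qed

context sphere_points
begin

definition section_at :: "int vec4 \<Rightarrow> int vec4 \<Rightarrow> int vec4 \<Rightarrow> int vec4 set" where
  "section_at U V z = {x \<in> A. p dvd inner4 U (x - z) \<and> p dvd inner4 V (x - z)}"

lemma section_diff:
  assumes "x \<in> section_at U V z" "y \<in> section_at U V z"
  shows "p dvd inner4 U (x - y)" "p dvd inner4 V (x - y)"
proof -
  have "inner4 W (x - y) = inner4 W (x - z) - inner4 W (y - z)" for W by (simp add: inner4_diff_right)
  then show "p dvd inner4 U (x - y)" "p dvd inner4 V (x - y)" using assms by (simp_all add: section_at_def)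
qed

text \<open>In a plane that contains an isotropic line of the sphere, the equation of the sphere is the product of two linear
  equations, so the points off this line lie on a second line of the sphere.\<close>

lemma isotropic_off_isotropic_line:
  assumes UV: "indep p U V" and r: "\<not> zero_mod p r" "p dvd inner4 r r" "p dvd inner4 U r" "p dvd inner4 V r"
    and z: "z \<in> A" "p dvd inner4 r z"
    and x: "x \<in> A" "p dvd inner4 U (x - z)" "p dvd inner4 V (x - z)" "\<And>c. \<not> zero_mod p (x - z - scl c r)"
    and y: "y \<in> A" "p dvd inner4 U (y - z)" "p dvd inner4 V (y - z)" "\<And>c. \<not> zero_mod p (y - z - scl c r)"
  shows "p dvd inner4 (x - y) (x - y)"
proof -
  define u where "u = x - z"
  define v where "v = y - z"
  have ru: "indep p r u" using indepI[OF p(1) r(1)] x(4) by (simp add: u_def)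
  obtain \<alpha> \<beta> where v0: "zero_mod p (v - scl \<alpha> r - scl \<beta> u)"
    by (rule dependent_of_three_orthogonal[OF p(1) UV ru, of v]) (use r x y in \<open>simp_all add: u_def v_def\<close>)
  define e where "e = v - scl \<alpha> r - scl \<beta> u"
  have e: "p dvd inner4 e w" for w using zero_mod_inner4[OF v0] by (simp add: e_def)
  have v: "v = scl \<alpha> r + scl \<beta> u + e" by (simp add: e_def)
  have \<beta>: "\<not> p dvd \<beta>"
  proof
    assume "p dvd \<beta>"
    then have "zero_mod p (y - z - scl \<alpha> r)"
      using zero_mod_add[OF v0 zero_mod_scl_dvd[of p \<beta> u]] by (simp add: v_def)
    then show False using y(4) by blast
  qed
  have uu: "p dvd inner4 u u + 2 * inner4 u z" and vv: "p dvd inner4 v v + 2 * inner4 v z"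
    using inner_diff_sphere[OF x(1) z(1)] inner_diff_sphere[OF y(1) z(1)] by (simp_all add: u_def v_def)
  have "\<beta> * ((\<beta> - 1) * inner4 u u + 2 * \<alpha> * inner4 r u) = (inner4 v v + 2 * inner4 v z) - \<beta> * (inner4 u u + 2 * inner4 u z)
      - \<alpha>\<^sup>2 * inner4 r r - 2 * \<alpha> * inner4 r z - inner4 e (scl 2 (scl \<alpha> r + scl \<beta> u) + e + scl 2 z)"
    unfolding v by (simp add: inner4_simps inner4_commute[of u r] inner4_commute[of u e] inner4_commute[of r e] algebra_simps power2_eq_square)
  also have "p dvd \<dots>"
    by (insert uu vv r(2) z(2) e, (assumption | rule dvd_diff dvd_mult)+)
  finally have key: "p dvd (\<beta> - 1) * inner4 u u + 2 * \<alpha> * inner4 r u" using \<beta> p(1) by (simp add: prime_dvd_mult_iff)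
  have "inner4 (x - y) (x - y) = inner4 (u - v) (u - v)" by (simp add: u_def v_def)
  also have "\<dots> = (\<beta> - 1) * ((\<beta> - 1) * inner4 u u + 2 * \<alpha> * inner4 r u) + \<alpha>\<^sup>2 * inner4 r r
      - inner4 e (scl 2 (u - scl \<alpha> r - scl \<beta> u) - e)"
    unfolding v by (simp add: inner4_simps inner4_commute[of u r] inner4_commute[of u e] inner4_commute[of r e] algebra_simps power2_eq_square)
  also have "p dvd \<dots>"
    by (insert key r(2) e, (assumption | rule dvd_diff dvd_add dvd_mult)+)
  finally show ?thesis .
qed

text \<open>An isotropic chord would put the section on three isotropic lines, apart from one point: the line of the chord
  and the two isotropic lines through a point off it.\<close>

lemma rich_section_anisotropic:
  assumes UV: "indep p U V" and rich: "3 * k + 1 < card (section_at U V z)"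
    and x: "x \<in> section_at U V z" and x': "x' \<in> section_at U V z" and "x \<noteq> x'"
  shows "niso p x x'"
proof (rule ccontr)
  let ?C = "section_at U V z"
  assume "\<not> niso p x x'"
  define r where "r = x - x'"
  have xA: "x \<in> A" "x' \<in> A" using x x' by (auto simp: section_at_def)
  have r: "\<not> zero_mod p r" "p dvd inner4 r r" "p dvd inner4 U r" "p dvd inner4 V r" "p dvd inner4 r x'"
    using \<open>\<not> niso p x x'\<close> eq_if_zero_mod[OF xA] \<open>x \<noteq> x'\<close> section_diff[OF x x'] isotropic_perp[OF xA]
    by (auto simp: niso_def r_def)
  let ?L = "{y \<in> A. \<exists>c. zero_mod p (y - x' - scl c r)}"
  have L: "card ?L \<le> k" by (rule k[OF r(1,2)])
  have finC: "finite ?C" using finite_A by (simp add: section_at_def)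
  show False
  proof (cases "?C \<subseteq> ?L")
    case True
    then have "card ?C \<le> card ?L" using finite_A by (intro card_mono) auto
    then show False using L rich by linarith
  next
    case False
    then obtain y where y: "y \<in> ?C" "y \<notin> ?L" by blast
    then have yA: "y \<in> A" by (simp add: section_at_def)
    let ?I = "{w \<in> A. w \<noteq> y \<and> p dvd inner4 (w - y) (w - y) \<and> p dvd inner4 U (w - y) \<and> p dvd inner4 V (w - y)}"
    have I: "card ?I \<le> 2 * k" by (rule card_isotropic_in_plane_le[OF yA UV])
    have "?C \<subseteq> ?L \<union> insert y ?I"
    proof
      fix w assume w: "w \<in> ?C"
      then have wA: "w \<in> A" by (simp add: section_at_def)
      show "w \<in> ?L \<union> insert y ?I"
      proof (cases "w \<in> ?L")
        case False
        have "p dvd inner4 (w - y) (w - y)"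
          by (rule isotropic_off_isotropic_line[OF UV r(1-4) xA(2) r(5) wA section_diff[OF w x'] _ yA section_diff[OF y(1) x']])
            (use False wA y yA in blast)+
        then show ?thesis using wA section_diff[OF w y(1)] by blast
      qed blast
    qed
    then have "card ?C \<le> card (?L \<union> insert y ?I)" using finite_A by (intro card_mono) auto
    also have "\<dots> \<le> card ?L + card (insert y ?I)" by (rule card_Un_le)
    also have "card (insert y ?I) \<le> Suc (card ?I)" by (rule card_insert_le_m1) auto
    finally show False using L I rich by linarith
  qed
qed

text \<open>A line that is not isotropic meets the sphere in at most two points.\<close>

lemma rich_section_no_three_collinear:
  assumes UV: "indep p U V" and rich: "3 * k + 1 < card (section_at U V z)"
    and x: "x1 \<in> section_at U V z" "x2 \<in> section_at U V z" "x3 \<in> section_at U V z" "x1 \<noteq> x2" "x1 \<noteq> x3" "x2 \<noteq> x3"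
  shows "\<not> zero_mod p ((x3 - x1) - scl c (x2 - x1))"
proof
  assume e: "zero_mod p ((x3 - x1) - scl c (x2 - x1))"
  have xA: "x1 \<in> A" "x2 \<in> A" "x3 \<in> A" using x by (auto simp: section_at_def)
  define r where "r = x2 - x1"
  define s where "s = x3 - x1"
  have rr: "p dvd inner4 r r + 2 * inner4 r x1" and ss: "p dvd inner4 s s + 2 * inner4 s x1"
    using inner_diff_sphere[OF xA(2,1)] inner_diff_sphere[OF xA(3,1)] by (simp_all add: r_def s_def)
  define w where "w = s - scl c r"
  have w: "p dvd inner4 w v" for v using zero_mod_inner4[OF e] by (simp add: w_def r_def s_def)
  have s: "s = scl c r + w" by (simp add: w_def)
  have "c * (c - 1) * inner4 r r = (inner4 s s + 2 * inner4 s x1) - c * (inner4 r r + 2 * inner4 r x1)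
     - inner4 w (scl (2 * c) r + w + scl 2 x1)"
    unfolding s by (simp add: inner4_simps inner4_commute[of r w] algebra_simps)
  also have "p dvd \<dots>" by (insert rr ss w, (assumption | rule dvd_diff dvd_mult)+)
  finally have "p dvd c * (c - 1) * inner4 r r" .
  moreover have "\<not> p dvd inner4 r r"
    using rich_section_anisotropic[OF UV rich x(2,1)] x(4) by (simp add: niso_def r_def)
  ultimately consider "p dvd c" | "p dvd c - 1" using p(1) by (auto simp: prime_dvd_mult_iff)
  then show False
  proof cases
    case 1
    have "zero_mod p (x3 - x1)" using zero_mod_add[OF e zero_mod_scl_dvd[OF 1, of "x2 - x1"]] by simp
    then show False using eq_if_zero_mod xA x by blast
  next
    case 2
    have "scl c (x2 - x1) - scl (c - 1) (x2 - x1) = x2 - x1" by (cases x2; cases x1) (simp add: algebra_simps)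
    then have "x3 - x2 = ((x3 - x1) - scl c (x2 - x1)) + scl (c - 1) (x2 - x1)" by (simp add: algebra_simps)
    then have "zero_mod p (x3 - x2)" using zero_mod_add[OF e zero_mod_scl_dvd[OF 2, of "x2 - x1"]] by (simp only:)
    then show False using eq_if_zero_mod xA x by blast
  qed
qed

text \<open>Given a side from \<open>z\<close> to \<open>y\<close>, the vertex \<open>x\<close> lies on the hyperplane through \<open>z\<close> perpendicular to the side. Either the
  hyperplane meets the section \<open>C\<close> in at most two points, or it contains three points of \<open>C\<close> and then all of \<open>C\<close>. In the latter
  case the parallel side from \<open>x\<close> to \<open>u\<close> is perpendicular to the plane of \<open>C\<close> as well, which leaves only one \<open>x\<close> for each
  \<open>u\<close>: two of them would differ by an isotropic vector.\<close>

lemma card_rectangles_vertex_in_section_le: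
  assumes UV: "indep p U V" and rich: "3 * k + 1 < card (section_at U V w)"
  shows "card {(x, y, z, u). (x, y, z, u) \<in> rectangles p A \<and> x \<in> section_at U V w} \<le> 3 * (card A)\<^sup>2"
proof -
  let ?C = "section_at U V w"
  have finC: "finite ?C" and CA: "?C \<subseteq> A" using finite_A by (auto simp: section_at_def)
  define D where "D s = {x \<in> ?C. p dvd inner4 (x - fst s) (snd s - fst s)}" for s :: "int vec4 \<times> int vec4"
  have finD: "finite (D s)" for s using finC by (simp add: D_def)
  let ?R = "{(x, y, z, u). (x, y, z, u) \<in> rectangles p A \<and> x \<in> ?C}"
  (* R1 and R2 collect the rectangles whose hyperplane has at most two, or more than two, points in C. *)
  let ?R1 = "{q. q \<in> ?R \<and> (case q of (x, y, z, u) \<Rightarrow> card (D (z, y)) \<le> 2)}"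
  let ?R2 = "{q. q \<in> ?R \<and> \<not> (case q of (x, y, z, u) \<Rightarrow> card (D (z, y)) \<le> 2)}"
  have finR: "finite ?R"
    by (rule finite_subset[of _ "A \<times> A \<times> A \<times> A"]) (use finite_A in \<open>auto simp: rectangles_def\<close>)
  have D: "x \<in> D (z, y)" if "(x, y, z, u) \<in> ?R" for x y z u
    using that right_angle[of x y z u] by (simp add: D_def rectangles_def)
  have perp: "p dvd inner4 (a - a') (y - z)"
    if big: "\<not> card (D (z, y)) \<le> 2" and a: "a \<in> ?C" "a' \<in> ?C" for y z a a'
  proof -
    have "3 \<le> card (D (z, y))" using big by simp
    then obtain S where S: "S \<subseteq> D (z, y)" "card S = 3" by (metis obtain_subset_with_card_n)
    then obtain x1 x2 x3 where X: "S = {x1, x2, x3}" "x1 \<noteq> x2" "x1 \<noteq> x3" "x2 \<noteq> x3" unfolding card_3_iff by blast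
    then have xD: "x1 \<in> D (z, y)" "x2 \<in> D (z, y)" "x3 \<in> D (z, y)" using S by auto
    then have xC: "x1 \<in> ?C" "x2 \<in> ?C" "x3 \<in> ?C" by (auto simp: D_def)
    define v where "v = y - z"
    have xv: "p dvd inner4 (x1 - z) v" "p dvd inner4 (x2 - z) v" "p dvd inner4 (x3 - z) v"
      using xD by (simp_all add: D_def v_def)
    have rv: "p dvd inner4 (x2 - x1) v" "p dvd inner4 (x3 - x1) v"
      using dvd_diff[OF xv(2,1)] dvd_diff[OF xv(3,1)] by (simp_all add: inner4_diff_left)
    have "\<not> zero_mod p (x2 - x1)" using eq_if_zero_mod[of x2 x1] xC CA X by blast
    then have rs: "indep p (x2 - x1) (x3 - x1)"
      by (rule indepI[OF p(1) _ rich_section_no_three_collinear[OF UV rich xC X(2-4)]])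
    have one: "p dvd inner4 (a - x1) v" if aC: "a \<in> ?C" for a
    proof -
      obtain \<alpha> \<beta> where "zero_mod p ((a - x1) - scl \<alpha> (x2 - x1) - scl \<beta> (x3 - x1))"
        using dependent_of_three_orthogonal[OF p(1) UV rs section_diff[OF xC(2,1)] section_diff[OF xC(3,1)] section_diff[OF aC xC(1)]]
        by blast
      from zero_mod_inner4[OF this, of v] have "p dvd inner4 (a - x1) v - \<alpha> * inner4 (x2 - x1) v - \<beta> * inner4 (x3 - x1) v"
        by (simp only: inner4_diff_left[of "a - x1 - _"] inner4_diff_left[of "a - x1"] inner4_scl_left)
      moreover have "inner4 (a - x1) v = (inner4 (a - x1) v - \<alpha> * inner4 (x2 - x1) v - \<beta> * inner4 (x3 - x1) v)
          + \<alpha> * inner4 (x2 - x1) v + \<beta> * inner4 (x3 - x1) v" by simp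
      ultimately show ?thesis using rv by (metis dvd_add dvd_mult)
    qed
    show ?thesis using dvd_diff[OF one[OF a(1)] one[OF a(2)]] by (simp add: inner4_diff_left v_def)
  qed
  have "card ?R1 \<le> card (SIGMA s:{s \<in> A \<times> A. card (D s) \<le> 2}. D s)"
  proof (rule card_inj_on_le[where f = "\<lambda>(x, y, z, u). ((z, y), x)"])
    show "inj_on (\<lambda>(x, y, z, u). ((z, y), x)) ?R1"
    proof (rule inj_onI)
      fix q q' assume q: "q \<in> ?R1" "q' \<in> ?R1" and eq: "(\<lambda>(x, y, z, u). ((z, y), x)) q = (\<lambda>(x, y, z, u). ((z, y), x)) q'"
      obtain x y z u x' y' z' u' where xy: "q = (x, y, z, u)" "q' = (x', y', z', u')" by (metis prod_cases4)
      have e: "z = z'" "x = x'" "y = y'" using eq by (simp_all add: xy)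
      moreover have "u = u'" using q fourth_unique[of u u' x y z] unfolding xy e rectangles_def by blast
      ultimately show "q = q'" by (simp add: xy)
    qed
    show "(\<lambda>(x, y, z, u). ((z, y), x)) ` ?R1 \<subseteq> (SIGMA s:{s \<in> A \<times> A. card (D s) \<le> 2}. D s)"
    proof
      fix q assume "q \<in> (\<lambda>(x, y, z, u). ((z, y), x)) ` ?R1"
      then obtain x y z u where q: "q = ((z, y), x)" and r: "(x, y, z, u) \<in> ?R" "card (D (z, y)) \<le> 2" by fast
      have "z \<in> A" "y \<in> A" using r(1) unfolding rectangles_def by blast+
      then show "q \<in> (SIGMA s:{s \<in> A \<times> A. card (D s) \<le> 2}. D s)" using D[OF r(1)] r(2) unfolding q by blast
    qed
  qed (use finite_A finD in auto)
  also have "\<dots> = (\<Sum>s\<in>{s \<in> A \<times> A. card (D s) \<le> 2}. card (D s))" using finite_A finD by (simp add: card_SigmaI)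
  also have "\<dots> \<le> (\<Sum>s\<in>{s \<in> A \<times> A. card (D s) \<le> 2}. 2)" by (intro sum_mono) auto
  also have "\<dots> \<le> 2 * (card A)\<^sup>2"
    using card_mono[of "A \<times> A" "{s \<in> A \<times> A. card (D s) \<le> 2}"] finite_A by (simp add: card_cartesian_product power2_eq_square)
  finally have R1: "card ?R1 \<le> 2 * (card A)\<^sup>2" .
  have "card ?R2 \<le> card (A \<times> A)"
  proof (rule card_inj_on_le[where f = "\<lambda>(x, y, z, u). (z, u)"])
    show "inj_on (\<lambda>(x, y, z, u). (z, u)) ?R2"
    proof (rule inj_onI)
      fix q q' assume q: "q \<in> ?R2" "q' \<in> ?R2" and eq: "(\<lambda>(x, y, z, u). (z, u)) q = (\<lambda>(x, y, z, u). (z, u)) q'"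
      obtain x y z u x' y' z' u' where xy: "q = (x, y, z, u)" "q' = (x', y', z', u')" by (metis prod_cases4)
      have e: "z' = z" "u' = u" using eq by (simp_all add: xy)
      have xC: "x \<in> ?C" "x' \<in> ?C" and big: "\<not> card (D (z, y)) \<le> 2" "\<not> card (D (z, y')) \<le> 2"
        and z: "zero_mod p (x + y - z - u)" "zero_mod p (x' + y' - z - u)" and yA: "y \<in> A" "y' \<in> A"
        using q unfolding xy e rectangles_def by blast+
      have xx: "x = x'"
      proof (rule ccontr)
        assume "x \<noteq> x'"
        then have "niso p x x'" by (rule rich_section_anisotropic[OF UV rich xC])
        define d where "d = x - x'"
        have "inner4 d d = inner4 d ((y' - z) - (y - z) + (x + y - z - u) - (x' + y' - z - u))"
          by (rule arg_cong[where f = "inner4 d"]) (simp add: d_def)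
        also have "\<dots> = inner4 d (y' - z) - inner4 d (y - z) + inner4 d (x + y - z - u) - inner4 d (x' + y' - z - u)"
        proof -
          have "inner4 d (a - b + c - e) = inner4 d a - inner4 d b + inner4 d c - inner4 d e" for a b c e
            by (simp add: inner4_diff_right inner4_add_right)
          then show ?thesis .
        qed
        also have "p dvd \<dots>"
        proof (intro dvd_add dvd_diff)
          show "p dvd inner4 d (y' - z)" "p dvd inner4 d (y - z)" using perp[OF _ xC] big by (simp_all add: d_def)
          show "p dvd inner4 d (x + y - z - u)" using zero_mod_inner4[OF z(1), of d] by (simp only: inner4_commute[of d])
          show "p dvd inner4 d (x' + y' - z - u)" using zero_mod_inner4[OF z(2), of d] by (simp only: inner4_commute[of d])
        qed
        finally show False using \<open>niso p x x'\<close> by (simp add: niso_def d_def)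
      qed
      have "y - y' = (x + y - z - u) - (x' + y' - z - u)" by (simp add: xx)
      then have "zero_mod p (y - y')" using zero_mod_diff[OF z] by (simp only:)
      then have "y = y'" using eq_if_zero_mod yA by blast
      then show "q = q'" by (simp add: xy e xx)
    qed
    show "(\<lambda>(x, y, z, u). (z, u)) ` ?R2 \<subseteq> A \<times> A"
    proof
      fix q assume "q \<in> (\<lambda>(x, y, z, u). (z, u)) ` ?R2"
      then obtain x y z u where q: "q = (z, u)" and r: "(x, y, z, u) \<in> ?R" by fast
      show "q \<in> A \<times> A" using r unfolding q rectangles_def by blast
    qed
  qed (use finite_A in auto)
  then have R2: "card ?R2 \<le> (card A)\<^sup>2" by (simp add: card_cartesian_product power2_eq_square)
  have "?R = ?R1 \<union> ?R2" by blast
  then have "card ?R \<le> card ?R1 + card ?R2" using card_Un_le[of ?R1 ?R2] by (simp only:)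
  then show ?thesis using R1 R2 by linarith
qed

end

context sphere_points
begin

lemma rectangles_swap: "(x, y, z, u) \<in> rectangles p A \<Longrightarrow> (y, x, z, u) \<in> rectangles p A"
  by (simp add: rectangles_def add.commute)

lemma rectangles_flip:
  assumes "(x, y, z, u) \<in> rectangles p A"
  shows "(z, u, x, y) \<in> rectangles p A"
proof -
  have r: "x \<in> A" "y \<in> A" "z \<in> A" "u \<in> A" "zero_mod p (x + y - z - u)" "niso p x z" "niso p y z"
    using assms by (auto simp only: rectangles_def mem_Collect_eq case_prod_conv)
  define w where "w = x + y - z - u"
  have "zero_mod p (scl (- 1) w)" using r(5) by (simp add: zero_mod_scl w_def)
  moreover have "scl (- 1) w = z + u - x - y" by (cases x; cases y; cases z; cases u) (simp add: w_def)
  ultimately have 1: "zero_mod p (z + u - x - y)" by simp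
  define s where "s = y - z"
  have e: "u - x = s - w" by (simp add: w_def s_def)
  have "inner4 (s - w) (s - w) = inner4 s s - inner4 w (s + (s - w))"
    by (simp add: inner4_simps inner4_commute[of s w])
  then have "inner4 (u - x) (u - x) = inner4 (y - z) (y - z) - inner4 w ((y - z) + (u - x))"
    by (simp only: e s_def)
  moreover have "p dvd inner4 w ((y - z) + (u - x))" using zero_mod_inner4 r(5) by (simp add: w_def)
  ultimately have "niso p u x" using r(7) unfolding niso_def by (metis dvd_diff_left_iff)
  then show ?thesis using r 1 niso_commute[of p x z] by (simp add: rectangles_def)
qed

text \<open>Each of the four vertices can be moved to the first place by a symmetry of the rectangle.\<close>

lemma card_rectangles_remove_section:
  assumes UV: "indep p U V" and rich: "3 * k + 1 < card (section_at U V w)"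
  shows "card (rectangles p A) \<le> card (rectangles p (A - section_at U V w)) + 12 * (card A)\<^sup>2"
proof -
  let ?C = "section_at U V w" and ?R = "rectangles p A"
  let ?X = "{(x, y, z, u). (x, y, z, u) \<in> ?R \<and> x \<in> ?C}" and ?Y = "{(x, y, z, u). (x, y, z, u) \<in> ?R \<and> y \<in> ?C}"
    and ?Z = "{(x, y, z, u). (x, y, z, u) \<in> ?R \<and> z \<in> ?C}" and ?U = "{(x, y, z, u). (x, y, z, u) \<in> ?R \<and> u \<in> ?C}"
  have finR: "finite ?R"
    by (rule finite_subset[of _ "A \<times> A \<times> A \<times> A"]) (use finite_A in \<open>auto simp: rectangles_def\<close>)
  have finX: "finite ?X" by (rule finite_subset[OF _ finR]) blast
  have X: "card ?X \<le> 3 * (card A)\<^sup>2" by (rule card_rectangles_vertex_in_section_le[OF UV rich])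
  have le: "card S \<le> 3 * (card A)\<^sup>2"
    if "inj f" "\<And>q. q \<in> S \<Longrightarrow> f q \<in> ?X" for S and f :: "_ \<Rightarrow> int vec4 \<times> int vec4 \<times> int vec4 \<times> int vec4"
  proof -
    have "card S \<le> card ?X"
      by (rule card_inj_on_le[OF inj_on_subset[OF that(1) subset_UNIV] image_subsetI[OF that(2)] finX])
    then show ?thesis using X by linarith
  qed
  have Y: "card ?Y \<le> 3 * (card A)\<^sup>2"
  proof (rule le[of "\<lambda>(x, y, z, u). (y, x, z, u)"])
    fix q assume "q \<in> ?Y"
    then obtain x y z u where "q = (x, y, z, u)" "(x, y, z, u) \<in> ?R" "y \<in> ?C" by blast
    then show "(\<lambda>(x, y, z, u). (y, x, z, u)) q \<in> ?X" using rectangles_swap by simp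
  qed (auto intro!: injI)
  have Z: "card ?Z \<le> 3 * (card A)\<^sup>2"
  proof (rule le[of "\<lambda>(x, y, z, u). (z, u, x, y)"])
    fix q assume "q \<in> ?Z"
    then obtain x y z u where "q = (x, y, z, u)" "(x, y, z, u) \<in> ?R" "z \<in> ?C" by blast
    then show "(\<lambda>(x, y, z, u). (z, u, x, y)) q \<in> ?X" using rectangles_flip by simp
  qed (auto intro!: injI)
  have U: "card ?U \<le> 3 * (card A)\<^sup>2"
  proof (rule le[of "\<lambda>(x, y, z, u). (u, z, x, y)"])
    fix q assume "q \<in> ?U"
    then obtain x y z u where "q = (x, y, z, u)" "(x, y, z, u) \<in> ?R" "u \<in> ?C" by blast
    then show "(\<lambda>(x, y, z, u). (u, z, x, y)) q \<in> ?X" using rectangles_swap[OF rectangles_flip] by simp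
  qed (auto intro!: injI)
  let ?R' = "rectangles p (A - ?C)"
  have "?R \<subseteq> ?R' \<union> ?X \<union> ?Y \<union> ?Z \<union> ?U"
  proof
    fix q assume q: "q \<in> ?R"
    obtain x y z u where xy: "q = (x, y, z, u)" by (metis prod_cases4)
    show "q \<in> ?R' \<union> ?X \<union> ?Y \<union> ?Z \<union> ?U" using q unfolding xy rectangles_def by blast
  qed
  then have "card ?R \<le> card (?R' \<union> ?X \<union> ?Y \<union> ?Z \<union> ?U)"
  proof (rule card_mono[rotated])
    have "?R' \<subseteq> ?R" by (auto simp only: rectangles_def) 
    then show "finite (?R' \<union> ?X \<union> ?Y \<union> ?Z \<union> ?U)" using finR
      by (intro finite_UnI) (auto intro: finite_subset[OF _ finR])
  qed
  also have "\<dots> \<le> card ?R' + card ?X + card ?Y + card ?Z + card ?U" by (rule card_Un5_le)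
  finally show ?thesis using X Y Z U by linarith
qed

end

text \<open>Each removed section has more than \<open>Q\<close> points and costs \<open>12 n^2\<close> rectangles, so \<open>Q\<close> times the total cost is at most \<open>12 n^2 |A|\<close>.\<close>

lemma card_rectangles_le_by_removal:
  assumes "sphere_points p t A k" and Q: "3 * k + 1 \<le> Q" and n: "card A \<le> n"
    and poor: "\<And>B. B \<subseteq> A \<Longrightarrow> (\<And>U V z. indep p U V \<Longrightarrow> card {x \<in> B. p dvd inner4 U (x - z) \<and> p dvd inner4 V (x - z)} \<le> Q)
       \<Longrightarrow> card (rectangles p B) \<le> F"
  shows "Q * card (rectangles p A) \<le> 12 * n\<^sup>2 * card A + Q * F"
  using assms(1) n poor
proof (induction "card A" arbitrary: A rule: less_induct)
  case less
  interpret sphere_points p t A k by (rule less.prems(1))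
  show ?case
  proof (cases "\<forall>U V z. indep p U V \<longrightarrow> card (section_at U V z) \<le> Q")
    case True
    then have "card {x \<in> A. p dvd inner4 U (x - z) \<and> p dvd inner4 V (x - z)} \<le> Q" if "indep p U V" for U V z
      using that unfolding section_at_def by blast
    then have "card (rectangles p A) \<le> F" by (rule less.prems(3)[OF order_refl])
    then show ?thesis by (simp add: trans_le_add2)
  next
    case False
    then obtain U V z where UV: "indep p U V" and big: "Q < card (section_at U V z)" by (meson not_le)
    let ?C = "section_at U V z" and ?B = "A - section_at U V z"
    have CA: "?C \<subseteq> A" and finC: "finite ?C" using finite_A by (auto simp: section_at_def)
    have cardB: "card ?B + card ?C = card A"
      using card_Diff_subset[OF finC CA] card_mono[OF finite_A CA] by simp
    have IH: "Q * card (rectangles p ?B) \<le> 12 * n\<^sup>2 * card ?B + Q * F"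
    proof (rule less.hyps)
      show "card ?B < card A" using cardB big by linarith
      show "sphere_points p t ?B k" by (rule sphere_points_subset[OF less.prems(1)]) blast
      show "card ?B \<le> n" using cardB less.prems(2) by linarith
      show "card (rectangles p B) \<le> F"
        if "B \<subseteq> ?B" "\<And>U V z. indep p U V \<Longrightarrow> card {x \<in> B. p dvd inner4 U (x - z) \<and> p dvd inner4 V (x - z)} \<le> Q" for B
        using less.prems(3)[of B] that by blast
    qed
    have "Q * card (rectangles p A) \<le> Q * (card (rectangles p ?B) + 12 * (card A)\<^sup>2)"
      using card_rectangles_remove_section[OF UV, of z] big Q by (intro mult_left_mono) auto
    also have "\<dots> \<le> Q * (card (rectangles p ?B) + 12 * n\<^sup>2)"
      using less.prems(2) by (intro mult_left_mono add_left_mono power_mono) auto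
    also have "\<dots> = Q * card (rectangles p ?B) + 12 * n\<^sup>2 * Q" by (simp add: algebra_simps)
    also have "\<dots> \<le> (12 * n\<^sup>2 * card ?B + Q * F) + 12 * n\<^sup>2 * card ?C"
      using IH big by (intro add_mono mult_left_mono) auto
    also have "\<dots> = 12 * n\<^sup>2 * (card ?B + card ?C) + Q * F" by (simp add: algebra_simps)
    finally show ?thesis by (simp only: cardB)
  qed
qed

context sphere_points
begin

lemma card_rectangles_le_small:
  assumes Q: "3 * k + 1 \<le> Q" "card A \<le> Q\<^sup>2" "51200 * int Q \<le> p"
  shows "card (rectangles p A) \<le> 812 * (card A)\<^sup>2 * Q"
proof -
  have Q0: "0 < Q" using Q(1) by linarith
  have "Q * card (rectangles p A) \<le> 12 * (card A)\<^sup>2 * card A + Q * (card A * (800 * card A * Q))"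
  proof (rule card_rectangles_le_by_removal[OF sphere_points_axioms Q(1) order_refl])
    fix B assume B: "B \<subseteq> A" and poor: "\<And>U V z. indep p U V \<Longrightarrow> card {x \<in> B. p dvd inner4 U (x - z) \<and> p dvd inner4 V (x - z)} \<le> Q"
    interpret B: sphere_points p t B k by (rule sphere_points_subset[OF sphere_points_axioms B])
    have BA: "card B \<le> card A" by (rule card_mono[OF finite_A B])
    have "card (rectangles p B) \<le> (\<Sum>z\<in>B. card (B.corners z))" by (rule B.card_rectangles_le_sum)
    also have "\<dots> \<le> (\<Sum>z\<in>B. 800 * card B * Q)"
      using Q BA poor by (intro sum_mono B.card_corners_le_small[OF _ Q0]) auto
    also have "\<dots> = card B * (800 * card B * Q)" by simp
    also have "\<dots> \<le> card A * (800 * card A * Q)" using BA by (intro mult_mono) auto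
    finally show "card (rectangles p B) \<le> card A * (800 * card A * Q)" .
  qed
  also have "\<dots> \<le> 12 * (card A)\<^sup>2 * Q\<^sup>2 + Q * (card A * (800 * card A * Q))"
    using Q(2) by (intro add_right_mono mult_left_mono) auto
  also have "\<dots> = Q * (812 * (card A)\<^sup>2 * Q)" by (simp add: algebra_simps power2_eq_square)
  finally show ?thesis using Q0 by simp
qed

lemma card_rectangles_le_large:
  "real (card (rectangles p A)) \<le> (real (card A)) ^ 3 / p + 2 * p * (real (card A))\<^sup>2"
proof -
  have "real (card (rectangles p A)) \<le> real (\<Sum>z\<in>A. card (corners z))" using card_rectangles_le_sum by (simp only: of_nat_le_iff)
  also have "\<dots> \<le> (\<Sum>z\<in>A. (real (card A))\<^sup>2 / p + 2 * p * card A)"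
    unfolding of_nat_sum by (intro sum_mono card_corners_le_large)
  also have "\<dots> = (real (card A)) ^ 3 / p + 2 * p * (real (card A))\<^sup>2"
    by (simp add: algebra_simps power2_eq_square power3_eq_cube)
  finally show ?thesis .
qed

end

section \<open>From rectangles to the energy\<close>

context sphere_points
begin

definition quadruples :: "(int vec4 \<times> int vec4 \<times> int vec4 \<times> int vec4) set" where
  "quadruples = {(x, y, z, u). x \<in> A \<and> y \<in> A \<and> z \<in> A \<and> u \<in> A \<and> zero_mod p (x + y - z - u)}"

text \<open>A line through the origin meets the sphere only in \<open>z\<close> and \<open>- z\<close>.\<close>

lemma indep_radius_side:
  assumes z: "z \<in> A" and y: "y \<in> A" "y \<noteq> z" "\<not> zero_mod p (y + z)"
  shows "indep p z (y - z)"
proof (rule indepI[OF p(1)])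
  show "\<not> zero_mod p z" using zero_mod_inner4[of p z z] sphere_nonzero[OF z] by blast
  fix c
  show "\<not> zero_mod p (y - z - scl c z)"
  proof
    assume e: "zero_mod p (y - z - scl c z)"
    define w where "w = y - z - scl c z"
    have w: "p dvd inner4 w v" for v using zero_mod_inner4[OF e] by (simp add: w_def)
    have y': "y = z + scl c z + w" by (simp add: w_def)
    have "inner4 y y - inner4 z z = c * (c + 2) * inner4 z z + inner4 w (z + z + scl (2 * c) z + w)"
      unfolding y' by (simp add: inner4_simps inner4_commute[of z w] algebra_simps)
    moreover have "p dvd inner4 y y - inner4 z z" using dvd_diff[OF sphere[OF y(1)] sphere[OF z]] by simp
    ultimately have "p dvd c * (c + 2) * inner4 z z" using w by (metis dvd_add_left_iff)
    then consider "p dvd c" | "p dvd c + 2" using sphere_nonzero[OF z] p(1) by (auto simp: prime_dvd_mult_iff)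
    then show False
    proof cases
      case 1
      have "zero_mod p (y - z)" using zero_mod_add[OF e zero_mod_scl_dvd[OF 1, of z]] by simp
      then show False using eq_if_zero_mod y z by blast
    next
      case 2
      have "y + z = (y - z - scl c z) + scl (c + 2) z" by (cases y; cases z) (simp add: algebra_simps)
      then have "zero_mod p (y + z)" using zero_mod_add[OF e zero_mod_scl_dvd[OF 2, of z]] by (simp only:)
      then show False using y(3) by blast
    qed
  qed
qed

lemma finite_quadruples: "finite quadruples"
  by (rule finite_subset[of _ "A \<times> A \<times> A \<times> A"]) (use finite_A in \<open>auto simp: quadruples_def\<close>)

lemma quadruples_swap: "(x, y, z, u) \<in> quadruples \<Longrightarrow> (y, x, z, u) \<in> quadruples"
  by (simp add: quadruples_def add.commute)

text \<open>The side \<open>x - z\<close> is orthogonal to \<open>y - z\<close> because of the right angle, and orthogonal to \<open>z\<close> because it is isotropic. This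
  leaves the isotropic lines of one plane for \<open>x\<close>.\<close>

lemma card_quadruples_isotropic_side:
  "card {(x, y, z, u). (x, y, z, u) \<in> quadruples \<and> y \<noteq> z \<and> \<not> zero_mod p (y + z) \<and> x \<noteq> z \<and> \<not> niso p x z} \<le> 2 * k * (card A)\<^sup>2"
  (is "card ?S \<le> _")
proof -
  define I where "I s = {x \<in> A. x \<noteq> fst s \<and> p dvd inner4 (x - fst s) (x - fst s) \<and> p dvd inner4 (fst s) (x - fst s) \<and> p dvd inner4 (snd s - fst s) (x - fst s)}" for s
  let ?G = "{s \<in> A \<times> A. snd s \<noteq> fst s \<and> \<not> zero_mod p (snd s + fst s)}"
  have finI: "finite (I s)" for s using finite_A by (simp add: I_def)
  have "card ?S \<le> card (SIGMA s:?G. I s)"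
  proof (rule card_inj_on_le[where f = "\<lambda>(x, y, z, u). ((z, y), x)"])
    show "inj_on (\<lambda>(x, y, z, u). ((z, y), x)) ?S"
    proof (rule inj_onI)
      fix q q' assume q: "q \<in> ?S" "q' \<in> ?S" and eq: "(\<lambda>(x, y, z, u). ((z, y), x)) q = (\<lambda>(x, y, z, u). ((z, y), x)) q'"
      obtain x y z u x' y' z' u' where xy: "q = (x, y, z, u)" "q' = (x', y', z', u')" by (metis prod_cases4)
      have e: "z = z'" "x = x'" "y = y'" using eq by (simp_all add: xy)
      moreover have "u = u'" using q fourth_unique[of u u' x y z] unfolding xy e quadruples_def by blast
      ultimately show "q = q'" by (simp add: xy)
    qed
    show "(\<lambda>(x, y, z, u). ((z, y), x)) ` ?S \<subseteq> (SIGMA s:?G. I s)"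
    proof
      fix q assume "q \<in> (\<lambda>(x, y, z, u). ((z, y), x)) ` ?S"
      then obtain x y z u where q: "q = ((z, y), x)" and r: "(x, y, z, u) \<in> quadruples" "y \<noteq> z" "\<not> zero_mod p (y + z)" "x \<noteq> z" "\<not> niso p x z"
        by fast
      have A: "x \<in> A" "y \<in> A" "z \<in> A" "u \<in> A" "zero_mod p (x + y - z - u)" using r(1) unfolding quadruples_def by blast+
      have iso: "p dvd inner4 (x - z) (x - z)" using r(5) by (simp add: niso_def)
      have "x \<in> I (z, y)"
        using A r iso isotropic_perp[OF A(1,3) iso] right_angle[OF A] inner4_commute[of z "x - z"] inner4_commute[of "y - z" "x - z"]
        by (simp add: I_def)
      then show "q \<in> (SIGMA s:?G. I s)" using A r unfolding q by simp
    qed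
  qed (use finite_A finI in auto)
  also have "\<dots> = (\<Sum>s\<in>?G. card (I s))" using finite_A finI by (simp add: card_SigmaI)
  also have "\<dots> \<le> (\<Sum>s\<in>?G. 2 * k)"
  proof (rule sum_mono)
    fix s assume s: "s \<in> ?G"
    then have "indep p (fst s) (snd s - fst s)" by (intro indep_radius_side) auto
    then show "card (I s) \<le> 2 * k" unfolding I_def using s by (intro card_isotropic_in_plane_le) auto
  qed
  also have "\<dots> = 2 * k * card ?G" by simp
  also have "\<dots> \<le> 2 * k * (card A)\<^sup>2"
    using card_mono[of "A \<times> A" ?G] finite_A by (intro mult_left_mono) (auto simp: card_cartesian_product power2_eq_square)
  finally show ?thesis .
qed

lemma card_quadruples_degenerate_side:
  "card {(x, y, z, u). (x, y, z, u) \<in> quadruples \<and> (x = z \<or> zero_mod p (x + z))} \<le> 2 * (card A)\<^sup>2"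
proof -
  let ?S1 = "{(x, y, z, u). (x, y, z, u) \<in> quadruples \<and> x = z}" and ?S2 = "{(x, y, z, u). (x, y, z, u) \<in> quadruples \<and> zero_mod p (x + z)}"
  have le: "card S \<le> (card A)\<^sup>2"
    if S: "S \<subseteq> quadruples" and x: "\<And>x y z u x' y' u'. (x, y, z, u) \<in> S \<Longrightarrow> (x', y', z, u') \<in> S \<Longrightarrow> x = x'" for S
  proof -
    have "card S \<le> card (A \<times> A)"
    proof (rule card_inj_on_le[where f = "\<lambda>(x, y, z, u). (z, y)"])
      show "inj_on (\<lambda>(x, y, z, u). (z, y)) S"
      proof (rule inj_onI)
        fix q q' assume q: "q \<in> S" "q' \<in> S" and eq: "(\<lambda>(x, y, z, u). (z, y)) q = (\<lambda>(x, y, z, u). (z, y)) q'"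
        obtain a y z u a' y' z' u' where xy: "q = (a, y, z, u)" "q' = (a', y', z', u')" by (metis prod_cases4)
        have e: "z' = z" "y' = y" using eq by (simp_all add: xy)
        have a: "a' = a" using x[of a y z u a' y u'] q unfolding xy e by blast
        have "(a, y, z, u) \<in> quadruples" "(a, y, z, u') \<in> quadruples" using q S unfolding xy e a by blast+
        then have "u = u'" using fourth_unique[of u u' a y z] unfolding quadruples_def by blast
        then show "q = q'" by (simp add: xy e a)
      qed
      show "(\<lambda>(x, y, z, u). (z, y)) ` S \<subseteq> A \<times> A"
      proof
        fix q assume "q \<in> (\<lambda>(x, y, z, u). (z, y)) ` S"
        then obtain x y z u where q: "q = (z, y)" and r: "(x, y, z, u) \<in> S" by fast
        then have "(x, y, z, u) \<in> quadruples" using S by blast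
        then show "q \<in> A \<times> A" unfolding q quadruples_def by blast
      qed
    qed (use finite_A in auto)
    then show ?thesis by (simp add: card_cartesian_product power2_eq_square)
  qed
  have 1: "card ?S1 \<le> (card A)\<^sup>2" by (rule le) blast+
  have 2: "card ?S2 \<le> (card A)\<^sup>2"
  proof (rule le)
    fix x y z u x' y' u' assume q: "(x, y, z, u) \<in> ?S2" "(x', y', z, u') \<in> ?S2"
    then have z: "zero_mod p (x + z)" "zero_mod p (x' + z)" and xA: "x \<in> A" "x' \<in> A" unfolding quadruples_def by blast+
    have "x - x' = (x + z) - (x' + z)" by simp
    then have "zero_mod p (x - x')" using zero_mod_diff[OF z] by (simp only:)
    then show "x = x'" using eq_if_zero_mod xA by blast
  qed blast
  have "{(x, y, z, u). (x, y, z, u) \<in> quadruples \<and> (x = z \<or> zero_mod p (x + z))} = ?S1 \<union> ?S2" by blast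
  then have "card {(x, y, z, u). (x, y, z, u) \<in> quadruples \<and> (x = z \<or> zero_mod p (x + z))} \<le> card ?S1 + card ?S2"
    using card_Un_le[of ?S1 ?S2] by (simp only:)
  then show ?thesis using 1 2 by linarith
qed

text \<open>A quadruple is a rectangle with anisotropic sides, or it has an isotropic side, or \<open>z\<close> coincides with \<open>x\<close> or \<open>y\<close> or is
  opposite to one of them.\<close>

lemma card_quadruples_le: "card quadruples \<le> card (rectangles p A) + 4 * (card A)\<^sup>2 + 4 * k * (card A)\<^sup>2"
proof -
  let ?I = "{(x, y, z, u). (x, y, z, u) \<in> quadruples \<and> y \<noteq> z \<and> \<not> zero_mod p (y + z) \<and> x \<noteq> z \<and> \<not> niso p x z}"
  let ?J = "{(x, y, z, u). (x, y, z, u) \<in> quadruples \<and> x \<noteq> z \<and> \<not> zero_mod p (x + z) \<and> y \<noteq> z \<and> \<not> niso p y z}"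
  let ?S = "{(x, y, z, u). (x, y, z, u) \<in> quadruples \<and> (x = z \<or> zero_mod p (x + z))}"
  let ?T = "{(x, y, z, u). (x, y, z, u) \<in> quadruples \<and> (y = z \<or> zero_mod p (y + z))}"
  have fin: "finite S" if "S \<subseteq> quadruples" for S using that finite_quadruples finite_subset by blast
  have sw: "card S \<le> card S'" if "\<And>x y z u. (x, y, z, u) \<in> S \<Longrightarrow> (y, x, z, u) \<in> S'" "S' \<subseteq> quadruples" for S S'
  proof (rule card_inj_on_le[where f = "\<lambda>(x, y, z, u). (y, x, z, u)"])
    show "(\<lambda>(x, y, z, u). (y, x, z, u)) ` S \<subseteq> S'" using that(1) by fast
  qed (use fin[OF that(2)] in \<open>auto intro!: inj_onI\<close>)
  have I: "card ?I \<le> 2 * k * (card A)\<^sup>2" by (rule card_quadruples_isotropic_side)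
  have S: "card ?S \<le> 2 * (card A)\<^sup>2" by (rule card_quadruples_degenerate_side)
  have "card ?J \<le> card ?I" by (rule sw) (use quadruples_swap in blast)+
  moreover have "card ?T \<le> card ?S" by (rule sw) (use quadruples_swap in blast)+
  moreover have "quadruples \<subseteq> rectangles p A \<union> ?I \<union> ?J \<union> ?S \<union> ?T"
  proof
    fix q assume q: "q \<in> quadruples"
    obtain x y z u where xy: "q = (x, y, z, u)" by (metis prod_cases4)
    show "q \<in> rectangles p A \<union> ?I \<union> ?J \<union> ?S \<union> ?T" using q unfolding xy rectangles_def quadruples_def by blast
  qed
  then have "card quadruples \<le> card (rectangles p A \<union> ?I \<union> ?J \<union> ?S \<union> ?T)"
  proof (rule card_mono[rotated])
    have "rectangles p A \<subseteq> quadruples" unfolding rectangles_def quadruples_def by blast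
    then show "finite (rectangles p A \<union> ?I \<union> ?J \<union> ?S \<union> ?T)" by (intro finite_UnI fin) blast+
  qed
  moreover have "card (rectangles p A \<union> ?I \<union> ?J \<union> ?S \<union> ?T) \<le> card (rectangles p A) + card ?I + card ?J + card ?S + card ?T"
    by (rule card_Un5_le)
  ultimately show ?thesis using I S by linarith
qed

theorem card_quadruples_bound:
  "real (card quadruples) \<le> 1000000 * ((real (card A)) ^ 3 / p + real (card A) powr (5 / 2) + (real (card A))\<^sup>2 * k)"
proof (cases "card A = 0")
  case True
  then have "A = {}" using finite_A by simp
  then have "quadruples = {}" unfolding quadruples_def by blast
  then show ?thesis using p(2) by simp
next
  case False
  define n where "n = real (card A)"
  define q where "q = real_of_int p"
  have n1: "n \<ge> 1" using False by (simp add: n_def)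
  have q0: "q > 0" using p(2) by (simp add: q_def)
  (* The threshold for rich plane sections: at least sqrt n for the incidence theorem, above 3 k for the absence of
     isotropic chords. *)
  define Q where "Q = nat \<lceil>sqrt n\<rceil> + 3 * k + 1"
  have sq: "sqrt n \<le> real (nat \<lceil>sqrt n\<rceil>)" by linarith
  have "real (nat \<lceil>sqrt n\<rceil>) \<le> sqrt n + 1" using n1 by (simp add: of_nat_nat)
  then have Qle: "real Q \<le> sqrt n + 3 * real k + 2" by (simp add: Q_def)
  have "n \<le> (real Q)\<^sup>2"
  proof -
    have "sqrt n \<le> real Q" using sq by (simp add: Q_def)
    then have "(sqrt n)\<^sup>2 \<le> (real Q)\<^sup>2" using n1 by (intro power_mono) auto
    then show ?thesis using n1 by simp
  qed
  then have "real (card A) \<le> real (Q\<^sup>2)" by (simp add: n_def)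
  then have Q2: "card A \<le> Q\<^sup>2" by (simp only: of_nat_le_iff)
  have s1: "1 \<le> sqrt n" using n1 by simp
  have n52: "n powr (5 / 2) = n\<^sup>2 * sqrt n"
  proof -
    have "n powr (5 / 2) = n powr (2 + 1 / 2)" by simp
    also have "\<dots> = n powr 2 * n powr (1 / 2)" by (rule powr_add)
    finally show ?thesis using n1 by (simp add: powr_half_sqrt powr_numeral)
  qed
  have nQ: "n\<^sup>2 * real Q \<le> 3 * (n\<^sup>2 * sqrt n) + 3 * (n\<^sup>2 * k)"
  proof -
    have "real Q \<le> 3 * sqrt n + 3 * real k" using Qle s1 by linarith
    then have "n\<^sup>2 * real Q \<le> n\<^sup>2 * (3 * sqrt n + 3 * real k)" by (rule mult_left_mono) simp
    then show ?thesis by (simp add: algebra_simps)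
  qed
  have nn: "n\<^sup>2 \<le> n\<^sup>2 * sqrt n" using s1 mult_left_mono[of 1 "sqrt n" "n\<^sup>2"] by simp
  have nk: "0 \<le> n\<^sup>2 * real k" "0 \<le> n ^ 3 / q" "0 \<le> n\<^sup>2 * sqrt n" using n1 q0 by auto
  have rect: "real (card (rectangles p A)) \<le> n ^ 3 / q + 102400 * (n\<^sup>2 * real Q)"
  proof (cases "51200 * int Q \<le> p")
    case True
    have "card (rectangles p A) \<le> 812 * (card A)\<^sup>2 * Q"
      by (rule card_rectangles_le_small[OF _ Q2 True]) (simp add: Q_def)
    then have "real (card (rectangles p A)) \<le> real (812 * (card A)\<^sup>2 * Q)" by (simp only: of_nat_le_iff)
    also have "\<dots> = 812 * (n\<^sup>2 * real Q)" by (simp add: n_def)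
    also have "\<dots> \<le> 102400 * (n\<^sup>2 * real Q)" by (intro mult_right_mono) auto
    finally show ?thesis using nk(2) by linarith
  next
    case False
    then have "q \<le> 51200 * real Q"
      unfolding q_def by (metis le_cases of_int_le_iff of_int_mult of_int_numeral of_int_of_nat_eq)
    then have "2 * q * n\<^sup>2 \<le> 2 * (51200 * real Q) * n\<^sup>2" by (intro mult_right_mono) auto
    then show ?thesis using card_rectangles_le_large by (simp add: n_def q_def algebra_simps)
  qed
  have "real (card quadruples) \<le> real (card (rectangles p A) + 4 * (card A)\<^sup>2 + 4 * k * (card A)\<^sup>2)"
    using card_quadruples_le by (simp only: of_nat_le_iff)
  also have "\<dots> = real (card (rectangles p A)) + 4 * n\<^sup>2 + 4 * (n\<^sup>2 * k)" by (simp add: n_def)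
  also have "\<dots> \<le> 1000000 * (n ^ 3 / q + n\<^sup>2 * sqrt n + n\<^sup>2 * k)"
  proof -
    have "R + 4 * m + 4 * t \<le> 1000000 * (a + s + t)"
      if "R \<le> a + 102400 * w" "w \<le> 3 * s + 3 * t" "m \<le> s" "0 \<le> a" "0 \<le> s" "0 \<le> t" for R a s t w m :: real
    proof -
      have "102400 * w \<le> 307200 * s + 307200 * t" using that(2) by linarith
      then have "R + 4 * m + 4 * t \<le> a + 307204 * s + 307204 * t" using that(1,3) by linarith
      also have "\<dots> \<le> 1000000 * (a + s + t)"
        unfolding distrib_left by (intro add_mono mult_right_mono) (use that(4-6) in simp_all)
      finally show ?thesis .
    qed
    from this[OF rect nQ nn nk(2,3,1)] show ?thesis .
  qed
  finally show ?thesis by (simp add: n52 n_def[symmetric] q_def[symmetric])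
qed

end


theorem theorem19:
  shows "\<exists>C::real. C > 0 \<and>
    (\<forall>(p::nat) (t::int) (A :: int vec4 set).
       prime p \<longrightarrow> odd p \<longrightarrow>
       t \<in> carrier (residue_ring (int p)) \<longrightarrow> t \<noteq> \<zero>\<^bsub>residue_ring (int p)\<^esub> \<longrightarrow>
       A \<subseteq> sphere3 (residue_ring (int p)) t \<longrightarrow>
       (let k0 = real (max_isotropic (residue_ring (int p)) A) in
        real (additive_energy (residue_ring (int p)) A)
          \<le> C * (real (card A) ^ 3 / real p + real (card A) powr (5 / 2)
                 + real (card A) * k0 ^ 2 + real (card A) ^ 2 * k0)))"
proof (intro exI[of _ "1000000 :: real"] conjI allI impI)
  fix p :: nat and t :: int and A :: "int vec4 set"
  let ?R = "residue_ring (int p)"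
  let ?k = "max_isotropic ?R A"
  assume p: "prime p" "odd p" and t: "t \<in> carrier ?R" "t \<noteq> \<zero>\<^bsub>?R\<^esub>" and A: "A \<subseteq> sphere3 ?R t"
  have p2: "p > 2" using p by (metis even_numeral le_neq_implies_less prime_ge_2_nat)
  interpret R: residues_prime p ?R by unfold_locales (use p in auto)
  (* The operations of the residue ring are translated to integers modulo p. *)
  have ops: "x \<oplus>\<^bsub>?R\<^esub> y = (x + y) mod p" "x \<otimes>\<^bsub>?R\<^esub> y = x * y mod p" "\<zero>\<^bsub>?R\<^esub> = 0" "carrier ?R = {0..<int p}" for x y
    using p2 by (auto simp: residue_ring_def)
  have box: "space4 ?R = box4 p" by (simp add: space4_def box4_def ops)
  have pw: "x [^]\<^bsub>?R\<^esub> (2::nat) = x ^ 2 mod p" if "0 \<le> x" "x < int p" for x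
    using R.pow_cong[of x 2] that by simp
  have mod0: "x mod int p = y mod int p \<longleftrightarrow> int p dvd x - y" for x y by (rule mod_eq_dvd_iff)
  have add: "add4 ?R x y = add4 ?R z u \<longleftrightarrow> zero_mod p (x + y - z - u)" for x y z u
    by (cases x; cases y; cases z; cases u) (simp add: ops mod0 diff_diff_eq)
  have energy: "additive_energy ?R A = card {(x, y, z, u). x \<in> A \<and> y \<in> A \<and> z \<in> A \<and> u \<in> A \<and> zero_mod p (x + y - z - u)}"
    by (simp only: additive_energy_def add)
  have Abox: "A \<subseteq> box4 p" using A unfolding box[symmetric] sphere3_def by blast
  have finA: "finite A" by (rule finite_subset[OF Abox]) (simp add: box4_def)
  have tp: "\<not> int p dvd t" using t not_dvd_diff_residues[of t "int p" 0] p2 by (simp add: ops)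
  have sph: "int p dvd inner4 x x - t" if x: "x \<in> A" for x
  proof -
    obtain x1 x2 x3 x4 where xx: "x = (x1, x2, x3, x4)" by (metis prod_cases4)
    have "x \<in> sphere3 ?R t" using x A by blast
    moreover have "0 \<le> x1" "x1 < p" "0 \<le> x2" "x2 < p" "0 \<le> x3" "x3 < p" "0 \<le> x4" "x4 < p"
      using x Abox by (auto simp: box4_def xx)
    ultimately have "(((x1\<^sup>2 mod p + x2\<^sup>2 mod p) mod p + x3\<^sup>2 mod p) mod p + x4\<^sup>2 mod p) mod p = t" (is "?s = t")
      by (simp only: xx sphere3_def ops pw mem_Collect_eq case_prod_conv)
    moreover have "[?s = x1\<^sup>2 + x2\<^sup>2 + x3\<^sup>2 + x4\<^sup>2] (mod p)"
      by (intro cong_add cong_mod_left[THEN iffD2] cong_refl)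
    ultimately have "[x1\<^sup>2 + x2\<^sup>2 + x3\<^sup>2 + x4\<^sup>2 = t] (mod p)" using cong_sym by simp
    then show ?thesis by (simp add: xx cong_iff_dvd_diff power2_eq_square)
  qed
  have line: "card {y \<in> A. \<exists>c. zero_mod p (y - x - scl c r)} \<le> ?k"
    if r: "\<not> zero_mod p r" "int p dvd inner4 r r" for x r
  proof (cases "{y \<in> A. \<exists>c. zero_mod p (y - x - scl c r)} = {}")
    case False
    then obtain y0 c0 where y0: "y0 \<in> A" "zero_mod p (y0 - x - scl c0 r)" by blast
    obtain r1 r2 r3 r4 where rr: "r = (r1, r2, r3, r4)" by (metis prod_cases4)
    (* The residues of the direction r, with y0 as base point, describe the same line inside the residue ring. *)
    define s where "s = (r1 mod p, r2 mod p, r3 mod p, r4 mod p)"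
    have iso: "isotropic ?R s"
    proof -
      have "[dot4 ?R s s = inner4 r r] (mod p)"
        unfolding s_def rr dot4.simps inner4.simps ops
        by (intro cong_add cong_mult cong_mod_left[THEN iffD2] cong_refl)
      then have "dot4 ?R s s mod p = 0" using r(2) by (simp add: cong_def dvd_eq_mod_eq_0)
      then have "dot4 ?R s s = 0" by (simp add: s_def ops)
      moreover have "s \<in> space4 ?R" using p2 by (simp add: s_def space4_def ops)
      moreover have "s \<noteq> zero4 ?R" using r(1) by (auto simp: s_def rr zero4_def ops)
      ultimately show ?thesis by (simp add: isotropic_def ops)
    qed
    have y0s: "y0 \<in> space4 ?R" using y0(1) Abox box by blast
    let ?L = "affine_line ?R y0 s"
    have "{y \<in> A. \<exists>c. zero_mod p (y - x - scl c r)} \<subseteq> A \<inter> ?L"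
    proof
      fix y assume "y \<in> {y \<in> A. \<exists>c. zero_mod p (y - x - scl c r)}"
      then obtain c where y: "y \<in> A" "zero_mod p (y - x - scl c r)" by blast
      define d where "d = (c - c0) mod p"
      have "y0 + scl (c - c0) r - y = (y0 - x - scl c0 r) - (y - x - scl c r)"
        by (cases y; cases y0; cases x) (simp add: rr algebra_simps)
      then have z: "zero_mod p (y0 + scl (c - c0) r - y)" using zero_mod_diff[OF y0(2) y(2)] by (simp only:)
      obtain a1 a2 a3 a4 b1 b2 b3 b4 where ab: "y0 = (a1, a2, a3, a4)" "y = (b1, b2, b3, b4)" by (metis prod_cases4)
      have red: "(a + d * (v mod p) mod p) mod p = b" if "int p dvd a + (c - c0) * v - b" "b \<in> {0..<int p}" for a v b
      proof -
        have "(a + d * (v mod p) mod p) mod p = (a + (c - c0) * v) mod p" by (simp add: d_def mod_simps)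
        also have "\<dots> = b mod p" using that(1) by (simp add: mod0)
        also have "\<dots> = b" using that(2) by simp
        finally show ?thesis .
      qed
      have "b1 \<in> {0..<int p}" "b2 \<in> {0..<int p}" "b3 \<in> {0..<int p}" "b4 \<in> {0..<int p}"
        using y(1) Abox by (auto simp: ab box4_def)
      then have "add4 ?R y0 (scale4 ?R d s) = y"
        using z red by (simp add: ab rr s_def ops)
      moreover have "d \<in> carrier ?R" using p2 by (simp add: d_def ops)
      ultimately have "y \<in> ?L" unfolding affine_line_def by blast
      then show "y \<in> A \<inter> ?L" using y(1) by blast
    qed
    then have "card {y \<in> A. \<exists>c. zero_mod p (y - x - scl c r)} \<le> card (A \<inter> ?L)" using finA by (intro card_mono) auto
    also have "\<dots> \<le> ?k"
      unfolding max_isotropic_def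
    proof (rule Max_ge)
      have "card (A \<inter> M) \<le> card A" for M using finA by (intro card_mono) auto
      then show "finite {card (A \<inter> L) | L. L \<in> isotropic_lines ?R}"
        by (rule_tac finite_subset[of _ "{..card A}"]) auto
      have "?L \<in> isotropic_lines ?R" using iso y0s unfolding isotropic_lines_def by blast
      then show "card (A \<inter> ?L) \<in> {card (A \<inter> L) | L. L \<in> isotropic_lines ?R}" by blast
    qed
    finally show ?thesis .
  next
    case True
    show ?thesis unfolding True by simp
  qed
  have loc: "sphere_points (int p) t A ?k"
    by unfold_locales (use p p2 tp Abox sph line in auto)
  then interpret sphere_points "int p" t A ?k .
  have "real (additive_energy ?R A) \<le> 1000000 * (real (card A) ^ 3 / real p + real (card A) powr (5 / 2) + (real (card A))\<^sup>2 * ?k)"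
    using card_quadruples_bound by (simp add: energy quadruples_def)
  also have "\<dots> \<le> 1000000 * (real (card A) ^ 3 / real p + real (card A) powr (5 / 2)
                 + real (card A) * real ?k ^ 2 + real (card A) ^ 2 * real ?k)"
    by simp
  finally show "let k0 = real ?k in real (additive_energy ?R A)
          \<le> 1000000 * (real (card A) ^ 3 / real p + real (card A) powr (5 / 2)
                 + real (card A) * k0 ^ 2 + real (card A) ^ 2 * k0)"
    by (simp add: Let_def)
qed simp

end
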